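(* There is a universal constant $c>0$ such that the following holds. Let $0<\varepsilon<1$, $0<\delta<1$, $2\le s\le 2^{d+1}$, let $\Lambda=\Lambda^{\mathrm{HC}}_{d,s}$ be the hyperbolic cross, and let $\{\phi_{\boldsymbol i}\}_{\boldsymbol i\in\mathbb N_0^d}$ be the tensor Legendre or tensor Chebyshev polynomial basis. Draw $\boldsymbol t_1,\dots,\boldsymbol t_m$ independently according to the corresponding measure $\nu$, with $$m\ \ge\ c\, s^{\gamma}\,L(s,n,\delta,\varepsilon).$$ Then, with probability at least $1-\varepsilon$, the following holds. For every $\eta\ge 0$, every $f\in L^2_\nu(D)\cap L^\infty(D)$ with coefficient sequence $\boldsymbol x$, and data $\boldsymbol y=\boldsymbol A\boldsymbol x_\Lambda+\boldsymbol e$ with unknown error $\boldsymbol e\in\mathbb C^m$, the approximation $\tilde f=\sum_{\boldsymbol i\in\Lambda}\hat x_{\boldsymbol i}\phi_{\boldsymbol i}$ computed from a minimizer (weighted quadratically-constrained basis pursuit) $$\hat{\boldsymbol x}_\Lambda\in\arg\min_{\boldsymbol z\in\mathbb C^n}\|\boldsymbol z\|_{1,\boldsymbol u}\ \text{ s.t. }\ \|\boldsymbol A\boldsymbol z-\boldsymbol y\|_2\le\eta$$ satisfies $$\|f-\tilde f\|_{L^\infty}\le C_1\,\sigma_{s,L}(\boldsymbol x)_{1,\boldsymbol u}+s^{\gamma/2}\big[C_2(\eta+\|\boldsymbol e\|_2)+C_3\mathcal T\big],$$ $$\|f-\tilde f\|_{L^2_\nu}\le C_4\,\frac{\sigma_{s,L}(\boldsymbol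 x)_{1,\boldsymbol u}}{s^{\gamma/2}}+C_5(\eta+\|\boldsymbol e\|_2)+C_6\mathcal T+\|f-f_\Lambda\|_{L^2_\nu},$$ where $$\mathcal T=\mathcal T(\boldsymbol A,\Lambda,\boldsymbol e,\boldsymbol u,\eta):=\min\left\{\frac{\|\boldsymbol z\|_{1,\boldsymbol u}}{s^{\gamma/2}}:\ \boldsymbol z\in\mathbb C^n,\ \|\boldsymbol A\boldsymbol z-\boldsymbol e\|_2\le\eta\right\},$$ and, with $\rho=\frac{4\delta}{1-\delta}$ and $\tau=\frac{\sqrt{1+\delta}}{1-\delta}$, $$C_1=\frac{3+\rho}{1-\rho},\quad C_2=\frac{2\tau}{1-\rho},\quad C_3=\frac{1+\rho}{1-\rho},\quad C_4=\frac{2(1+\rho)(2+\rho)}{1-\rho},\quad C_5=\frac{\tau(9+3\rho)}{1-\rho},\quad C_6=C_4.$$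
   Context: Setting. $d\in\mathbb N$, $D=(-1,1)^d$, $\mathbb N_0=\{0,1,2,\dots\}$. The measure $\nu$ on $D$ is the tensor uniform probability measure $d\nu=2^{-d}d\boldsymbol t$ (Legendre case) or the tensor Chebyshev measure $d\nu=\prod_{\ell=1}^d\frac{1}{\pi\sqrt{1-t_\ell^2}}d\boldsymbol t$ (Chebyshev case). $\{\phi_{\boldsymbol i}\}_{\boldsymbol i\in\mathbb N_0^d}$ is the tensor product of the corresponding univariate orthonormal polynomials; it is an orthonormal basis of $L^2_\nu(D)$. For $f\in L^2_\nu(D)\cap L^\infty(D)$ (complex valued), $\boldsymbol x=(x_{\boldsymbol i})_{\boldsymbol i\in\mathbb N_0^d}$ with $x_{\boldsymbol i}=\langle f,\phi_{\boldsymbol i}\rangle_{L^2_\nu}$, so $f=\sum_{\boldsymbol i}x_{\boldsymbol i}\phi_{\boldsymbol i}$. Weights: $u_{\boldsymbol i}=\|\phi_{\boldsymbol i}\|_{L^\infty}$, i.e. $u_{\boldsymbol i}=\prod_{\ell=1}^d\sqrt{2i_\ell+1}$ (Legendre) and $u_{\boldsymbol i}=2^{\|\boldsymbol i\|_0/2}$ (Chebyshev, $\|\boldsymbol i\|_0$ the number of nonzero entries). $\|\boldsymbol z\|_{1,\boldsymbol u}=\sum_{\boldsymbol i}u_{\boldsymbol i}|z_{\boldsymbol i}|$. For $S\subseteq\mathbb N_0^d$, $|S|_{\boldsymbol u}=\sum_{\boldsymbol i\in S}u_{\boldsymbol i}^2$. A set $S\subseteq\mathbb N_0^d$ is lower if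 $\boldsymbol i\in S$ and $\boldsymbol j\le\boldsymbol i$ componentwise imply $\boldsymbol j\in S$. $\sigma_{s,L}(\boldsymbol z)_{1,\boldsymbol u}=\inf\{\|\boldsymbol z-\boldsymbol z'\|_{1,\boldsymbol u}:|\mathrm{supp}(\boldsymbol z')|\le s,\ \mathrm{supp}(\boldsymbol z')\text{ lower}\}$ (possibly $+\infty$). $K(s)=\max\{|S|_{\boldsymbol u}:S\subseteq\mathbb N_0^d\text{ lower},\ |S|\le s\}$. $\gamma=2$ (Legendre), $\gamma=\ln 3/\ln 2$ (Chebyshev). Hyperbolic cross: $\Lambda^{\mathrm{HC}}_{d,s}=\{\boldsymbol i\in\mathbb N_0^d:\prod_{\ell=1}^d(i_\ell+1)\le s\}$, $n=|\Lambda|$, with a fixed enumeration $\boldsymbol i_1,\dots,\boldsymbol i_n$ of $\Lambda$. Vectors in $\mathbb C^n$ are indexed by $\Lambda$ and identified with sequences on $\mathbb N_0^d$ vanishing off $\Lambda$. $\boldsymbol x_\Lambda=(x_{\boldsymbol i})_{\boldsymbol i\in\Lambda}$ and $f_\Lambda=\sum_{\boldsymbol i\in\Lambda}x_{\boldsymbol i}\phi_{\boldsymbol i}$. Design matrix: $\boldsymbol A\in\mathbb C^{m\times n}$, $A_{ij}=\frac1{\sqrt m}\phi_{\boldsymbol i_j}(\boldsymbol t_i)$. The data are $\boldsymbol y=\boldsymbol A\boldsymbol x_\Lambda+\boldsymbol e$, where the unknown error $\boldsymbol e$ contains the truncation error $\frac{1}{\sqrt m}(f(\boldsymbol t_i)-f_\Lambda(\boldsymbol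 t_i))_{i}$ and possibly any further error. Polylogarithmic factor: $$L(s,n,\delta,\varepsilon)=\frac1{\delta^2}\ln\Big(\frac{K(s)}{\delta^2}\Big)\max\Big\{\frac1{\delta^4}\ln\Big(\frac{K(s)}{\delta^2}\ln\Big(\frac{K(s)}{\delta^2}\Big)\Big)\ln(n),\ \frac1\delta\ln\Big(\frac1{\delta\varepsilon}\ln\Big(\frac{K(s)}{\delta^2}\Big)\Big)\Big\}.$$
   Formalization: The formal theorem additionally assumes ρ<1, i.e. δ<1/5; for δ>1/5 the constants are negative and the bound fails (take η=0, e=0, f a polynomial with σ>0), and at δ=1/5 they are undefined. *)

theory Defs
  imports "HOL-Probability.Probability"
begin

text \<open>
  The constant in the theorem must not depend on the dimension \<open>d\<close>, so \<open>d\<close> is a natural number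
  and not a type: points are functions \<open>nat \<Rightarrow> real\<close> in the product space over \<open>{..<d}\<close>, and
  \<open>\<nat>\<^sub>0\<^sup>d\<close> is the set of functions \<open>nat \<Rightarrow> nat\<close> that vanish from \<open>d\<close> on.
\<close>

datatype family = Legendre | Chebyshev


section \<open>Measures and orthonormal polynomials\<close>

fun nu1 :: "family \<Rightarrow> real measure" where
  "nu1 Legendre = density (restrict_space lborel {-1<..<1}) (\<lambda>t. ennreal (1 / 2))"
| "nu1 Chebyshev = density (restrict_space lborel {-1<..<1}) (\<lambda>t. ennreal (1 / (pi * sqrt (1 - t\<^sup>2))))"

text \<open>The space of this measure is \<open>D = (-1,1)\<^sup>d\<close>.\<close>
definition nu :: "family \<Rightarrow> nat \<Rightarrow> (nat \<Rightarrow> real) measure" where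
  "nu B d = Pi\<^sub>M {..<d} (\<lambda>_. nu1 B)"

text \<open>Law of \<open>m\<close> independent points drawn from \<open>nu\<close>.\<close>
definition sample :: "family \<Rightarrow> nat \<Rightarrow> nat \<Rightarrow> (nat \<Rightarrow> nat \<Rightarrow> real) measure" where
  "sample B d m = Pi\<^sub>M {..<m} (\<lambda>_. nu B d)"

text \<open>Bonnet's recursion, with the classical normalisation \<open>P\<^sub>k(1) = 1\<close>.\<close>
fun legendre_P :: "nat \<Rightarrow> real \<Rightarrow> real" where
  "legendre_P 0 x = 1"
| "legendre_P (Suc 0) x = x"
| "legendre_P (Suc (Suc k)) x =
     ((2 * real k + 3) * x * legendre_P (Suc k) x - (real k + 1) * legendre_P k x) / (real k + 2)"

fun chebyshev_T :: "nat \<Rightarrow> real \<Rightarrow> real" where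
  "chebyshev_T 0 x = 1"
| "chebyshev_T (Suc 0) x = x"
| "chebyshev_T (Suc (Suc k)) x = 2 * x * chebyshev_T (Suc k) x - chebyshev_T k x"

text \<open>The factors make the polynomials orthonormal with respect to the probability measure \<open>nu1\<close>.\<close>
fun phi1 :: "family \<Rightarrow> nat \<Rightarrow> real \<Rightarrow> real" where
  "phi1 Legendre k x = sqrt (2 * real k + 1) * legendre_P k x"
| "phi1 Chebyshev k x = (if k = 0 then 1 else sqrt 2 * chebyshev_T k x)"

definition phi :: "family \<Rightarrow> nat \<Rightarrow> (nat \<Rightarrow> nat) \<Rightarrow> (nat \<Rightarrow> real) \<Rightarrow> real" where
  "phi B d i t = (\<Prod>l<d. phi1 B (i l) (t l))"


section \<open>Function spaces and coefficients\<close>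

definition Linf_norm :: "family \<Rightarrow> nat \<Rightarrow> ((nat \<Rightarrow> real) \<Rightarrow> complex) \<Rightarrow> ennreal" where
  "Linf_norm B d g = esssup (nu B d) (\<lambda>t. ennreal (cmod (g t)))"

definition L2_norm :: "family \<Rightarrow> nat \<Rightarrow> ((nat \<Rightarrow> real) \<Rightarrow> complex) \<Rightarrow> real" where
  "L2_norm B d g = sqrt (LINT t|nu B d. (cmod (g t))\<^sup>2)"

definition L2_Linf :: "family \<Rightarrow> nat \<Rightarrow> ((nat \<Rightarrow> real) \<Rightarrow> complex) set" where
  "L2_Linf B d = {f. f \<in> borel_measurable (nu B d) \<and>
     integrable (nu B d) (\<lambda>t. (cmod (f t))\<^sup>2) \<and> Linf_norm B d f < \<infinity>}"

text \<open>The inner product needs no conjugation, since \<open>phi\<close> is real valued.\<close>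
definition fcoeff :: "family \<Rightarrow> nat \<Rightarrow> ((nat \<Rightarrow> real) \<Rightarrow> complex) \<Rightarrow> (nat \<Rightarrow> nat) \<Rightarrow> complex" where
  "fcoeff B d f i = (LINT t|nu B d. f t * complex_of_real (phi B d i t))"

definition expansion ::
  "family \<Rightarrow> nat \<Rightarrow> (nat \<Rightarrow> nat) set \<Rightarrow> ((nat \<Rightarrow> nat) \<Rightarrow> complex) \<Rightarrow> (nat \<Rightarrow> real) \<Rightarrow> complex" where
  "expansion B d \<Lambda> z t = (\<Sum>i\<in>\<Lambda>. z i * complex_of_real (phi B d i t))"


section \<open>Multi-indices, weights, lower sets\<close>

definition midx :: "nat \<Rightarrow> (nat \<Rightarrow> nat) set" where
  "midx d = {i. \<forall>l\<ge>d. i l = 0}"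

definition weight :: "family \<Rightarrow> nat \<Rightarrow> (nat \<Rightarrow> nat) \<Rightarrow> real" where
  "weight B d i = enn2real (Linf_norm B d (\<lambda>t. complex_of_real (phi B d i t)))"

definition l1u :: "family \<Rightarrow> nat \<Rightarrow> ((nat \<Rightarrow> nat) \<Rightarrow> complex) \<Rightarrow> ennreal" where
  "l1u B d z = (\<Sum>\<^sub>\<infinity>i\<in>midx d. ennreal (weight B d i * cmod (z i)))"

text \<open>Only used for finite \<open>S\<close>.\<close>
definition wcard :: "family \<Rightarrow> nat \<Rightarrow> (nat \<Rightarrow> nat) set \<Rightarrow> real" where
  "wcard B d S = (\<Sum>i\<in>S. (weight B d i)\<^sup>2)"

text \<open>The order on functions is componentwise, and \<open>midx d\<close> is closed downwards.\<close>
definition lower :: "nat \<Rightarrow> (nat \<Rightarrow> nat) set \<Rightarrow> bool" where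
  "lower d S \<longleftrightarrow> S \<subseteq> midx d \<and> (\<forall>i\<in>S. \<forall>j. j \<le> i \<longrightarrow> j \<in> S)"

definition supp :: "((nat \<Rightarrow> nat) \<Rightarrow> complex) \<Rightarrow> (nat \<Rightarrow> nat) set" where
  "supp z = {i. z i \<noteq> 0}"

definition sigma_lower :: "family \<Rightarrow> nat \<Rightarrow> nat \<Rightarrow> ((nat \<Rightarrow> nat) \<Rightarrow> complex) \<Rightarrow> ennreal" where
  "sigma_lower B d s z =
     (INF z'\<in>{z'. finite (supp z') \<and> card (supp z') \<le> s \<and> lower d (supp z')}. l1u B d (\<lambda>i. z i - z' i))"

definition Kfun :: "family \<Rightarrow> nat \<Rightarrow> nat \<Rightarrow> real" where
  "Kfun B d s = Max (wcard B d ` {S. lower d S \<and> finite S \<and> card S \<le> s})"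

fun gam :: "family \<Rightarrow> real" where
  "gam Legendre = 2"
| "gam Chebyshev = ln 3 / ln 2"

definition HC :: "nat \<Rightarrow> nat \<Rightarrow> (nat \<Rightarrow> nat) set" where
  "HC d s = {i \<in> midx d. (\<Prod>l<d. (i l + 1)) \<le> s}"


section \<open>Sampling, recovery, constants\<close>

text \<open>Vectors in \<open>\<complex>\<^sup>n\<close>, indexed by \<open>\<Lambda>\<close> and identified with sequences that vanish off \<open>\<Lambda>\<close>.\<close>
definition vecs :: "(nat \<Rightarrow> nat) set \<Rightarrow> ((nat \<Rightarrow> nat) \<Rightarrow> complex) set" where
  "vecs \<Lambda> = {z. \<forall>i. i \<notin> \<Lambda> \<longrightarrow> z i = 0}"

definition restrict_vec ::
  "(nat \<Rightarrow> nat) set \<Rightarrow> ((nat \<Rightarrow> nat) \<Rightarrow> complex) \<Rightarrow> (nat \<Rightarrow> nat) \<Rightarrow> complex" where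
  "restrict_vec \<Lambda> x i = (if i \<in> \<Lambda> then x i else 0)"

text \<open>Rows \<open>k < m\<close>; columns are indexed by the elements of \<open>\<Lambda>\<close> themselves.\<close>
definition design :: "family \<Rightarrow> nat \<Rightarrow> nat \<Rightarrow> (nat \<Rightarrow> nat \<Rightarrow> real) \<Rightarrow> nat \<Rightarrow> (nat \<Rightarrow> nat) \<Rightarrow> complex" where
  "design B d m t k i = complex_of_real (phi B d i (t k) / sqrt (real m))"

definition mat_vec ::
  "(nat \<Rightarrow> (nat \<Rightarrow> nat) \<Rightarrow> complex) \<Rightarrow> (nat \<Rightarrow> nat) set \<Rightarrow> ((nat \<Rightarrow> nat) \<Rightarrow> complex) \<Rightarrow> nat \<Rightarrow> complex" where
  "mat_vec A \<Lambda> z k = (\<Sum>i\<in>\<Lambda>. A k i * z i)"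

text \<open>Euclidean norm on \<open>\<complex>\<^sup>m\<close>; entries with index at least \<open>m\<close> are ignored.\<close>
definition norm2 :: "nat \<Rightarrow> (nat \<Rightarrow> complex) \<Rightarrow> real" where
  "norm2 m v = L2_set (\<lambda>k. cmod (v k)) {..<m}"

definition feasible ::
  "(nat \<Rightarrow> (nat \<Rightarrow> nat) \<Rightarrow> complex) \<Rightarrow> (nat \<Rightarrow> nat) set \<Rightarrow> nat \<Rightarrow> (nat \<Rightarrow> complex) \<Rightarrow> real
     \<Rightarrow> ((nat \<Rightarrow> nat) \<Rightarrow> complex) set" where
  "feasible A \<Lambda> m y \<eta> = {z \<in> vecs \<Lambda>. norm2 m (\<lambda>k. mat_vec A \<Lambda> z k - y k) \<le> \<eta>}"

text \<open>
  The minimum is attained whenever the feasible set is nonempty. That is the case as soon as the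
  basis pursuit problem with data \<open>A x\<^sub>\<Lambda> + e\<close> has a solution, since its feasible set is a
  translate of this one.
\<close>
definition Tmin ::
  "family \<Rightarrow> nat \<Rightarrow> nat \<Rightarrow> (nat \<Rightarrow> (nat \<Rightarrow> nat) \<Rightarrow> complex) \<Rightarrow> (nat \<Rightarrow> nat) set \<Rightarrow> nat
     \<Rightarrow> (nat \<Rightarrow> complex) \<Rightarrow> real \<Rightarrow> ennreal" where
  "Tmin B d s A \<Lambda> m e \<eta> = (INF z\<in>feasible A \<Lambda> m e \<eta>. l1u B d z / ennreal (real s powr (gam B / 2)))"

definition Lfactor :: "family \<Rightarrow> nat \<Rightarrow> nat \<Rightarrow> nat \<Rightarrow> real \<Rightarrow> real \<Rightarrow> real" where
  "Lfactor B d s n \<delta> \<epsilon> =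
     (let K = Kfun B d s in
      1 / \<delta>\<^sup>2 * ln (K / \<delta>\<^sup>2) *
      max (1 / \<delta> ^ 4 * ln (K / \<delta>\<^sup>2 * ln (K / \<delta>\<^sup>2)) * ln (real n))
          (1 / \<delta> * ln (1 / (\<delta> * \<epsilon>) * ln (K / \<delta>\<^sup>2))))"

text \<open>
  The constants \<open>C1\<close> to \<open>C6\<close> below are meaningful only for \<open>rho \<delta> < 1\<close>, i.e. \<open>\<delta> < 1/5\<close>: their
  denominator \<open>1 - rho \<delta>\<close> vanishes or is negative otherwise. In that range they are all positive,
  so that \<open>ennreal\<close> does not truncate them.
\<close>
definition rho :: "real \<Rightarrow> real" where
  "rho \<delta> = 4 * \<delta> / (1 - \<delta>)"

definition tau :: "real \<Rightarrow> real" where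
  "tau \<delta> = sqrt (1 + \<delta>) / (1 - \<delta>)"

definition C1 :: "real \<Rightarrow> real" where
  "C1 \<delta> = (3 + rho \<delta>) / (1 - rho \<delta>)"

definition C2 :: "real \<Rightarrow> real" where
  "C2 \<delta> = 2 * tau \<delta> / (1 - rho \<delta>)"

definition C3 :: "real \<Rightarrow> real" where
  "C3 \<delta> = (1 + rho \<delta>) / (1 - rho \<delta>)"

definition C4 :: "real \<Rightarrow> real" where
  "C4 \<delta> = 2 * (1 + rho \<delta>) * (2 + rho \<delta>) / (1 - rho \<delta>)"

definition C5 :: "real \<Rightarrow> real" where
  "C5 \<delta> = tau \<delta> * (9 + 3 * rho \<delta>) / (1 - rho \<delta>)"

definition C6 :: "real \<Rightarrow> real" where
  "C6 \<delta> = C4 \<delta>"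

end

theory Submission
  imports Defs
begin

text \<open>
  The proof separates a deterministic statement about the design matrix from a probabilistic one.
  Write \<open>r = s\<^sup>\<gamma>\<^sup>/\<^sup>2\<close>, \<open>u\<close> for the weights and \<open>\<Lambda>\<close> for the hyperbolic cross.

  Deterministic part. Call a matrix a \<^emph>\<open>weighted near-isometry\<close> if it changes the squared Euclidean norm of
  \<open>z\<close> by at most \<open>\<delta>\<close> whenever \<open>z\<close> has Euclidean norm at most \<open>1\<close> and weighted \<open>1\<close>-norm at most
  \<open>2r\<close>. Let \<open>S\<close> have weighted cardinality at most \<open>r\<^sup>2\<close>, and let \<open>b\<close> be the weighted \<open>1\<close>-norm of
  \<open>z\<close> off \<open>S\<close>, divided by \<open>r\<close>. The indices off \<open>S\<close> with \<open>|z\<^sub>i| > u\<^sub>i b / r\<close> have weighted cardinality at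
  most \<open>r\<^sup>2\<close>; the remaining part of \<open>z\<close> has Euclidean norm at most \<open>b\<close> and weighted \<open>1\<close>-norm at most
  \<open>r b\<close>. So both parts of \<open>z\<close> are multiples of vectors that the near-isometry controls, polarization
  shows that their images are nearly orthogonal, and a robust null space property follows
  (\<open>weighted_null_space\<close>). The comparison of a minimizer with a feasible competitor then bounds
  the coefficient error (\<open>recovery\<close>). The approximation error \<open>\<sigma>\<close> refers to lower sets, and those of
  cardinality at most \<open>s\<close> are contained in \<open>\<Lambda>\<close> and have weighted cardinality at most \<open>s\<^sup>\<gamma>\<close>
  (\<open>lower_subset_HC\<close>, \<open>wcard_lower_le\<close>). For the uniform norm one also needs that \<open>f\<close> minus its
  truncation is the sum of the remaining terms, hence that the basis is complete
  (\<open>phi_complete\<close>, \<open>Linf_norm_truncation_le\<close>).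

  Probabilistic part. The real vectors with weighted \<open>1\<close>-norm at most \<open>R = 2r\<close> correspond to \<open>R\<close> times the
  convex hull of the functions \<open>\<plusminus> \<phi>\<^sub>i / u\<^sub>i\<close>, which are bounded by \<open>1\<close>. So one must compare
  the empirical and the true mean of \<open>f\<^sup>2\<close>, uniformly over the convex hull of \<open>n\<close> functions bounded by
  \<open>1\<close>, with an error of order \<open>\<delta>\<close> relative to \<open>\<theta> = 1 / R\<^sup>2\<close> (\<open>conv_hull_quadratic_process\<close>). The
  mean of \<open>f\<^sup>2\<close> is determined, up to factors \<open>1 + \<delta>\<close> and a small remainder, by the measures of the
  superlevel sets \<open>{|f| \<ge> x}\<close> for \<open>x\<close> in a finite geometric progression. Fix such an \<open>x\<close>. A random average \<open>g\<close> of \<open>N\<close>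
  generators, drawn with the convex weights of \<open>f\<close>, is within \<open>\<delta> x / 2\<close> of \<open>f\<close> at any given point
  with probability \<open>1 - \<eta>\<close> as soon as \<open>N \<ge> C \<delta>\<^sup>-\<^sup>2 x\<^sup>-\<^sup>2 log (1 / \<eta>)\<close>. Averaging over the
  random draw compares the superlevel sets of \<open>f\<close> under both measures with those of the averages \<open>g\<close>, and there
  are only \<open>n\<^sup>N\<close> of the latter. For each of them a Chernoff bound with relative error \<open>\<delta>\<close> and
  additive error \<open>\<eta>\<close> fails with probability at most \<open>2 exp (- m \<delta> \<eta> / 2)\<close>. Since level \<open>x\<close> enters the
  integral with factor \<open>x\<^sup>2\<close>, one may take \<open>\<eta>\<close> proportional to \<open>x\<^sup>-\<^sup>2\<close>. With
  \<open>log (1 / \<eta>)\<close> replaced by its largest value, \<open>log (n\<^sup>N)\<close> and the exponent both scale like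
  \<open>x\<^sup>-\<^sup>2\<close>, and every level leads to the same requirement on \<open>m\<close>. The three logarithms of the
  sample complexity come from the number of levels, from \<open>log (1 / \<eta>)\<close>, and from \<open>log n\<close>.

  The argument runs with \<open>s\<^sup>\<gamma>\<close> in place of \<open>K(s)\<close>. Since \<open>s \<le> K(s)\<close> and \<open>\<gamma> \<le> 2\<close>, their logarithms
  are comparable, which is all that the polylogarithmic factor requires (\<open>sample_complexity_bound\<close>).
\<close>


section \<open>Frequencies of events in independent samples\<close>

lemma exp_le_quadratic: "exp x \<le> 1 + x + x\<^sup>2" if "0 \<le> x" "x \<le> 1" for x :: real
  using exp_bound[OF that] by simp

lemma (in prob_space) iid_indicator_mgf:
  assumes A: "A \<in> sets M"
  shows "integrable (Pi\<^sub>M {..<m} (\<lambda>_. M)) (\<lambda>t. exp (\<xi> * (\<Sum>k<m. indicat_real A (t k))))"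
    and "(LINT t|Pi\<^sub>M {..<m} (\<lambda>_. M). exp (\<xi> * (\<Sum>k<m. indicat_real A (t k))))
           \<le> exp (real m * prob A * (exp \<xi> - 1))"
proof -
  interpret P: product_sigma_finite "\<lambda>_::nat. M"
    by unfold_locales
  have eq: "(\<lambda>t. exp (\<xi> * (\<Sum>k<m. indicat_real A (t k)))) =
      (\<lambda>t. \<Prod>k<m. exp (\<xi> * indicat_real A (t k)))"
    by (simp only: sum_distrib_left exp_sum finite_lessThan)
  have e1: "exp (\<xi> * indicat_real A x) = 1 + (exp \<xi> - 1) * indicat_real A x" for x
    by (simp add: indicator_def)
  have int: "integrable M (\<lambda>x. exp (\<xi> * indicat_real A x))"
    unfolding e1 using A by (auto intro!: integrable_real_mult_indicator Bochner_Integration.integrable_add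
      integrable_mult_right simp: emeasure_eq_measure)
  show "integrable (Pi\<^sub>M {..<m} (\<lambda>_. M)) (\<lambda>t. exp (\<xi> * (\<Sum>k<m. indicat_real A (t k))))"
    unfolding eq by (rule P.product_integrable_prod) (use int in auto)
  have "(LINT t|Pi\<^sub>M {..<m} (\<lambda>_. M). exp (\<xi> * (\<Sum>k<m. indicat_real A (t k))))
      = (\<Prod>k<m. LINT x|M. exp (\<xi> * indicat_real A x))"
    unfolding eq by (rule P.product_integral_prod) (use int in auto)
  also have "(LINT x|M. exp (\<xi> * indicat_real A x)) = 1 + prob A * (exp \<xi> - 1)"
    unfolding e1 using A by (subst Bochner_Integration.integral_add)
      (auto simp: emeasure_eq_measure prob_space mult.commute)
  also have "(\<Prod>k<m. 1 + prob A * (exp \<xi> - 1)) \<le> (\<Prod>k<m. exp (prob A * (exp \<xi> - 1)))"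
  proof (intro prod_mono conjI)
    have "0 \<le> (1 - prob A) + prob A * exp \<xi>"
      by (intro add_nonneg_nonneg) auto
    then show "0 \<le> 1 + prob A * (exp \<xi> - 1)" by (simp add: algebra_simps)
  qed (simp add: exp_ge_add_one_self)
  also have "\<dots> = exp (real m * prob A * (exp \<xi> - 1))"
    by (simp add: exp_of_nat_mult[symmetric] mult.assoc)
  finally show "(LINT t|Pi\<^sub>M {..<m} (\<lambda>_. M). exp (\<xi> * (\<Sum>k<m. indicat_real A (t k))))
           \<le> exp (real m * prob A * (exp \<xi> - 1))" .
qed

definition freq :: "nat \<Rightarrow> (nat \<Rightarrow> 'a) \<Rightarrow> 'a set \<Rightarrow> real" where
  "freq m t A = (\<Sum>k<m. indicat_real A (t k)) / real m"

lemma (in prob_space) freq_measurable [measurable]: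
  assumes [measurable]: "A \<in> sets M"
  shows "(\<lambda>t. freq m t A) \<in> borel_measurable (Pi\<^sub>M {..<m} (\<lambda>_. M))"
  unfolding freq_def by measurable

text \<open>
  The mixed relative and additive deviation \<open>\<delta> P + \<eta>\<close> makes the Chernoff exponent linear in \<open>\<eta>\<close>:
  with exponential parameter \<open>\<delta>\<close> itself, the terms proportional to \<open>P\<close> cancel, because
  \<open>exp \<delta> - 1 \<le> \<delta> (1 + \<delta>)\<close>.
\<close>
lemma (in prob_space) freq_upper_tail:
  assumes A: "A \<in> sets M" and m: "0 < m" and \<delta>: "0 < \<delta>" "\<delta> \<le> 1"
  shows "measure (Pi\<^sub>M {..<m} (\<lambda>_. M))
     {t \<in> space (Pi\<^sub>M {..<m} (\<lambda>_. M)). (1 + \<delta>) * prob A + \<eta> \<le> freq m t A} \<le> exp (- (real m * \<delta> * \<eta>))"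
proof -
  let ?P = "Pi\<^sub>M {..<m} (\<lambda>_. M)"
  interpret PP: prob_space ?P by (intro prob_space_PiM) unfold_locales
  let ?u = "\<lambda>t. exp (\<delta> * (\<Sum>k<m. indicat_real A (t k)))"
  let ?c = "exp (\<delta> * real m * ((1 + \<delta>) * prob A + \<eta>))"
  have "{t \<in> space ?P. (1 + \<delta>) * prob A + \<eta> \<le> freq m t A} = {t \<in> space ?P. ?c \<le> ?u t}"
  proof (intro Collect_cong conj_cong refl)
    fix t
    have "?c \<le> ?u t \<longleftrightarrow> \<delta> * (real m * ((1 + \<delta>) * prob A + \<eta>)) \<le> \<delta> * (\<Sum>k<m. indicat_real A (t k))"
      by (simp only: exp_le_cancel_iff mult.assoc)
    then show "(1 + \<delta>) * prob A + \<eta> \<le> freq m t A \<longleftrightarrow> ?c \<le> ?u t"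
      unfolding freq_def using m \<delta> by (simp only: mult_le_cancel_left_pos pos_le_divide_eq of_nat_0_less_iff mult.commute)
  qed
  then have "measure ?P {t \<in> space ?P. (1 + \<delta>) * prob A + \<eta> \<le> freq m t A}
      \<le> (LINT t|?P. ?u t) / ?c"
    by (simp only:) (rule integral_Markov_inequality_measure[OF iid_indicator_mgf(1)[OF A] sets.top]; auto)
  also have "\<dots> \<le> exp (real m * prob A * (exp \<delta> - 1)) / ?c"
    by (intro divide_right_mono iid_indicator_mgf A) auto
  also have "\<dots> = exp (real m * prob A * (exp \<delta> - 1 - \<delta> * (1 + \<delta>)) - real m * \<delta> * \<eta>)"
    unfolding exp_diff[symmetric] by (simp add: algebra_simps)
  also have "\<dots> \<le> exp (- (real m * \<delta> * \<eta>))"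
  proof -
    have "real m * prob A * (exp \<delta> - 1 - \<delta> * (1 + \<delta>)) \<le> 0"
      using exp_le_quadratic[of \<delta>] \<delta> by (intro mult_nonneg_nonpos) (auto simp: power2_eq_square algebra_simps)
    then show ?thesis by simp
  qed
  finally show ?thesis .
qed

text \<open>
  The counterpart with the two measures exchanged. It rests on \<open>exp (- \<delta>) \<le> 1 / (1 + \<delta>)\<close>, and it
  is stated with the factor on the frequency so that later arguments are symmetric in the two measures.
\<close>
lemma (in prob_space) freq_lower_tail:
  assumes A: "A \<in> sets M" and m: "0 < m" and \<delta>: "0 < \<delta>" "\<delta> \<le> 1" and \<eta>: "0 \<le> \<eta>"
  shows "measure (Pi\<^sub>M {..<m} (\<lambda>_. M))
     {t \<in> space (Pi\<^sub>M {..<m} (\<lambda>_. M)). (1 + \<delta>) * freq m t A + \<eta> \<le> prob A} \<le> exp (- (real m * \<delta> * \<eta> / 2))"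
proof -
  let ?P = "Pi\<^sub>M {..<m} (\<lambda>_. M)"
  interpret PP: prob_space ?P by (intro prob_space_PiM) unfold_locales
  let ?u = "\<lambda>t. exp (- \<delta> * (\<Sum>k<m. indicat_real A (t k)))"
  let ?c = "exp (- \<delta> * real m * ((prob A - \<eta>) / (1 + \<delta>)))"
  have "{t \<in> space ?P. (1 + \<delta>) * freq m t A + \<eta> \<le> prob A} = {t \<in> space ?P. ?c \<le> ?u t}"
  proof (intro Collect_cong conj_cong refl)
    fix t
    define S where "S = (\<Sum>k<m. indicat_real A (t k))"
    have "?c \<le> ?u t \<longleftrightarrow> \<delta> * S \<le> \<delta> * (real m * ((prob A - \<eta>) / (1 + \<delta>)))"
      by (simp only: exp_le_cancel_iff mult.assoc mult_minus_left neg_le_iff_le S_def)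
    also have "\<dots> \<longleftrightarrow> S \<le> real m * ((prob A - \<eta>) / (1 + \<delta>))"
      using \<delta> by (intro mult_le_cancel_left_pos) auto
    also have "\<dots> \<longleftrightarrow> (1 + \<delta>) * freq m t A + \<eta> \<le> prob A"
      using m \<delta> by (simp add: freq_def S_def[symmetric] field_simps)
    finally show "(1 + \<delta>) * freq m t A + \<eta> \<le> prob A \<longleftrightarrow> ?c \<le> ?u t" by blast
  qed
  then have "measure ?P {t \<in> space ?P. (1 + \<delta>) * freq m t A + \<eta> \<le> prob A}
      \<le> (LINT t|?P. ?u t) / ?c"
    by (simp only:) (rule integral_Markov_inequality_measure[OF iid_indicator_mgf(1)[OF A] sets.top]; auto)
  also have "\<dots> \<le> exp (real m * prob A * (exp (- \<delta>) - 1)) / ?c"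
    by (intro divide_right_mono iid_indicator_mgf A) auto
  also have "\<dots> = exp (real m * prob A * (exp (- \<delta>) - 1 / (1 + \<delta>)) - real m * \<delta> * \<eta> / (1 + \<delta>))"
  proof -
    define r where "r = 1 / (1 + \<delta>)"
    have r: "\<delta> * r = 1 - r" using \<delta> by (simp add: r_def field_simps)
    have "real m * prob A * (exp (- \<delta>) - 1) - (- \<delta> * real m * ((prob A - \<eta>) * r))
       = real m * prob A * (exp (- \<delta>) - 1 + \<delta> * r) - real m * \<delta> * \<eta> * r"
      by (simp add: algebra_simps)
    then show ?thesis unfolding exp_diff[symmetric] r by (simp add: r_def)
  qed
  also have "\<dots> \<le> exp (- (real m * \<delta> * \<eta> / 2))"
  proof -
    have "exp (- \<delta>) \<le> 1 / (1 + \<delta>)"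
      using exp_ge_add_one_self[of \<delta>] \<delta> by (simp add: exp_minus field_simps)
    then have "real m * prob A * (exp (- \<delta>) - 1 / (1 + \<delta>)) \<le> 0"
      by (intro mult_nonneg_nonpos) auto
    moreover have "real m * \<delta> * \<eta> / 2 \<le> real m * \<delta> * \<eta> / (1 + \<delta>)"
      using \<delta> \<eta> by (intro divide_left_mono) auto
    ultimately show ?thesis by simp
  qed
  finally show ?thesis .
qed

section \<open>Averages of random tuples\<close>

text \<open>
  Hoeffding's lemma for the discrete distribution \<open>p\<close>; the interval \<open>[-1, 1]\<close> has length \<open>2\<close>.
\<close>
lemma finite_hoeffding_mgf:
  fixes p X :: "'a \<Rightarrow> real"
  assumes fin: "finite A" and p: "\<And>a. a \<in> A \<Longrightarrow> 0 \<le> p a" "sum p A = 1"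
    and X: "\<And>a. a \<in> A \<Longrightarrow> \<bar>X a\<bar> \<le> 1" and l: "0 < l"
  defines "\<mu> \<equiv> \<Sum>a\<in>A. p a * X a"
  shows "(\<Sum>a\<in>A. p a * exp (l * (X a - \<mu>))) \<le> exp (l\<^sup>2 / 2)"
proof -
  let ?M = "point_measure A p"
  have "emeasure ?M A = ennreal 1"
    using fin p by (simp add: emeasure_point_measure_finite sum_ennreal)
  then interpret M: prob_space ?M
    by (intro prob_spaceI) (simp add: space_point_measure)
  interpret I: interval_bounded_random_variable ?M X "-1" 1
    by unfold_locales (use X in \<open>auto simp: measurable_point_measure_eq1 abs_le_iff space_point_measure intro!: AE_I2\<close>)
  have \<mu>: "M.expectation X = \<mu>"
    using fin p by (simp add: lebesgue_integral_point_measure_finite \<mu>_def)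
  have "ennreal (\<Sum>a\<in>A. p a * exp (l * (X a - \<mu>))) = (\<integral>\<^sup>+ x. ennreal (exp (l * (X x - \<mu>))) \<partial>?M)"
  proof (subst nn_integral_point_measure_finite[OF fin])
    show "ennreal (\<Sum>a\<in>A. p a * exp (l * (X a - \<mu>))) = (\<Sum>a\<in>A. ennreal (p a) * ennreal (exp (l * (X a - \<mu>))))"
      using p by (subst sum_ennreal[symmetric]) (auto simp: ennreal_mult' intro!: sum.cong)
  qed
  also have "\<dots> \<le> ennreal (exp (l\<^sup>2 * (1 - - 1)\<^sup>2 / 8))"
    using I.Hoeffdings_lemma_nn_integral[OF l] by (simp add: \<mu>)
  finally show ?thesis by (simp add: ennreal_le_iff)
qed

definition avg :: "nat \<Rightarrow> ('a \<Rightarrow> real) \<Rightarrow> (nat \<Rightarrow> 'a) \<Rightarrow> real" where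
  "avg N X \<omega> = (\<Sum>i<N. X (\<omega> i)) / real N"

definition tuples :: "nat \<Rightarrow> 'a set \<Rightarrow> (nat \<Rightarrow> 'a) set" where
  "tuples N A = (\<Pi>\<^sub>E i\<in>{..<N}. A)"

text \<open>
  The probability of \<open>\<omega>\<close> when its entries are drawn independently with distribution \<open>p\<close>. Finite sums
  over tuples replace a product space, so that exchanging them with integrals needs no Fubini theorem.
\<close>
definition tuple_prob :: "nat \<Rightarrow> ('a \<Rightarrow> real) \<Rightarrow> (nat \<Rightarrow> 'a) \<Rightarrow> real" where
  "tuple_prob N p \<omega> = (\<Prod>i<N. p (\<omega> i))"

lemma finite_tuples: "finite A \<Longrightarrow> finite (tuples N A)"
  by (simp add: tuples_def finite_PiE)

lemma tuple_prob_nonneg: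
  "(\<And>a. a \<in> A \<Longrightarrow> 0 \<le> p a) \<Longrightarrow> \<omega> \<in> tuples N A \<Longrightarrow> 0 \<le> tuple_prob N p \<omega>"
  unfolding tuple_prob_def tuples_def by (intro prod_nonneg) auto

lemma sum_tuple_prob_prod:
  "finite A \<Longrightarrow> (\<Sum>\<omega>\<in>tuples N A. tuple_prob N p \<omega> * (\<Prod>i<N. h (\<omega> i))) = (\<Sum>a\<in>A. p a * h a) ^ N"
  unfolding tuple_prob_def tuples_def prod.distrib[symmetric]
  by (subst prod_sum_PiE[symmetric]) auto

lemma sum_tuple_prob: "finite A \<Longrightarrow> sum p A = 1 \<Longrightarrow> (\<Sum>\<omega>\<in>tuples N A. tuple_prob N p \<omega>) = 1"
  using sum_tuple_prob_prod[of A N p "\<lambda>_. 1"] by simp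

lemma avg_upper_tail:
  fixes p X :: "'a \<Rightarrow> real"
  assumes fin: "finite A" and p: "\<And>a. a \<in> A \<Longrightarrow> 0 \<le> p a" "sum p A = 1"
    and X: "\<And>a. a \<in> A \<Longrightarrow> \<bar>X a\<bar> \<le> 1" and h: "0 < h" and N: "0 < N"
  defines "\<mu> \<equiv> \<Sum>a\<in>A. p a * X a"
  shows "(\<Sum>\<omega>\<in>tuples N A. tuple_prob N p \<omega> * of_bool (h \<le> avg N X \<omega> - \<mu>)) \<le> exp (- (real N * h\<^sup>2 / 2))"
proof -
  have "(\<Sum>\<omega>\<in>tuples N A. tuple_prob N p \<omega> * of_bool (h \<le> avg N X \<omega> - \<mu>))
     \<le> (\<Sum>\<omega>\<in>tuples N A. tuple_prob N p \<omega> * (exp (- (real N * h\<^sup>2)) * (\<Prod>i<N. exp (h * (X (\<omega> i) - \<mu>)))))"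
  proof (intro sum_mono mult_left_mono)
    fix \<omega> assume "\<omega> \<in> tuples N A"
    show "0 \<le> tuple_prob N p \<omega>" by (rule tuple_prob_nonneg) fact+
    have e: "exp (- (real N * h\<^sup>2)) * (\<Prod>i<N. exp (h * (X (\<omega> i) - \<mu>)))
       = exp (real N * h * (avg N X \<omega> - \<mu> - h))"
      using N by (simp add: exp_sum[symmetric] exp_add[symmetric] avg_def sum_distrib_left[symmetric]
          sum_subtractf algebra_simps power2_eq_square)
    show "of_bool (h \<le> avg N X \<omega> - \<mu>) \<le> exp (- (real N * h\<^sup>2)) * (\<Prod>i<N. exp (h * (X (\<omega> i) - \<mu>)))"
      unfolding e using N h by auto
  qed
  also have "\<dots> = exp (- (real N * h\<^sup>2)) * (\<Sum>\<omega>\<in>tuples N A. tuple_prob N p \<omega> * (\<Prod>i<N. exp (h * (X (\<omega> i) - \<mu>))))"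
    by (simp add: sum_distrib_left mult_ac)
  also have "\<dots> = exp (- (real N * h\<^sup>2)) * (\<Sum>a\<in>A. p a * exp (h * (X a - \<mu>))) ^ N"
    by (subst sum_tuple_prob_prod[OF fin, where h = "\<lambda>a. exp (h * (X a - \<mu>))"]) simp
  also have "\<dots> \<le> exp (- (real N * h\<^sup>2)) * exp (h\<^sup>2 / 2) ^ N"
    unfolding \<mu>_def using p
    by (intro mult_left_mono power_mono finite_hoeffding_mgf fin X h sum_nonneg mult_nonneg_nonneg) auto
  also have "\<dots> = exp (- (real N * h\<^sup>2 / 2))"
    by (simp add: exp_of_nat_mult[symmetric] exp_add[symmetric])
  finally show ?thesis .
qed

text \<open>
  Maurey's empirical method at a single point: \<open>X a\<close> stands for the value of the generator \<open>a\<close> at that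
  point, and the mean of \<open>X\<close> for the value of the convex combination.
\<close>
lemma avg_tail:
  fixes p X :: "'a \<Rightarrow> real"
  assumes fin: "finite A" and p: "\<And>a. a \<in> A \<Longrightarrow> 0 \<le> p a" "sum p A = 1"
    and X: "\<And>a. a \<in> A \<Longrightarrow> \<bar>X a\<bar> \<le> 1" and h: "0 < h" and N: "0 < N"
  shows "(\<Sum>\<omega>\<in>tuples N A. tuple_prob N p \<omega> * of_bool (h \<le> \<bar>avg N X \<omega> - (\<Sum>a\<in>A. p a * X a)\<bar>))
     \<le> 2 * exp (- (real N * h\<^sup>2 / 2))"
proof -
  let ?\<mu> = "\<Sum>a\<in>A. p a * X a"
  have neg: "avg N (\<lambda>a. - X a) \<omega> - (\<Sum>a\<in>A. p a * - X a) = - (avg N X \<omega> - ?\<mu>)" for \<omega>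
    unfolding avg_def mult_minus_right sum_negf by simp
  have "(\<Sum>\<omega>\<in>tuples N A. tuple_prob N p \<omega> * of_bool (h \<le> \<bar>avg N X \<omega> - ?\<mu>\<bar>))
    \<le> (\<Sum>\<omega>\<in>tuples N A. tuple_prob N p \<omega> * of_bool (h \<le> avg N X \<omega> - ?\<mu>)
         + tuple_prob N p \<omega> * of_bool (h \<le> avg N (\<lambda>a. - X a) \<omega> - (\<Sum>a\<in>A. p a * - X a)))"
  proof (rule sum_mono)
    fix \<omega> assume "\<omega> \<in> tuples N A"
    with p(1) have "0 \<le> tuple_prob N p \<omega>" by (rule tuple_prob_nonneg)
    moreover have "of_bool (h \<le> \<bar>y\<bar>) \<le> (of_bool (h \<le> y) + of_bool (h \<le> - y) :: real)" for y
      by (simp add: abs_if)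
    ultimately show "tuple_prob N p \<omega> * of_bool (h \<le> \<bar>avg N X \<omega> - ?\<mu>\<bar>)
      \<le> tuple_prob N p \<omega> * of_bool (h \<le> avg N X \<omega> - ?\<mu>)
         + tuple_prob N p \<omega> * of_bool (h \<le> avg N (\<lambda>a. - X a) \<omega> - (\<Sum>a\<in>A. p a * - X a))"
      unfolding neg distrib_left[symmetric] by (rule mult_left_mono[rotated])
  qed
  also have "\<dots> \<le> exp (- (real N * h\<^sup>2 / 2)) + exp (- (real N * h\<^sup>2 / 2))"
    unfolding sum.distrib using avg_upper_tail[OF fin p _ h N, of X] avg_upper_tail[OF fin p _ h N, of "\<lambda>a. - X a"] X
    by (intro add_mono) auto
  finally show ?thesis by simp
qed

section \<open>Quadratic processes over convex hulls\<close>

text \<open>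
  Wherever \<open>F \<omega>\<close> reaches \<open>u + h\<close>, either \<open>G \<omega>\<close> reaches \<open>u\<close> or the two differ by at least \<open>h\<close>; the
  second event has \<open>W\<close>-average at most \<open>\<eta>\<close> at every point. It is applied once with \<open>F\<close> and once with
  \<open>G\<close> independent of \<open>\<omega>\<close>.
\<close>
lemma mixture_level_shift:
  fixes F G :: "'i \<Rightarrow> 'd \<Rightarrow> real"
  assumes "prob_space S" and fin: "finite I" and W: "\<And>\<omega>. \<omega> \<in> I \<Longrightarrow> 0 \<le> W \<omega>"
    and F: "\<And>\<omega>. \<omega> \<in> I \<Longrightarrow> F \<omega> \<in> borel_measurable S"
    and G: "\<And>\<omega>. \<omega> \<in> I \<Longrightarrow> G \<omega> \<in> borel_measurable S"
    and FG: "\<And>x. x \<in> space S \<Longrightarrow> (\<Sum>\<omega>\<in>I. W \<omega> * of_bool (h \<le> \<bar>G \<omega> x - F \<omega> x\<bar>)) \<le> \<eta>"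
  shows "(\<Sum>\<omega>\<in>I. W \<omega> * measure S {x \<in> space S. u + h \<le> \<bar>F \<omega> x\<bar>})
       \<le> (\<Sum>\<omega>\<in>I. W \<omega> * measure S {x \<in> space S. u \<le> \<bar>G \<omega> x\<bar>}) + \<eta>"
proof -
  interpret S: prob_space S by fact
  have sets: "{x \<in> space S. v \<le> \<bar>k x\<bar>} \<in> sets S" if [measurable]: "k \<in> borel_measurable S"
    for v and k :: "'d \<Rightarrow> real" by measurable
  have int: "integrable S (indicat_real {x \<in> space S. v \<le> \<bar>k x\<bar>})" if "k \<in> borel_measurable S"
    for v and k :: "'d \<Rightarrow> real" using sets[OF that] by (simp add: S.emeasure_eq_measure)
  have sum_eq: "(\<Sum>\<omega>\<in>I. W \<omega> * measure S {x \<in> space S. v \<le> \<bar>K \<omega> x\<bar>})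
      = (LINT x|S. (\<Sum>\<omega>\<in>I. W \<omega> * indicat_real {x \<in> space S. v \<le> \<bar>K \<omega> x\<bar>} x))"
    and sum_int: "integrable S (\<lambda>x. \<Sum>\<omega>\<in>I. W \<omega> * indicat_real {x \<in> space S. v \<le> \<bar>K \<omega> x\<bar>} x)"
    if K: "\<And>\<omega>. \<omega> \<in> I \<Longrightarrow> K \<omega> \<in> borel_measurable S" for v and K :: "'i \<Rightarrow> 'd \<Rightarrow> real"
  proof -
    show "integrable S (\<lambda>x. \<Sum>\<omega>\<in>I. W \<omega> * indicat_real {x \<in> space S. v \<le> \<bar>K \<omega> x\<bar>} x)"
      by (intro Bochner_Integration.integrable_sum integrable_mult_right int K)
    show "(\<Sum>\<omega>\<in>I. W \<omega> * measure S {x \<in> space S. v \<le> \<bar>K \<omega> x\<bar>})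
      = (LINT x|S. (\<Sum>\<omega>\<in>I. W \<omega> * indicat_real {x \<in> space S. v \<le> \<bar>K \<omega> x\<bar>} x))"
      using sets[OF K] by (subst Bochner_Integration.integral_sum)
        (auto intro!: integrable_mult_right int K sum.cong)
  qed
  have "(LINT x|S. (\<Sum>\<omega>\<in>I. W \<omega> * indicat_real {x \<in> space S. u + h \<le> \<bar>F \<omega> x\<bar>} x))
    \<le> (LINT x|S. (\<Sum>\<omega>\<in>I. W \<omega> * indicat_real {x \<in> space S. u \<le> \<bar>G \<omega> x\<bar>} x) + \<eta>)"
  proof (rule integral_mono)
    fix x assume x: "x \<in> space S"
    have "(\<Sum>\<omega>\<in>I. W \<omega> * indicat_real {x \<in> space S. u + h \<le> \<bar>F \<omega> x\<bar>} x)
       \<le> (\<Sum>\<omega>\<in>I. W \<omega> * (indicat_real {x \<in> space S. u \<le> \<bar>G \<omega> x\<bar>} x + of_bool (h \<le> \<bar>G \<omega> x - F \<omega> x\<bar>)))"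
      using x by (intro sum_mono mult_left_mono W) (auto simp: indicator_def)
    also have "\<dots> \<le> (\<Sum>\<omega>\<in>I. W \<omega> * indicat_real {x \<in> space S. u \<le> \<bar>G \<omega> x\<bar>} x) + \<eta>"
      using FG[OF x] by (simp only: distrib_left sum.distrib add_le_cancel_left)
    finally show "(\<Sum>\<omega>\<in>I. W \<omega> * indicat_real {x \<in> space S. u + h \<le> \<bar>F \<omega> x\<bar>} x)
       \<le> (\<Sum>\<omega>\<in>I. W \<omega> * indicat_real {x \<in> space S. u \<le> \<bar>G \<omega> x\<bar>} x) + \<eta>" .
  qed (auto intro!: Bochner_Integration.integrable_add sum_int F G)
  also have "\<dots> = (LINT x|S. (\<Sum>\<omega>\<in>I. W \<omega> * indicat_real {x \<in> space S. u \<le> \<bar>G \<omega> x\<bar>} x)) + \<eta>"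
    by (subst Bochner_Integration.integral_add) (auto intro!: sum_int G simp: S.prob_space)
  finally show ?thesis
    by (simp only: sum_eq[OF F] sum_eq[OF G])
qed

text \<open>
  If superlevel sets of all \<open>N\<close>-fold averages have comparable measures, then so do those of all convex
  combinations, at the price of moving the level by \<open>h\<close> on either side. Averaging over the random tuple
  is used in both spaces, so no tuple has to approximate the combination everywhere. Both
  \<open>Q\<close> and \<open>Q'\<close> are arbitrary because the empirical measure will play either role.
\<close>
lemma avg_level_compare:
  fixes g :: "'a \<Rightarrow> 'b \<Rightarrow> real" and g' :: "'a \<Rightarrow> 'c \<Rightarrow> real"
  assumes Q: "prob_space Q" and Q': "prob_space Q'"
    and fin: "finite A" and p: "\<And>a. a \<in> A \<Longrightarrow> 0 \<le> p a" "sum p A = 1"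
    and gm: "\<And>a. a \<in> A \<Longrightarrow> g a \<in> borel_measurable Q"
    and gm': "\<And>a. a \<in> A \<Longrightarrow> g' a \<in> borel_measurable Q'"
    and g: "\<And>a x. a \<in> A \<Longrightarrow> x \<in> space Q \<Longrightarrow> \<bar>g a x\<bar> \<le> 1"
    and g': "\<And>a x. a \<in> A \<Longrightarrow> x \<in> space Q' \<Longrightarrow> \<bar>g' a x\<bar> \<le> 1"
    and h: "0 < h" and N: "0 < N" and tail: "2 * exp (- (real N * h\<^sup>2 / 2)) \<le> \<eta>"
    and \<delta>: "0 \<le> \<delta>" "\<delta> \<le> 1"
    and cmp: "\<And>\<omega>. \<omega> \<in> tuples N A \<Longrightarrow>
       measure Q {x \<in> space Q. r \<le> \<bar>avg N (\<lambda>a. g a x) \<omega>\<bar>}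
         \<le> (1 + \<delta>) * measure Q' {x \<in> space Q'. r \<le> \<bar>avg N (\<lambda>a. g' a x) \<omega>\<bar>} + \<eta>"
  shows "measure Q {x \<in> space Q. r + h \<le> \<bar>\<Sum>a\<in>A. p a * g a x\<bar>}
     \<le> (1 + \<delta>) * measure Q' {x \<in> space Q'. r - h \<le> \<bar>\<Sum>a\<in>A. p a * g' a x\<bar>} + 4 * \<eta>"
proof -
  let ?W = "tuple_prob N p" and ?I = "tuples N A"
  let ?F = "\<lambda>x. \<Sum>a\<in>A. p a * g a x" and ?F' = "\<lambda>x. \<Sum>a\<in>A. p a * g' a x"
  have W: "0 \<le> ?W \<omega>" if "\<omega> \<in> ?I" for \<omega> using tuple_prob_nonneg p(1) that by metis
  have W1: "sum ?W ?I = 1" by (rule sum_tuple_prob) fact+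
  have finI: "finite ?I" by (rule finite_tuples) fact
  have mem: "\<omega> i \<in> A" if "\<omega> \<in> ?I" "i < N" for \<omega> i using that by (auto simp: tuples_def)
  have am: "(\<lambda>x. avg N (\<lambda>a. g a x) \<omega>) \<in> borel_measurable Q" if "\<omega> \<in> ?I" for \<omega>
    unfolding avg_def by (intro borel_measurable_divide borel_measurable_sum gm mem[OF that]) auto
  have am': "(\<lambda>x. avg N (\<lambda>a. g' a x) \<omega>) \<in> borel_measurable Q'" if "\<omega> \<in> ?I" for \<omega>
    unfolding avg_def by (intro borel_measurable_divide borel_measurable_sum gm' mem[OF that]) auto
  have Fm: "?F \<in> borel_measurable Q" "?F' \<in> borel_measurable Q'"
    by (auto intro!: borel_measurable_sum borel_measurable_times gm gm')
  have "measure Q {x \<in> space Q. r + h \<le> \<bar>?F x\<bar>} = (\<Sum>\<omega>\<in>?I. ?W \<omega> * measure Q {x \<in> space Q. r + h \<le> \<bar>?F x\<bar>})"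
    by (simp add: sum_distrib_right[symmetric] W1)
  also have "\<dots> \<le> (\<Sum>\<omega>\<in>?I. ?W \<omega> * measure Q {x \<in> space Q. r \<le> \<bar>avg N (\<lambda>a. g a x) \<omega>\<bar>}) + \<eta>"
    by (intro mixture_level_shift Q finI W Fm am order.trans[OF avg_tail tail] fin p g h N)
  also have "\<dots> \<le> (\<Sum>\<omega>\<in>?I. ?W \<omega> * ((1 + \<delta>) * measure Q' {x \<in> space Q'. r \<le> \<bar>avg N (\<lambda>a. g' a x) \<omega>\<bar>} + \<eta>)) + \<eta>"
    by (intro add_right_mono sum_mono mult_left_mono cmp W)
  also have "\<dots> = (1 + \<delta>) * (\<Sum>\<omega>\<in>?I. ?W \<omega> * measure Q' {x \<in> space Q'. (r - h) + h \<le> \<bar>avg N (\<lambda>a. g' a x) \<omega>\<bar>}) + 2 * \<eta>"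
  proof -
    have "(\<Sum>\<omega>\<in>?I. ?W \<omega> * \<eta>) = \<eta>" by (simp add: sum_distrib_right[symmetric] W1)
    then show ?thesis
      unfolding distrib_left sum.distrib by (simp add: sum_distrib_left mult_ac)
  qed
  also have "\<dots> \<le> (1 + \<delta>) * ((\<Sum>\<omega>\<in>?I. ?W \<omega> * measure Q' {x \<in> space Q'. r - h \<le> \<bar>?F' x\<bar>}) + \<eta>) + 2 * \<eta>"
  proof (intro add_right_mono mult_left_mono mixture_level_shift Q' finI W Fm am')
    show "(\<Sum>\<omega>\<in>?I. ?W \<omega> * of_bool (h \<le> \<bar>?F' x - avg N (\<lambda>a. g' a x) \<omega>\<bar>)) \<le> \<eta>" if "x \<in> space Q'" for x
      by (subst abs_minus_commute) (intro order.trans[OF avg_tail tail] fin p g' h N that)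
  qed (use \<delta> in auto)
  also have "\<dots> = (1 + \<delta>) * (measure Q' {x \<in> space Q'. r - h \<le> \<bar>?F' x\<bar>} + \<eta>) + 2 * \<eta>"
    by (simp add: sum_distrib_right[symmetric] W1)
  also have "\<dots> \<le> (1 + \<delta>) * measure Q' {x \<in> space Q'. r - h \<le> \<bar>?F' x\<bar>} + 4 * \<eta>"
  proof -
    have "0 \<le> \<eta>" using tail by (rule order.trans[rotated]) simp
    then have "(1 + \<delta>) * \<eta> \<le> 2 * \<eta>" using \<delta> by (intro mult_right_mono) auto
    then show ?thesis by (simp add: algebra_simps)
  qed
  finally show ?thesis .
qed

text \<open>
  The two staircase functions built on a decreasing sequence enclose the identity: the larger one jumps at
  the lower end of each step, the smaller one at the upper end. For a geometric sequence they differ by a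
  constant factor, up to the last term of the sequence.
\<close>
lemma staircase_upper:
  fixes a :: "nat \<Rightarrow> real"
  assumes "antimono a" "a 0 = 1" "0 \<le> y" "y \<le> 1" "\<And>n. 0 \<le> a n"
  shows "y \<le> a J + (\<Sum>j<J. (a j - a (Suc j)) * of_bool (a (Suc j) \<le> y))"
proof (induction J)
  case (Suc J)
  show ?case
  proof (cases "a (Suc J) \<le> y")
    case True
    then show ?thesis using Suc by simp
  next
    case False
    have "0 \<le> (\<Sum>j<Suc J. (a j - a (Suc j)) * of_bool (a (Suc j) \<le> y))"
      using antimonoD[OF assms(1)] by (intro sum_nonneg mult_nonneg_nonneg) auto
    then show ?thesis using False by linarith
  qed
qed (use assms in auto)

lemma staircase_lower:
  fixes a :: "nat \<Rightarrow> real"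
  assumes "antimono a" "0 \<le> y" "\<And>n. 0 \<le> a n"
  shows "(\<Sum>j<J. (a j - a (Suc j)) * of_bool (a j \<le> y)) \<le> y"
proof -
  have "(\<Sum>j<J. (a j - a (Suc j)) * of_bool (a j \<le> y)) \<le> max 0 (y - a J)"
  proof (induction J)
    case (Suc J)
    then show ?case using antimonoD[OF assms(1), of J "Suc J"] by (auto simp: of_bool_def)
  qed simp
  also have "\<dots> \<le> y" using assms by auto
  finally show ?thesis .
qed

text \<open>
  The hypothesis compares level \<open>Suc j\<close> of \<open>F\<close> with level \<open>j + 2\<close> of \<open>F'\<close>. The lower staircase for
  \<open>F'\<close> has step \<open>x\<^sub>j\<^sub>+\<^sub>2\<^sup>2 - x\<^sub>j\<^sub>+\<^sub>3\<^sup>2\<close> at that level, which is smaller than the step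
  \<open>x\<^sub>j\<^sup>2 - x\<^sub>j\<^sub>+\<^sub>1\<^sup>2\<close> of the upper staircase for \<open>F\<close> by the factor \<open>(1 + \<delta>)\<^sup>4\<close>; the fifth
  factor comes from the hypothesis.
\<close>
lemma square_integral_compare:
  fixes F :: "'b \<Rightarrow> real" and F' :: "'c \<Rightarrow> real"
  assumes Q: "prob_space Q" and Q': "prob_space Q'"
    and [measurable]: "F \<in> borel_measurable Q" "F' \<in> borel_measurable Q'"
    and F1: "\<And>x. x \<in> space Q \<Longrightarrow> \<bar>F x\<bar> \<le> 1" and F1': "\<And>x. x \<in> space Q' \<Longrightarrow> \<bar>F' x\<bar> \<le> 1"
    and \<delta>: "0 < \<delta>" 
  defines "x \<equiv> \<lambda>j::nat. inverse (1 + \<delta>) ^ j"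
  assumes cmp: "\<And>j. j < J \<Longrightarrow> measure Q {y \<in> space Q. x (Suc j) \<le> \<bar>F y\<bar>}
       \<le> (1 + \<delta>) * measure Q' {y \<in> space Q'. x (j + 2) \<le> \<bar>F' y\<bar>} + e j"
  shows "(LINT y|Q. (F y)\<^sup>2) \<le> (1 + \<delta>) ^ 5 * (LINT y|Q'. (F' y)\<^sup>2) + (x J)\<^sup>2 + (\<Sum>j<J. ((x j)\<^sup>2 - (x (Suc j))\<^sup>2) * e j)"
proof -
  interpret Q: prob_space Q by fact
  interpret Q': prob_space Q' by fact
  define a where "a j = (x j)\<^sup>2" for j
  have q: "0 < inverse (1 + \<delta>)" "inverse (1 + \<delta>) \<le> 1" using \<delta> by (auto simp: field_simps)
  have x0: "0 < x j" for j using q by (simp add: x_def)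
  have xdec: "x (Suc j) \<le> x j" for j using q by (auto simp: x_def intro!: mult_left_le_one_le)
  have anti: "antimono a" unfolding a_def
    by (intro decseq_SucI power_mono xdec less_imp_le[OF x0])
  have a0: "a 0 = 1" "0 \<le> a n" for n by (auto simp: a_def x_def)
  have a_Suc: "a j = (1 + \<delta>)\<^sup>2 * a (Suc j)" for j
    using q unfolding a_def by (simp add: x_def power_mult_distrib[symmetric] mult.assoc[symmetric])
  have a_2: "a j = (1 + \<delta>) ^ 4 * a (j + 2)" for j
    by (subst a_Suc, subst a_Suc) (simp add: mult.assoc[symmetric] power_add[symmetric])
  have a_shift: "a j - a (Suc j) = (1 + \<delta>) ^ 4 * (a (j + 2) - a (j + 3))" for j
    using a_2[of j] a_2[of "Suc j"] by (simp add: right_diff_distrib eval_nat_numeral)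
  have lev: "a j \<le> y\<^sup>2 \<longleftrightarrow> x j \<le> \<bar>y\<bar>" for j y
    unfolding a_def using x0[of j] by (metis abs_le_square_iff abs_of_pos)
  have sq1: "y\<^sup>2 \<le> 1" if "\<bar>y\<bar> \<le> 1" for y :: real using that by (simp add: abs_square_le_1)
  have dif: "0 \<le> a j - a (Suc j)" for j using antimonoD[OF anti, of j "Suc j"] by simp
  have int: "integrable Q (\<lambda>y. (F y)\<^sup>2)" 
    by (rule Q.integrable_const_bound[of _ 1]) (auto intro!: AE_I2 sq1 F1)
  have int': "integrable Q' (\<lambda>y. (F' y)\<^sup>2)" 
    by (rule Q'.integrable_const_bound[of _ 1]) (auto intro!: AE_I2 sq1 F1')
  let ?S = "\<lambda>j. {y \<in> space Q. x j \<le> \<bar>F y\<bar>}" and ?S' = "\<lambda>j. {y \<in> space Q'. x j \<le> \<bar>F' y\<bar>}"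
  have S: "integrable Q (indicat_real (?S j))" for j by (simp add: Q.emeasure_eq_measure)
  have S': "integrable Q' (indicat_real (?S' j))" for j by (simp add: Q'.emeasure_eq_measure)
  have "(LINT y|Q. (F y)\<^sup>2) \<le> (LINT y|Q. a J + (\<Sum>j<J. (a j - a (Suc j)) * indicat_real (?S (Suc j)) y))"
  proof (intro integral_mono int Bochner_Integration.integrable_add Bochner_Integration.integrable_sum
        integrable_mult_right S)
    fix y assume y: "y \<in> space Q"
    show "(F y)\<^sup>2 \<le> a J + (\<Sum>j<J. (a j - a (Suc j)) * indicat_real (?S (Suc j)) y)"
      using staircase_upper[OF anti a0(1) _ sq1[OF F1[OF y]] a0(2), of J] y
      by (simp add: lev indicator_def)
  qed auto
  also have "\<dots> = a J + (\<Sum>j<J. (a j - a (Suc j)) * measure Q (?S (Suc j)))"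
  proof -
    have "integrable Q (\<lambda>y. \<Sum>j<J. (a j - a (Suc j)) * indicat_real (?S (Suc j)) y)"
      by (intro Bochner_Integration.integrable_sum integrable_mult_right S)
    note Bochner_Integration.integral_add[OF Q.integrable_const this, of "a J"]
    also have "(LINT y|Q. (\<Sum>j<J. (a j - a (Suc j)) * indicat_real (?S (Suc j)) y))
        = (\<Sum>j<J. (a j - a (Suc j)) * measure Q (?S (Suc j)))"
      by (subst Bochner_Integration.integral_sum[OF integrable_mult_right[OF S]]) simp
    finally show ?thesis by (simp add: Q.prob_space)
  qed
  also have "\<dots> \<le> a J + (\<Sum>j<J. (a j - a (Suc j)) * ((1 + \<delta>) * measure Q' (?S' (j + 2)) + e j))"
    by (intro add_left_mono sum_mono mult_left_mono dif cmp) auto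
  also have "\<dots> = (1 + \<delta>) ^ 5 * (\<Sum>j<J. (a (j + 2) - a (j + 3)) * measure Q' (?S' (j + 2)))
      + a J + (\<Sum>j<J. (a j - a (Suc j)) * e j)"
  proof -
    have "(a j - a (Suc j)) * ((1 + \<delta>) * measure Q' (?S' (j + 2)) + e j) =
      (1 + \<delta>) ^ 5 * ((a (j + 2) - a (j + 3)) * measure Q' (?S' (j + 2))) + (a j - a (Suc j)) * e j" for j
    proof -
      have "(a j - a (Suc j)) * ((1 + \<delta>) * measure Q' (?S' (j + 2)))
        = (1 + \<delta>) ^ 4 * (1 + \<delta>) * (a (j + 2) - a (j + 3)) * measure Q' (?S' (j + 2))"
        unfolding a_shift[of j] by (simp only: mult_ac)
      also have "(1 + \<delta>) ^ 4 * (1 + \<delta>) = (1 + \<delta>) ^ 5" by (simp add: numeral_eq_Suc)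
      finally show ?thesis by (simp only: distrib_left mult.assoc)
    qed
    then show ?thesis by (simp add: sum.distrib sum_distrib_left)
  qed
  also have "(\<Sum>j<J. (a (j + 2) - a (j + 3)) * measure Q' (?S' (j + 2)))
     = (LINT y|Q'. (\<Sum>j<J. (a (j + 2) - a (j + 3)) * indicat_real (?S' (j + 2)) y))"
    by (subst Bochner_Integration.integral_sum[OF integrable_mult_right[OF S']]) simp
  also have "\<dots> \<le> (LINT y|Q'. (F' y)\<^sup>2)"
  proof (intro integral_mono int' Bochner_Integration.integrable_sum integrable_mult_right S')
    fix y assume y: "y \<in> space Q'"
    have "antimono (\<lambda>j. a (j + 2))" using anti by (auto simp: monotone_def)
    from staircase_lower[OF this, of "(F' y)\<^sup>2" J] y a0(2)
    show "(\<Sum>j<J. (a (j + 2) - a (j + 3)) * indicat_real (?S' (j + 2)) y) \<le> (F' y)\<^sup>2"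
      by (simp add: lev indicator_def numeral_3_eq_3)
  qed
  finally show ?thesis using \<delta> by (simp add: a_def)
qed

text \<open>
  The level argument described at the beginning. The number \<open>J\<close> of levels is such that the lowest level
  contributes at most \<open>\<delta> \<theta>\<close>. With \<open>\<eta>\<^sub>j = \<theta> / (J x\<^sub>j\<^sub>+\<^sub>1\<^sup>2)\<close> each level contributes at most
  \<open>12 \<delta> \<theta> / J\<close> to the additive error, for a total of \<open>13 \<delta> \<theta>\<close>. The good event controls the finitely
  many averages of \<open>N\<^sub>j\<close> generators only; the bounds for all convex weights follow on it
  deterministically.
\<close>
theorem conv_hull_quadratic_process:
  fixes g :: "'a \<Rightarrow> 'b \<Rightarrow> real"
  assumes M: "prob_space M" and fin: "finite A" and card: "card A = n" "1 \<le> n"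
    and gm: "\<And>a. a \<in> A \<Longrightarrow> g a \<in> borel_measurable M"
    and g: "\<And>a x. a \<in> A \<Longrightarrow> x \<in> space M \<Longrightarrow> \<bar>g a x\<bar> \<le> 1"
    and \<delta>: "0 < \<delta>" "\<delta> \<le> 1" and \<theta>: "0 < \<theta>" "\<theta> \<le> 1" and \<epsilon>: "0 < \<epsilon>" "\<epsilon> \<le> 1"
    and J: "1 \<le> J" "1 \<le> \<delta> * \<theta> * (1 + \<delta>) ^ (2 * J)"
    and m: "2 * real J / (\<delta> * \<theta>) * (34 * ln (2 * real J / \<theta>) * ln (real n) / \<delta>\<^sup>2 + ln (2 * real J / \<epsilon>)) \<le> real m"
  shows "\<exists>E\<in>sets (Pi\<^sub>M {..<m} (\<lambda>_. M)). 1 - \<epsilon> \<le> measure (Pi\<^sub>M {..<m} (\<lambda>_. M)) E \<and>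
    (\<forall>t\<in>E. \<forall>p. (\<forall>a\<in>A. 0 \<le> p a) \<longrightarrow> sum p A = 1 \<longrightarrow>
       (\<Sum>k<m. (\<Sum>a\<in>A. p a * g a (t k))\<^sup>2) / real m
          \<le> (1 + \<delta>) ^ 5 * (LINT x|M. (\<Sum>a\<in>A. p a * g a x)\<^sup>2) + 13 * \<delta> * \<theta> \<and>
       (LINT x|M. (\<Sum>a\<in>A. p a * g a x)\<^sup>2)
          \<le> (1 + \<delta>) ^ 5 * ((\<Sum>k<m. (\<Sum>a\<in>A. p a * g a (t k))\<^sup>2) / real m) + 13 * \<delta> * \<theta>)"
proof -
  interpret M: prob_space M by fact
  let ?P = "Pi\<^sub>M {..<m} (\<lambda>_. M)"
  interpret P: prob_space ?P by (intro prob_space_PiM) (rule M)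
  define x where "x j = inverse (1 + \<delta>) ^ j" for j :: nat
  define h where "h j = \<delta> * x (j + 2) / 2" for j
  define r where "r j = x (j + 2) + h j" for j
  define \<eta> where "\<eta> j = \<theta> / (real J * (x (Suc j))\<^sup>2)" for j
  define Y where "Y = ln (2 * real J / \<theta>)"
  define N where "N j = nat \<lceil>2 * Y / (h j)\<^sup>2\<rceil>" for j
  have q: "0 < inverse (1 + \<delta>)" "inverse (1 + \<delta>) \<le> 1" using \<delta> by (auto simp: field_simps)
  have x0: "0 < x j" and x1: "x j \<le> 1" for j using q by (auto simp: x_def intro: power_le_one)
  have x_Suc: "x j = (1 + \<delta>) * x (Suc j)" for j using \<delta> by (simp add: x_def mult.assoc[symmetric])
  have h0: "0 < h j" for j using x0 \<delta> by (simp add: h_def)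
  have r_plus: "r j + h j = x (Suc j)" and r_minus: "r j - h j = x (j + 2)" for j
    using x_Suc[of "Suc j"] by (auto simp: r_def h_def field_simps)
  have xsq1: "(x j)\<^sup>2 \<le> 1" "0 < (x j)\<^sup>2" for j using x0[of j] x1[of j] by (auto simp: power_le_one)
  have \<eta>0: "0 < \<eta> j" for j using \<theta> J x0[of "Suc j"] by (simp add: \<eta>_def)
  have \<eta>_ge: "\<theta> / real J \<le> \<eta> j" for j
    unfolding \<eta>_def using \<theta> J xsq1[of "Suc j"] by (intro divide_left_mono) (auto intro: mult_left_le)
  have "1 * 2 \<le> real J * 2 / \<theta>" using J \<theta> by (simp add: field_simps)
  then have "ln 2 \<le> Y" unfolding Y_def using \<theta> J by (subst ln_le_cancel_iff) (auto simp: mult.commute)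
  then have Y: "1 / 2 \<le> Y" using ln2_ge_two_thirds by simp
  have N0: "0 < N j" for j using h0[of j] Y by (simp add: N_def)
  have N_ge: "2 * Y / (h j)\<^sup>2 \<le> real (N j)" for j
    unfolding N_def using Y by (simp add: real_nat_ceiling_ge)
  have tail: "2 * exp (- (real (N j) * (h j)\<^sup>2 / 2)) \<le> \<eta> j" for j
  proof -
    have "Y \<le> real (N j) * (h j)\<^sup>2 / 2" using N_ge[of j] h0[of j] by (simp add: field_simps)
    then have "2 * exp (- (real (N j) * (h j)\<^sup>2 / 2)) \<le> 2 * exp (- Y)" by simp
    also have "\<dots> = \<theta> / real J" using \<theta> J by (simp add: Y_def exp_minus)
    finally show ?thesis using \<eta>_ge[of j] by simp
  qed
  \<comment> \<open>\<open>32\<close> is twice the \<open>16\<close> from \<open>h\<^sub>j \<ge> \<delta> x\<^sub>j\<^sub>+\<^sub>1 / 4\<close>; rounding up adds \<open>2\<close> because \<open>Y \<ge> 1 / 2\<close>\<close>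
  have N_le: "real (N j) \<le> 34 * Y / (\<delta>\<^sup>2 * (x (Suc j))\<^sup>2)" for j
  proof -
    have "real (N j) \<le> 2 * Y / (h j)\<^sup>2 + 1" unfolding N_def using Y by (simp add: of_nat_ceiling)
    moreover have "\<delta>\<^sup>2 * (x (Suc j))\<^sup>2 \<le> 16 * (h j)\<^sup>2"
    proof -
      have "x (Suc j) \<le> 2 * x (j + 2)" using x_Suc[of "Suc j"] x0[of "j + 2"] \<delta> 
        by (simp add: mult_right_mono)
      then have "\<delta> * x (Suc j) \<le> 4 * h j" using \<delta> by (simp add: h_def)
      then have "(\<delta> * x (Suc j))\<^sup>2 \<le> (4 * h j)\<^sup>2" using \<delta> x0[of "Suc j"] by (intro power_mono) auto
      then show ?thesis by (simp add: power_mult_distrib)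
    qed
    then have "2 * Y * 16 / (16 * (h j)\<^sup>2) \<le> 2 * Y * 16 / (\<delta>\<^sup>2 * (x (Suc j))\<^sup>2)"
      using Y \<delta> x0[of "Suc j"] h0[of j] by (intro divide_left_mono mult_pos_pos) auto
    moreover have "1 \<le> 2 * Y / (\<delta>\<^sup>2 * (x (Suc j))\<^sup>2)"
    proof -
      have "\<delta>\<^sup>2 * (x (Suc j))\<^sup>2 \<le> 1 * 1" using \<delta> xsq1 by (intro mult_mono) (auto simp: power_le_one)
      then show ?thesis using Y \<delta> x0[of "Suc j"] by (subst pos_le_divide_eq) auto
    qed
    ultimately show ?thesis by (simp add: add_divide_distrib[symmetric])
  qed
  have lnn: "0 \<le> ln (real n)" using card by simp
  have "1 * 2 \<le> real J * 2 / \<epsilon>" using J \<epsilon> by (simp add: field_simps)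
  then have ln\<epsilon>: "0 \<le> ln (2 * real J / \<epsilon>)" using J \<epsilon> by (simp add: field_simps)
  have m_pos: "0 < m"
  proof -
    have "0 < ln (2 * real J / \<epsilon>)" using \<open>1 * 2 \<le> real J * 2 / \<epsilon>\<close> by (simp add: mult.commute)
    then have "0 < 2 * real J / (\<delta> * \<theta>) * (34 * Y * ln (real n) / \<delta>\<^sup>2 + ln (2 * real J / \<epsilon>))"
      using J \<delta> \<theta> Y lnn by (intro mult_pos_pos add_nonneg_pos) auto
    then show ?thesis using m by (simp add: Y_def)
  qed
  \<comment> \<open>the level cancels: both sides are proportional to \<open>1 / x\<^sub>j\<^sub>+\<^sub>1\<^sup>2\<close>\<close>
  have budget: "real (N j) * ln (real n) + ln (2 * real J / \<epsilon>) \<le> real m * \<delta> * \<eta> j / 2" for j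
  proof -
    let ?X = "(x (Suc j))\<^sup>2"
    have "real (N j) * ln (real n) + ln (2 * real J / \<epsilon>)
       \<le> 34 * Y / (\<delta>\<^sup>2 * ?X) * ln (real n) + ln (2 * real J / \<epsilon>) / ?X"
      using N_le[of j] lnn ln\<epsilon> xsq1[of "Suc j"]
      by (intro add_mono mult_right_mono) (auto simp: pos_le_divide_eq mult_left_le)
    also have "\<dots> = (34 * Y * ln (real n) / \<delta>\<^sup>2 + ln (2 * real J / \<epsilon>)) / ?X"
      using \<delta> x0[of "Suc j"] by (simp add: field_simps)
    also have "\<dots> \<le> (real m * \<delta> * \<theta> / (2 * real J)) / ?X"
      using m J \<delta> \<theta> unfolding Y_def[symmetric] by (intro divide_right_mono) (auto simp: field_simps)
    also have "\<dots> = real m * \<delta> * \<eta> j / 2" by (simp add: \<eta>_def)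
    finally show ?thesis .
  qed
  define S where "S j \<omega> = {y \<in> space M. r j \<le> \<bar>avg (N j) (\<lambda>a. g a y) \<omega>\<bar>}" for j \<omega>
  have S [measurable]: "S j \<omega> \<in> sets M" if "\<omega> \<in> tuples (N j) A" for j \<omega>
  proof -
    have "\<omega> i \<in> A" if "i < N j" for i using that \<open>\<omega> \<in> _\<close> by (auto simp: tuples_def)
    then have [measurable]: "(\<lambda>y. avg (N j) (\<lambda>a. g a y) \<omega>) \<in> borel_measurable M"
      unfolding avg_def by (intro borel_measurable_divide borel_measurable_sum gm) auto
    show ?thesis unfolding S_def by measurable
  qed
  define B where "B j \<omega> = {t \<in> space ?P. (1 + \<delta>) * M.prob (S j \<omega>) + \<eta> j \<le> freq m t (S j \<omega>)}
      \<union> {t \<in> space ?P. (1 + \<delta>) * freq m t (S j \<omega>) + \<eta> j \<le> M.prob (S j \<omega>)}" for j \<omega>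
  define I where "I = (SIGMA j:{..<J}. tuples (N j) A)"
  define E where "E = space ?P - (\<Union>(j, \<omega>)\<in>I. B j \<omega>)"
  have finI: "finite I" unfolding I_def using finite_tuples[OF fin] by auto
  have B_sets: "B j \<omega> \<in> sets ?P" if "(j, \<omega>) \<in> I" for j \<omega>
  proof -
    have [measurable]: "S j \<omega> \<in> sets M" using that by (intro S) (auto simp: I_def)
    show ?thesis unfolding B_def by measurable
  qed
  have B_prob: "P.prob (B j \<omega>) \<le> 2 * exp (- (real m * \<delta> * \<eta> j / 2))" if "(j, \<omega>) \<in> I" for j \<omega>
  proof -
    have Sm [measurable]: "S j \<omega> \<in> sets M" using that by (intro S) (auto simp: I_def)
    have "P.prob (B j \<omega>) \<le> exp (- (real m * \<delta> * \<eta> j)) + exp (- (real m * \<delta> * \<eta> j / 2))"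
      unfolding B_def
      by (rule order.trans[OF measure_Un_le add_mono[OF M.freq_upper_tail[OF Sm m_pos \<delta>] M.freq_lower_tail[OF Sm m_pos \<delta>]]])
         (use \<eta>0[of j] in auto)
    also have "exp (- (real m * \<delta> * \<eta> j)) \<le> exp (- (real m * \<delta> * \<eta> j / 2))"
      using \<delta> \<eta>0[of j] by simp
    finally show ?thesis by simp
  qed
  have "P.prob (\<Union>(j, \<omega>)\<in>I. B j \<omega>) \<le> (\<Sum>(j, \<omega>)\<in>I. P.prob (B j \<omega>))"
    using P.finite_measure_subadditive_finite[OF finI, of "\<lambda>(j, \<omega>). B j \<omega>"] B_sets
    by (force simp: case_prod_unfold)
  also have "\<dots> \<le> (\<Sum>(j, \<omega>)\<in>I. 2 * exp (- (real m * \<delta> * \<eta> j / 2)))"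
    using B_prob by (intro sum_mono) auto
  also have "\<dots> = (\<Sum>j<J. real n ^ N j * (2 * exp (- (real m * \<delta> * \<eta> j / 2))))"
    unfolding I_def using fin finite_tuples[OF fin]
    by (subst sum.Sigma[symmetric]) (auto simp: tuples_def card_PiE card)
  also have "\<dots> \<le> (\<Sum>j<J. \<epsilon> / real J)"
  proof (rule sum_mono)
    fix j
    have "real n ^ N j * (2 * exp (- (real m * \<delta> * \<eta> j / 2)))
       = 2 * exp (real (N j) * ln (real n) - real m * \<delta> * \<eta> j / 2)"
      using card by (simp add: exp_diff exp_of_nat_mult exp_minus inverse_eq_divide)
    also have "\<dots> \<le> 2 * exp (- ln (2 * real J / \<epsilon>))" using budget[of j] by simp
    also have "\<dots> = \<epsilon> / real J" using J \<epsilon> by (simp add: exp_minus)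
    finally show "real n ^ N j * (2 * exp (- (real m * \<delta> * \<eta> j / 2))) \<le> \<epsilon> / real J" .
  qed
  also have "\<dots> = \<epsilon>" using J by simp
  finally have "P.prob (\<Union>(j, \<omega>)\<in>I. B j \<omega>) \<le> \<epsilon>" .
  moreover have UB: "(\<Union>(j, \<omega>)\<in>I. B j \<omega>) \<in> sets ?P" using finI B_sets by (intro sets.finite_UN) auto
  ultimately have "1 - \<epsilon> \<le> P.prob E" unfolding E_def by (simp add: P.prob_compl)
  moreover have "E \<in> sets ?P" unfolding E_def using UB by auto
  moreover {
    fix t and p :: "'a \<Rightarrow> real" assume t: "t \<in> E" and p: "\<forall>a\<in>A. 0 \<le> p a" "sum p A = 1"
    \<comment> \<open>the empirical measure, carried by the sample indices\<close>
    let ?Q = "uniform_count_measure {..<m}"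
    have tM: "t k \<in> space M" if "k < m" for k using t that by (auto simp: E_def space_PiM)
    have Q: "prob_space ?Q" using m_pos by (intro prob_space_uniform_count_measure) auto
    have gmQ: "(\<lambda>k. g a (t k)) \<in> borel_measurable ?Q" for a
      by (simp add: measurable_cong_sets[OF sets_uniform_count_measure_count_space refl])
    have gQ: "\<bar>g a (t k)\<bar> \<le> 1" if "a \<in> A" "k \<in> space ?Q" for a k
      using that g tM by (simp add: space_uniform_count_measure)
    have freq: "measure ?Q {k \<in> space ?Q. r j \<le> \<bar>avg (N j) (\<lambda>a. g a (t k)) \<omega>\<bar>} = freq m t (S j \<omega>)" for j \<omega>
    proof -
      have "{k \<in> space ?Q. r j \<le> \<bar>avg (N j) (\<lambda>a. g a (t k)) \<omega>\<bar>} = {k \<in> {..<m}. t k \<in> S j \<omega>}"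
        using tM by (auto simp: S_def space_uniform_count_measure)
      then have "measure ?Q {k \<in> space ?Q. r j \<le> \<bar>avg (N j) (\<lambda>a. g a (t k)) \<omega>\<bar>} = real (card {k \<in> {..<m}. t k \<in> S j \<omega>}) / real m"
        by (subst measure_uniform_count_measure) auto
      also have "real (card {k \<in> {..<m}. t k \<in> S j \<omega>}) = (\<Sum>k<m. indicat_real (S j \<omega>) (t k))"
        by (simp add: indicator_def sum.If_cases Int_def)
      finally show ?thesis by (simp add: freq_def)
    qed
    have good: "freq m t (S j \<omega>) \<le> (1 + \<delta>) * M.prob (S j \<omega>) + \<eta> j"
      "M.prob (S j \<omega>) \<le> (1 + \<delta>) * freq m t (S j \<omega>) + \<eta> j" if "j < J" "\<omega> \<in> tuples (N j) A" for j \<omega>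
      using t that by (force simp: E_def B_def I_def)+
    let ?F = "\<lambda>y. \<Sum>a\<in>A. p a * g a y"
    have F1: "\<bar>\<Sum>a\<in>A. p a * k a\<bar> \<le> 1" if "\<And>a. a \<in> A \<Longrightarrow> \<bar>k a\<bar> \<le> 1" for k
    proof -
      have "\<bar>\<Sum>a\<in>A. p a * k a\<bar> \<le> (\<Sum>a\<in>A. \<bar>p a * k a\<bar>)" by (rule sum_abs)
      also have "\<dots> \<le> (\<Sum>a\<in>A. p a)" using p that by (intro sum_mono) (auto simp: abs_mult mult_left_le)
      finally show ?thesis using p by simp
    qed
    have err: "(x J)\<^sup>2 + (\<Sum>j<J. ((x j)\<^sup>2 - (x (Suc j))\<^sup>2) * (4 * \<eta> j)) \<le> 13 * \<delta> * \<theta>"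
    proof -
      have "(x J)\<^sup>2 = 1 / (1 + \<delta>) ^ (2 * J)"
        by (simp add: x_def power_inverse power_mult[symmetric] mult.commute divide_inverse)
      also have "\<dots> \<le> \<delta> * \<theta>" using J \<delta> by (simp add: pos_divide_le_eq)
      finally have 1: "(x J)\<^sup>2 \<le> \<delta> * \<theta>" .
      have "((x j)\<^sup>2 - (x (Suc j))\<^sup>2) * (4 * \<eta> j) \<le> 12 * \<delta> * \<theta> / real J" for j
      proof -
        have "(x j)\<^sup>2 - (x (Suc j))\<^sup>2 = (2 * \<delta> + \<delta> * \<delta>) * (x (Suc j))\<^sup>2"
          unfolding x_Suc[of j] by (simp add: power2_eq_square algebra_simps)
        also have "\<dots> \<le> (3 * \<delta>) * (x (Suc j))\<^sup>2" using \<delta> by (intro mult_right_mono) (auto simp: mult_left_le)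
        finally have "((x j)\<^sup>2 - (x (Suc j))\<^sup>2) * (4 * \<eta> j) \<le> (3 * \<delta>) * (x (Suc j))\<^sup>2 * (4 * \<eta> j)"
          using \<eta>0[of j] by (intro mult_right_mono) auto
        also have "\<dots> = 12 * \<delta> * \<theta> / real J" using x0[of "Suc j"] by (simp add: \<eta>_def)
        finally show ?thesis .
      qed
      then have "(\<Sum>j<J. ((x j)\<^sup>2 - (x (Suc j))\<^sup>2) * (4 * \<eta> j)) \<le> (\<Sum>j<J. 12 * \<delta> * \<theta> / real J)"
        by (intro sum_mono)
      also have "\<dots> = 12 * \<delta> * \<theta>" using J by simp
      finally show ?thesis using 1 by simp
    qed
    have 1: "(LINT k|?Q. (?F (t k))\<^sup>2) \<le> (1 + \<delta>) ^ 5 * (LINT y|M. (?F y)\<^sup>2) + 13 * \<delta> * \<theta>"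
    proof -
      have "(LINT k|?Q. (?F (t k))\<^sup>2) \<le> (1 + \<delta>) ^ 5 * (LINT y|M. (?F y)\<^sup>2)
          + (x J)\<^sup>2 + (\<Sum>j<J. ((x j)\<^sup>2 - (x (Suc j))\<^sup>2) * (4 * \<eta> j))"
        unfolding x_def
      proof (rule square_integral_compare[OF Q M], unfold x_def[symmetric])
        fix j assume j: "j < J"
        show "measure ?Q {k \<in> space ?Q. x (Suc j) \<le> \<bar>?F (t k)\<bar>} \<le> (1 + \<delta>) * M.prob {y \<in> space M. x (j + 2) \<le> \<bar>?F y\<bar>} + 4 * \<eta> j"
          unfolding r_plus[symmetric] r_minus[symmetric]
          by (rule avg_level_compare[OF Q M fin _ p(2) gmQ gm gQ g h0 N0 tail])
            (use p \<delta> good(1)[OF j] in \<open>auto simp: freq S_def[symmetric]\<close>)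
      qed (use \<delta> F1 g gQ in \<open>auto intro!: borel_measurable_sum borel_measurable_times gm gmQ\<close>)
      then show ?thesis using err by simp
    qed
    have 2: "(LINT y|M. (?F y)\<^sup>2) \<le> (1 + \<delta>) ^ 5 * (LINT k|?Q. (?F (t k))\<^sup>2) + 13 * \<delta> * \<theta>"
    proof -
      have "(LINT y|M. (?F y)\<^sup>2) \<le> (1 + \<delta>) ^ 5 * (LINT k|?Q. (?F (t k))\<^sup>2)
          + (x J)\<^sup>2 + (\<Sum>j<J. ((x j)\<^sup>2 - (x (Suc j))\<^sup>2) * (4 * \<eta> j))"
        unfolding x_def
      proof (rule square_integral_compare[OF M Q], unfold x_def[symmetric])
        fix j assume j: "j < J"
        show "M.prob {y \<in> space M. x (Suc j) \<le> \<bar>?F y\<bar>} \<le> (1 + \<delta>) * measure ?Q {k \<in> space ?Q. x (j + 2) \<le> \<bar>?F (t k)\<bar>} + 4 * \<eta> j"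
          unfolding r_plus[symmetric] r_minus[symmetric]
          by (rule avg_level_compare[OF M Q fin _ p(2) gm gmQ g gQ h0 N0 tail])
            (use p \<delta> good(2)[OF j] in \<open>auto simp: freq S_def[symmetric]\<close>)
      qed (use \<delta> F1 g gQ in \<open>auto intro!: borel_measurable_sum borel_measurable_times gm gmQ\<close>)
      then show ?thesis using err by simp
    qed
    have "(LINT k|?Q. (?F (t k))\<^sup>2) = (\<Sum>k<m. (?F (t k))\<^sup>2) / real m"
      by (subst integral_uniform_count_measure) auto
    note 1[unfolded this] 2[unfolded this]
  }
  ultimately show ?thesis by blast
qed

section \<open>Legendre polynomials\<close>

text \<open>
  The derivative of \<open>legendre_P\<close>, obtained by differentiating Bonnet's recursion termwise; likewise below
  for the second derivative.
\<close>
fun legendre_dP :: "nat \<Rightarrow> real \<Rightarrow> real" where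
  "legendre_dP 0 x = 0"
| "legendre_dP (Suc 0) x = 1"
| "legendre_dP (Suc (Suc k)) x =
     ((2 * real k + 3) * (legendre_P (Suc k) x + x * legendre_dP (Suc k) x) - (real k + 1) * legendre_dP k x)
       / (real k + 2)"

fun legendre_ddP :: "nat \<Rightarrow> real \<Rightarrow> real" where
  "legendre_ddP 0 x = 0"
| "legendre_ddP (Suc 0) x = 0"
| "legendre_ddP (Suc (Suc k)) x =
     ((2 * real k + 3) * (2 * legendre_dP (Suc k) x + x * legendre_ddP (Suc k) x) - (real k + 1) * legendre_ddP k x)
       / (real k + 2)"

lemma DERIV_legendre_P: "(legendre_P k has_real_derivative legendre_dP k x) (at x)"
proof (induction k x rule: legendre_P.induct)
  case (2 x)
  have "legendre_P (Suc 0) = (\<lambda>x. x)" by auto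
  then show ?case by simp
next
  case (3 k x)
  have "legendre_P (Suc (Suc k)) = (\<lambda>x. ((2 * real k + 3) * x * legendre_P (Suc k) x - (real k + 1) * legendre_P k x) / (real k + 2))"
    by auto
  moreover have "((\<lambda>x. ((2 * real k + 3) * x * legendre_P (Suc k) x - (real k + 1) * legendre_P k x) / (real k + 2))
     has_real_derivative legendre_dP (Suc (Suc k)) x) (at x)"
    unfolding legendre_dP.simps by (rule DERIV_cdivide) ((rule derivative_eq_intros 3 refl)+, simp add: algebra_simps)
  ultimately show ?case by simp
qed auto

lemma DERIV_legendre_dP: "(legendre_dP k has_real_derivative legendre_ddP k x) (at x)"
proof (induction k x rule: legendre_ddP.induct)
  case (1 x)
  have "legendre_dP 0 = (\<lambda>x. 0)" by auto
  then show ?case by simp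
next
  case (2 x)
  have "legendre_dP (Suc 0) = (\<lambda>x. 1)" by auto
  then show ?case by simp
next
  case (3 k x)
  have "legendre_dP (Suc (Suc k)) = (\<lambda>x. ((2 * real k + 3) * (legendre_P (Suc k) x + x * legendre_dP (Suc k) x) - (real k + 1) * legendre_dP k x) / (real k + 2))"
    by auto
  moreover have "((\<lambda>x. ((2 * real k + 3) * (legendre_P (Suc k) x + x * legendre_dP (Suc k) x) - (real k + 1) * legendre_dP k x) / (real k + 2))
     has_real_derivative legendre_ddP (Suc (Suc k)) x) (at x)"
    unfolding legendre_ddP.simps by (rule DERIV_cdivide) ((rule derivative_eq_intros 3 DERIV_legendre_P refl)+, simp add: algebra_simps)
  ultimately show ?case by simp
qed

text \<open>
  The two contiguity relations \<open>P'\<^sub>k\<^sub>+\<^sub>1 = x P'\<^sub>k + (k + 1) P\<^sub>k\<close> and \<open>x P'\<^sub>k\<^sub>+\<^sub>1 - P'\<^sub>k = (k + 1) P\<^sub>k\<^sub>+\<^sub>1\<close>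
  have to be proved together, since the inductive step for each uses the other. They link the recursion to the differential equation,
  from which orthogonality and the uniform bound are derived.
\<close>
lemma legendre_derivative_identities:
  "legendre_dP (Suc k) x = x * legendre_dP k x + (real k + 1) * legendre_P k x
   \<and> x * legendre_dP (Suc k) x - legendre_dP k x = (real k + 1) * legendre_P (Suc k) x"
proof (induction k)
  case (Suc k)
  define p q dp dq where "p = legendre_P k x" and "q = legendre_P (Suc k) x"
    and "dp = legendre_dP k x" and "dq = legendre_dP (Suc k) x"
  have k2: "real k + 2 \<noteq> 0" by auto
  have 1: "dq = x * dp + (real k + 1) * p" and 2: "dp = x * dq - (real k + 1) * q"
    using Suc unfolding p_def q_def dp_def dq_def by (auto simp: algebra_simps)
  have P2: "(real k + 2) * legendre_P (Suc (Suc k)) x = (2 * real k + 3) * x * q - (real k + 1) * p"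
    using k2 by (simp add: p_def q_def)
  have "(real k + 2) * legendre_dP (Suc (Suc k)) x = (2 * real k + 3) * (q + x * dq) - (real k + 1) * dp"
    using k2 by (simp add: p_def q_def dp_def dq_def)
  also have "\<dots> = (real k + 2) * (x * dq + (real k + 2) * q)"
    unfolding 2 by (simp add: algebra_simps)
  finally have d2: "legendre_dP (Suc (Suc k)) x = x * dq + (real k + 2) * q"
    using k2 by simp
  have "(x\<^sup>2 - 1) * dq = (real k + 1) * (x * q - p)"
    using 1 unfolding 2 by (simp add: algebra_simps power2_eq_square)
  then have "x * legendre_dP (Suc (Suc k)) x - dq = (real k + 2) * legendre_P (Suc (Suc k)) x"
    unfolding d2 P2 by (simp add: algebra_simps power2_eq_square)
  with d2 show ?case by (simp add: dq_def q_def add_ac)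
qed auto

lemma legendre_one_minus_square_dP:
  "(1 - x\<^sup>2) * legendre_dP (Suc k) x = (real k + 1) * (legendre_P k x - x * legendre_P (Suc k) x)"
proof -
  define p q dp dq where "p = legendre_P k x" and "q = legendre_P (Suc k) x"
    and "dp = legendre_dP k x" and "dq = legendre_dP (Suc k) x"
  have 1: "dq = x * dp + (real k + 1) * p" and 2: "dp = x * dq - (real k + 1) * q"
    using legendre_derivative_identities[of k x] unfolding p_def q_def dp_def dq_def by (auto simp: algebra_simps)
  from 1 show ?thesis unfolding 2 p_def[symmetric] q_def[symmetric] dq_def[symmetric]
    by (simp add: algebra_simps power2_eq_square)
qed

lemma legendre_ode:
  "((\<lambda>x. (1 - x\<^sup>2) * legendre_dP k x) has_real_derivative - (real k * (real k + 1)) * legendre_P k x) (at x)"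
proof (cases k)
  case 0
  then show ?thesis by simp
next
  case (Suc j)
  have "((\<lambda>x. (real j + 1) * (legendre_P j x - x * legendre_P (Suc j) x)) has_real_derivative
     (real j + 1) * (legendre_dP j x - (legendre_P (Suc j) x + x * legendre_dP (Suc j) x))) (at x)"
    by (rule derivative_eq_intros DERIV_legendre_P refl)+ (simp add: algebra_simps)
  moreover have "legendre_dP j x = x * legendre_dP (Suc j) x - (real j + 1) * legendre_P (Suc j) x"
    using legendre_derivative_identities[of j x] by auto
  ultimately show ?thesis
    unfolding Suc legendre_one_minus_square_dP by (simp add: algebra_simps)
qed

lemma legendre_ode': "(1 - x\<^sup>2) * legendre_ddP k x = 2 * x * legendre_dP k x - real k * (real k + 1) * legendre_P k x"
proof -
  have "((\<lambda>x. (1 - x\<^sup>2) * legendre_dP k x) has_real_derivative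
       (- 2 * x * legendre_dP k x + (1 - x\<^sup>2) * legendre_ddP k x)) (at x)"
    by (rule derivative_eq_intros DERIV_legendre_dP refl)+ (simp add: algebra_simps)
  from DERIV_unique[OF this legendre_ode] show ?thesis by simp
qed

lemma legendre_P_endpoints: "legendre_P k 1 = 1" "(legendre_P k (- 1))\<^sup>2 = 1"
proof -
  show "legendre_P k 1 = 1"
    by (induction k "1 :: real" rule: legendre_P.induct) (auto simp: field_simps)
  have "legendre_P k (- 1) = (- 1) ^ k"
    by (induction k "- 1 :: real" rule: legendre_P.induct) (auto simp: field_simps)
  then show "(legendre_P k (- 1))\<^sup>2 = 1" by (simp add: power_mult[symmetric])
qed

text \<open>
  Sonin's function: by the differential equation, \<open>F = P\<^sup>2 + (1 - x\<^sup>2) P'\<^sup>2 / (k (k + 1))\<close> has derivative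
  \<open>2 x P'\<^sup>2 / (k (k + 1))\<close>. So on \<open>[-1, 1]\<close> it is largest at the endpoints, where it equals \<open>1\<close>, and it
  dominates \<open>P\<^sup>2\<close>.
\<close>
lemma legendre_P_bound:
  assumes x: "\<bar>x\<bar> \<le> 1"
  shows "\<bar>legendre_P k x\<bar> \<le> 1"
proof (cases "k = 0")
  case False
  define c where "c = real k * (real k + 1)"
  have c: "0 < c" using False by (simp add: c_def)
  define F where "F y = (legendre_P k y)\<^sup>2 + (1 - y\<^sup>2) * (legendre_dP k y)\<^sup>2 / c" for y
  have dF: "(F has_real_derivative 2 * y * (legendre_dP k y)\<^sup>2 / c) (at y)" for y
  proof -
    define D where "D = (1 - y\<^sup>2) * legendre_ddP k y"
    have D: "D = 2 * y * legendre_dP k y - c * legendre_P k y"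
      unfolding D_def c_def by (rule legendre_ode')
    have "(F has_real_derivative 2 * legendre_P k y * legendre_dP k y +
       (- 2 * y * (legendre_dP k y)\<^sup>2 + 2 * legendre_dP k y * D) / c) (at y)"
      unfolding F_def D_def
    proof (intro DERIV_add DERIV_cdivide)
      show "((\<lambda>y. (legendre_P k y)\<^sup>2) has_real_derivative 2 * legendre_P k y * legendre_dP k y) (at y)"
        by (rule derivative_eq_intros DERIV_legendre_P refl)+ simp
      show "((\<lambda>y. (1 - y\<^sup>2) * (legendre_dP k y)\<^sup>2) has_real_derivative
          - 2 * y * (legendre_dP k y)\<^sup>2 + 2 * legendre_dP k y * ((1 - y\<^sup>2) * legendre_ddP k y)) (at y)"
        by (rule derivative_eq_intros DERIV_legendre_dP refl)+ (simp add: power2_eq_square algebra_simps)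
    qed
    also have "2 * legendre_P k y * legendre_dP k y + (- 2 * y * (legendre_dP k y)\<^sup>2 + 2 * legendre_dP k y * D) / c
       = 2 * y * (legendre_dP k y)\<^sup>2 / c"
      unfolding D using c by (simp add: field_simps power2_eq_square)
    finally show ?thesis .
  qed
  have "F x \<le> 1"
  proof (cases "0 \<le> x")
    case True
    have "F x \<le> F 1"
    proof (rule DERIV_nonneg_imp_nondecreasing[of x 1 F])
      show "x \<le> 1" using x by simp
      show "\<exists>y. (F has_real_derivative y) (at z) \<and> 0 \<le> y" if "x \<le> z" for z
        using dF[of z] c that True by (intro exI[of _ "2 * z * (legendre_dP k z)\<^sup>2 / c"]) auto
    qed
    then show ?thesis by (simp add: F_def legendre_P_endpoints)
  next
    case False
    have "F x \<le> F (- 1)"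
    proof (rule DERIV_nonpos_imp_nonincreasing[of "- 1" x F])
      show "- 1 \<le> x" using x by simp
      show "\<exists>y. (F has_real_derivative y) (at z) \<and> y \<le> 0" if "z \<le> x" for z
        using dF[of z] c that False
        by (intro exI[of _ "2 * z * (legendre_dP k z)\<^sup>2 / c"]) (auto simp: divide_nonpos_pos mult_nonpos_nonneg)
    qed
    then show ?thesis by (simp add: F_def legendre_P_endpoints)
  qed
  moreover have "x\<^sup>2 \<le> 1" using x by (simp add: abs_square_le_1)
  then have "(legendre_P k x)\<^sup>2 \<le> F x" using c by (simp add: F_def)
  ultimately have "(legendre_P k x)\<^sup>2 \<le> 1" by linarith
  then show ?thesis by (simp only: abs_square_le_1)
qed simp

lemma continuous_legendre_P: "continuous_on S (legendre_P k)"
  by (meson DERIV_continuous_on DERIV_legendre_P has_field_derivative_at_within)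

text \<open>
  The inner product for Lebesgue measure on \<open>(-1, 1)\<close>; the probability measure of the Legendre case has half its density.
\<close>
definition legendre_ip :: "nat \<Rightarrow> nat \<Rightarrow> real" where
  "legendre_ip j k = (LBINT x=-1..1. legendre_P j x * legendre_P k x)"

text \<open>
  Legendre's equation is self-adjoint: the derivative of \<open>(1 - x\<^sup>2) (P'\<^sub>k P\<^sub>j - P'\<^sub>j P\<^sub>k)\<close> is a nonzero multiple
  of \<open>P\<^sub>j P\<^sub>k\<close>, and this function vanishes at both endpoints.
\<close>
lemma legendre_P_orthogonal:
  assumes "j \<noteq> k"
  shows "legendre_ip j k = 0"
proof -
  define c where "c = real j * (real j + 1) - real k * (real k + 1)"
  have "c \<noteq> 0"
  proof
    assume "c = 0"
    then have "(real j - real k) * (real j + real k + 1) = 0" by (simp add: c_def algebra_simps)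
    then show False using assms by simp
  qed
  define W where "W x = (1 - x\<^sup>2) * legendre_dP k x * legendre_P j x - (1 - x\<^sup>2) * legendre_dP j x * legendre_P k x" for x
  have dW: "(W has_real_derivative c * (legendre_P j x * legendre_P k x)) (at x)" for x
    unfolding W_def c_def
    by (rule derivative_eq_intros legendre_ode DERIV_legendre_P refl)+ (simp add: algebra_simps)
  have "(LBINT x=-1..1. c * (legendre_P j x * legendre_P k x)) = W 1 - W (- 1)"
    unfolding zero_ereal_def one_ereal_def uminus_ereal.simps
    by (rule interval_integral_FTC_finite)
      (auto intro!: continuous_intros continuous_legendre_P has_field_derivative_at_within[OF dW]
        simp: has_real_derivative_iff_has_vector_derivative[symmetric])
  then show ?thesis using \<open>c \<noteq> 0\<close>
    by (simp add: W_def legendre_ip_def)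
qed

lemma unit_interval_integrable_continuous:
  assumes "continuous_on {- 1..1} f"
  shows "interval_lebesgue_integrable lborel (-1) 1 (f :: real \<Rightarrow> real)"
  using assms unfolding one_ereal_def uminus_ereal.simps
  by (intro interval_integrable_continuous_on) auto

text \<open>
  The norms of \<open>P\<^sub>k\<close> and \<open>P\<^sub>k\<^sub>+\<^sub>1\<close> can both be read off the integral of \<open>x P\<^sub>k P\<^sub>k\<^sub>+\<^sub>1\<close>: expand \<open>x P\<^sub>k\<close> or \<open>x P\<^sub>k\<^sub>+\<^sub>1\<close> by Bonnet's
  recursion and use orthogonality.
\<close>
lemma legendre_P_norm: "legendre_ip k k = 2 / (2 * real k + 1)"
proof (induction k)
  case 0
  show ?case unfolding legendre_ip_def one_ereal_def uminus_ereal.simps by (simp add: interval_integral_const)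
next
  case (Suc k)
  have x1: "(2 * real k + 1) * x * legendre_P k x = (real k + 1) * legendre_P (Suc k) x + real k * legendre_P (k - 1) x" for x
    by (cases k) (auto simp: field_simps)
  have x2: "(2 * real k + 3) * x * legendre_P (Suc k) x = (real k + 2) * legendre_P (Suc (Suc k)) x + (real k + 1) * legendre_P k x" for x
    by (simp add: field_simps)
  let ?I = "\<lambda>f. (LBINT x=-1..1. f x)"
  have lin: "?I (\<lambda>x. a * (legendre_P i x * legendre_P j x) + b * (legendre_P i' x * legendre_P j' x))
     = a * legendre_ip i j + b * legendre_ip i' j'" for a b i j i' j'
    unfolding legendre_ip_def
    by (subst interval_lebesgue_integral_add(2)) (auto intro!: unit_interval_integrable_continuous continuous_intros continuous_legendre_P)
  have "(2 * real k + 1) * ?I (\<lambda>x. x * legendre_P k x * legendre_P (Suc k) x)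
     = ?I (\<lambda>x. ((2 * real k + 1) * x * legendre_P k x) * legendre_P (Suc k) x)"
    by (simp add: mult.assoc)
  also have "\<dots> = ?I (\<lambda>x. (real k + 1) * (legendre_P (Suc k) x * legendre_P (Suc k) x)
      + real k * (legendre_P (k - 1) x * legendre_P (Suc k) x))"
    unfolding x1 by (simp add: algebra_simps)
  also have "\<dots> = (real k + 1) * legendre_ip (Suc k) (Suc k)"
    unfolding lin by (simp add: legendre_P_orthogonal)
  finally have 1: "(2 * real k + 1) * ?I (\<lambda>x. x * legendre_P k x * legendre_P (Suc k) x) = (real k + 1) * legendre_ip (Suc k) (Suc k)" .
  have "(2 * real k + 3) * ?I (\<lambda>x. x * legendre_P k x * legendre_P (Suc k) x)
     = ?I (\<lambda>x. ((2 * real k + 3) * x * legendre_P (Suc k) x) * legendre_P k x)"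
    unfolding interval_lebesgue_integral_mult_right[symmetric] by (simp only: mult_ac)
  also have "\<dots> = ?I (\<lambda>x. (real k + 2) * (legendre_P (Suc (Suc k)) x * legendre_P k x)
      + (real k + 1) * (legendre_P k x * legendre_P k x))"
    unfolding x2 by (simp add: algebra_simps)
  also have "\<dots> = (real k + 1) * legendre_ip k k"
    unfolding lin by (simp add: legendre_P_orthogonal)
  finally have 2: "(2 * real k + 3) * ?I (\<lambda>x. x * legendre_P k x * legendre_P (Suc k) x) = (real k + 1) * legendre_ip k k" .
  define I where "I = ?I (\<lambda>x. x * legendre_P k x * legendre_P (Suc k) x)"
  have "I * (2 * real k + 3) * (2 * real k + 1) = 2 * (real k + 1)"
    using 2 Suc unfolding I_def[symmetric] by (simp add: field_simps)
  moreover have "(2 * real k + 1) * I = (real k + 1) * legendre_ip (Suc k) (Suc k)" using 1 unfolding I_def .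
  ultimately have "((real k + 1) * legendre_ip (Suc k) (Suc k)) * (2 * real k + 3) = (real k + 1) * 2"
    by (metis mult.assoc mult.commute)
  then have "(real k + 1) * (legendre_ip (Suc k) (Suc k) * (2 * real k + 3)) = (real k + 1) * 2"
    by (simp only: mult.assoc)
  then have "legendre_ip (Suc k) (Suc k) * (2 * real k + 3) = 2" by (simp only: mult_cancel_left) simp
  then show ?case by (simp add: field_simps)
qed

section \<open>Chebyshev polynomials\<close>

lemma chebyshev_T_cos: "chebyshev_T k (cos \<theta>) = cos (real k * \<theta>)"
proof (induction k "cos \<theta>" rule: chebyshev_T.induct)
  case (3 k)
  have "cos (real (Suc (Suc k)) * \<theta>) = 2 * cos \<theta> * cos (real (Suc k) * \<theta>) - cos (real k * \<theta>)"
  proof -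
    have "real (Suc (Suc k)) * \<theta> = real (Suc k) * \<theta> + \<theta>" "real k * \<theta> = real (Suc k) * \<theta> - \<theta>"
      by (auto simp: algebra_simps)
    then show ?thesis by (simp only: cos_add cos_diff) simp
  qed
  then show ?case using 3 by simp
qed auto

lemma chebyshev_T_arccos: "\<bar>x\<bar> \<le> 1 \<Longrightarrow> chebyshev_T k x = cos (real k * arccos x)"
  using chebyshev_T_cos[of k "arccos x"] by (simp add: abs_le_iff)

lemma chebyshev_T_bound: "\<bar>x\<bar> \<le> 1 \<Longrightarrow> \<bar>chebyshev_T k x\<bar> \<le> 1"
  by (simp add: chebyshev_T_arccos)

lemma chebyshev_T_mult:
  assumes "\<bar>x\<bar> \<le> 1"
  shows "chebyshev_T j x * chebyshev_T k x = (chebyshev_T (j + k) x + chebyshev_T (if j \<le> k then k - j else j - k) x) / 2"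
proof -
  have "cos (real (if j \<le> k then k - j else j - k) * y) = cos ((real j - real k) * y)" for y
    by (auto simp: of_nat_diff) (metis cos_minus minus_diff_eq mult_minus_left)
  then show ?thesis using assms by (simp add: chebyshev_T_arccos cos_times_cos algebra_simps)
qed

lemma continuous_chebyshev_T: "continuous_on S (chebyshev_T k)"
proof (induction k rule: induct_nat_012)
  case 0
  have "chebyshev_T 0 = (\<lambda>x. 1)" by auto
  then show ?case by simp
next
  case 1
  have "chebyshev_T (Suc 0) = (\<lambda>x. x)" by auto
  then show ?case by simp
next
  case (ge2 k)
  have "chebyshev_T (Suc (Suc k)) = (\<lambda>x. 2 * x * chebyshev_T (Suc k) x - chebyshev_T k x)" by auto
  then show ?case using ge2 by (auto intro!: continuous_intros)
qed

definition arcsine_density :: "real \<Rightarrow> real" where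
  "arcsine_density x = 1 / (pi * sqrt (1 - x\<^sup>2))"

lemma isCont_arcsine_density: "- 1 < x \<Longrightarrow> x < 1 \<Longrightarrow> isCont arcsine_density x"
  unfolding arcsine_density_def using abs_square_less_1[of x] by (auto intro!: continuous_intros)

lemma arcsine_density_nonneg: "- 1 < x \<Longrightarrow> x < 1 \<Longrightarrow> 0 \<le> arcsine_density x"
  unfolding arcsine_density_def using abs_square_less_1[of x] by auto

lemma continuous_tendsto_endpoints:
  fixes F :: "real \<Rightarrow> real"
  assumes "continuous_on {- 1..1} F"
  shows "((F \<circ> real_of_ereal) \<longlongrightarrow> F (- 1)) (at_right (ereal (- 1)))"
    and "((F \<circ> real_of_ereal) \<longlongrightarrow> F 1) (at_left (ereal 1))"
proof -
  have "(F \<longlongrightarrow> F (- 1)) (at_right (- 1))" "(F \<longlongrightarrow> F 1) (at_left 1)"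
    using assms by (auto intro: continuous_on_Icc_at_rightD continuous_on_Icc_at_leftD)
  then show "((F \<circ> real_of_ereal) \<longlongrightarrow> F (- 1)) (at_right (ereal (- 1)))"
    and "((F \<circ> real_of_ereal) \<longlongrightarrow> F 1) (at_left (ereal 1))"
    by (simp_all only: ereal_tendsto_simps1)
qed

lemma arcsine_density_integral:
  "set_integrable lborel (einterval (ereal (- 1)) (ereal 1)) arcsine_density"
  "(LBINT x=ereal (- 1)..ereal 1. arcsine_density x) = 1"
proof -
  let ?F = "\<lambda>x. - (arccos x / pi)"
  have 1: "(?F has_real_derivative arcsine_density x) (at x)" if "- 1 < x" "x < 1" for x
    using that unfolding arcsine_density_def
    by (auto intro!: derivative_eq_intros simp: divide_simps abs_square_less_1)
  have cont: "continuous_on {-1..1} ?F" by (intro continuous_intros) auto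
  note FTC = interval_integral_FTC_nonneg[of "ereal (- 1)" "ereal 1" ?F arcsine_density, OF _ _ _ _ continuous_tendsto_endpoints[OF cont]]
  show "set_integrable lborel (einterval (ereal (- 1)) (ereal 1)) arcsine_density"
    by (rule FTC(1)) (auto intro!: 1 isCont_arcsine_density arcsine_density_nonneg AE_I2)
  have "(LBINT x=ereal (- 1)..ereal 1. arcsine_density x) = ?F 1 - ?F (- 1)"
    by (rule FTC(2)) (auto intro!: 1 isCont_arcsine_density arcsine_density_nonneg AE_I2)
  then show "(LBINT x=ereal (- 1)..ereal 1. arcsine_density x) = 1" by simp
qed

text \<open>
  The integrand has the primitive \<open>- sin (n arccos x) / (n \<pi>)\<close>. The fundamental theorem is needed in the form for
  open intervals, since the density is unbounded at the endpoints.
\<close>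
lemma chebyshev_T_mean_zero:
  assumes "0 < n"
  shows "(LBINT x=ereal (- 1)..ereal 1. chebyshev_T n x * arcsine_density x) = 0"
proof -
  let ?F = "\<lambda>x. - (sin (real n * arccos x) / (real n * pi))"
  have 1: "(?F has_real_derivative chebyshev_T n x * arcsine_density x) (at x)" if "- 1 < x" "x < 1" for x
    using that assms unfolding arcsine_density_def
    by (subst chebyshev_T_arccos) (auto intro!: derivative_eq_intros simp: divide_simps abs_square_less_1)
  have cont: "continuous_on {-1..1} ?F" using assms by (intro continuous_intros) auto
  have int: "set_integrable lborel (einterval (ereal (- 1)) (ereal 1)) (\<lambda>x. chebyshev_T n x * arcsine_density x)"
  proof (rule set_integrable_bound[OF arcsine_density_integral(1)])
    show "set_borel_measurable lborel (einterval (ereal (- 1)) (ereal 1)) (\<lambda>x. chebyshev_T n x * arcsine_density x)"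
      unfolding set_borel_measurable_def arcsine_density_def
      using borel_measurable_continuous_onI[OF continuous_chebyshev_T[of UNIV n]] by measurable
    show "AE x in lborel. x \<in> einterval (ereal (- 1)) (ereal 1) \<longrightarrow>
       norm (chebyshev_T n x * arcsine_density x) \<le> norm (arcsine_density x)"
      using chebyshev_T_bound[of _ n]
      by (intro AE_I2) (auto simp: einterval_iff abs_mult intro!: mult_left_le_one_le)
  qed
  have "(LBINT x=ereal (- 1)..ereal 1. chebyshev_T n x * arcsine_density x) = ?F 1 - ?F (- 1)"
    by (rule interval_integral_FTC_integrable[OF _ _ _ int continuous_tendsto_endpoints[OF cont]])
      (auto intro!: 1 continuous_intros isCont_arcsine_density continuous_on_interior[OF continuous_chebyshev_T, of _ UNIV]
        simp: has_real_derivative_iff_has_vector_derivative[symmetric])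
  then show ?thesis by (simp add: mult.commute[of _ pi] sin_npi2)
qed

section \<open>The univariate measures\<close>

fun nu1_density :: "family \<Rightarrow> real \<Rightarrow> real" where
  "nu1_density Legendre x = 1 / 2"
| "nu1_density Chebyshev x = arcsine_density x"

lemma nu1_density_measurable [measurable]: "nu1_density B \<in> borel_measurable borel"
  by (cases B) (auto simp: arcsine_density_def[abs_def] cong: measurable_cong)

lemma nu1_density_nonneg: "- 1 < x \<Longrightarrow> x < 1 \<Longrightarrow> 0 \<le> nu1_density B x"
  by (cases B) (auto simp: arcsine_density_nonneg)

lemma nu1_eq_density: "nu1 B = density (restrict_space lborel {-1<..<1}) (\<lambda>x. ennreal (nu1_density B x))"
  by (cases B) (auto simp: arcsine_density_def)

lemma space_nu1 [simp]: "space (nu1 B) = {-1<..<1}"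
  by (simp add: nu1_eq_density space_restrict_space)

lemma sets_nu1 [measurable_cong]: "sets (nu1 B) = sets (restrict_space borel {-1<..<1})"
  unfolding nu1_eq_density sets_density by (rule sets_restrict_space_cong) simp

lemma borel_measurable_nu1: "f \<in> borel_measurable borel \<Longrightarrow> f \<in> borel_measurable (nu1 B)"
  by (simp add: measurable_cong_sets[OF sets_nu1 refl] measurable_restrict_space1)

lemma LBINT_unit_interval: "(LBINT x=ereal (- 1)..ereal 1. f x) = (LINT x|restrict_space lborel {-1<..<1}. f x)"
  for f :: "real \<Rightarrow> real"
proof -
  have "einterval (ereal (- 1)) (ereal 1) = {-1<..<1}" by (auto simp: einterval_iff)
  then show ?thesis
    by (simp add: interval_lebesgue_integral_def integral_restrict_space set_lebesgue_integral_def)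
qed

lemma nu1_integral:
  fixes f :: "real \<Rightarrow> real"
  assumes "f \<in> borel_measurable borel"
  shows "(LINT x|nu1 B. f x) = (LBINT x=ereal (- 1)..ereal 1. f x * nu1_density B x)"
proof -
  have "(LINT x|nu1 B. f x) = (LINT x|restrict_space lborel {-1<..<1}. nu1_density B x *\<^sub>R f x)"
    unfolding nu1_eq_density using assms
    by (intro integral_density) (auto intro!: measurable_restrict_space1 AE_I2 nu1_density_nonneg simp: space_restrict_space)
  then show ?thesis by (simp add: LBINT_unit_interval mult.commute)
qed

lemma nu1_density_integral:
  "integrable (restrict_space lborel {-1<..<1}) (nu1_density B)" "(LBINT x=ereal (- 1)..ereal 1. nu1_density B x) = 1"
proof -
  have e: "einterval (ereal (- 1)) (ereal 1) = {-1<..<1}" by (auto simp: einterval_iff)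
  show "integrable (restrict_space lborel {-1<..<1}) (nu1_density B)"
    using arcsine_density_integral(1) unfolding e
    by (cases B) (auto simp: integrable_restrict_space set_integrable_def)
  show "(LBINT x=ereal (- 1)..ereal 1. nu1_density B x) = 1"
    using arcsine_density_integral(2) by (cases B) (auto simp: interval_integral_const)
qed

lemma prob_space_nu1: "prob_space (nu1 B)"
proof
  let ?R = "restrict_space lborel {-1<..<1::real}"
  have "emeasure (nu1 B) (space (nu1 B)) = (\<integral>\<^sup>+ x. ennreal (nu1_density B x) \<partial>?R)"
    unfolding nu1_eq_density
    by (subst emeasure_density) (auto intro!: measurable_restrict_space1 nn_integral_cong simp: space_restrict_space sets_restrict_space)
  also have "\<dots> = ennreal (LINT x|?R. nu1_density B x)"
    by (intro nn_integral_eq_integral nu1_density_integral AE_I2 nu1_density_nonneg) (auto simp: space_restrict_space)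
  also have "(LINT x|?R. nu1_density B x) = 1"
    using nu1_density_integral(2)[of B] by (simp add: LBINT_unit_interval)
  finally show "emeasure (nu1 B) (space (nu1 B)) = 1" by simp
qed

text \<open>
  The value of \<open>phi1 B k\<close> at \<open>1\<close>. It is used only as an upper bound for the absolute value.
\<close>
fun sup_phi1 :: "family \<Rightarrow> nat \<Rightarrow> real" where
  "sup_phi1 Legendre k = sqrt (2 * real k + 1)"
| "sup_phi1 Chebyshev k = (if k = 0 then 1 else sqrt 2)"

lemma phi1_bound: "\<bar>x\<bar> \<le> 1 \<Longrightarrow> \<bar>phi1 B k x\<bar> \<le> sup_phi1 B k"
  using legendre_P_bound[of x k] chebyshev_T_bound[of x k]
  by (cases B) (auto simp: abs_mult mult_left_le)

lemma continuous_phi1: "continuous_on S (phi1 B k)"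
proof (cases B)
  case Legendre
  have "phi1 Legendre k = (\<lambda>x. sqrt (2 * real k + 1) * legendre_P k x)" by auto
  then show ?thesis using Legendre by (auto intro!: continuous_intros continuous_legendre_P)
next
  case Chebyshev
  have "phi1 Chebyshev k = (\<lambda>x. if k = 0 then 1 else sqrt 2 * chebyshev_T k x)" by auto
  then show ?thesis using Chebyshev by (cases "k = 0") (auto intro!: continuous_intros continuous_chebyshev_T)
qed

lemma phi1_measurable [measurable]: "phi1 B k \<in> borel_measurable borel"
  by (rule borel_measurable_continuous_onI[OF continuous_phi1])

text \<open>
  In the Chebyshev case the product is a combination of two Chebyshev polynomials, of degrees \<open>j + k\<close> and
  \<open>|j - k|\<close>, and those of positive degree have mean zero.
\<close>
lemma phi1_orthonormal: "(LINT x|nu1 B. phi1 B j x * phi1 B k x) = of_bool (j = k)"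
proof (cases B)
  case Legendre
  have "(LINT x|nu1 B. phi1 B j x * phi1 B k x) =
     (LBINT x=ereal (- 1)..ereal 1. (sqrt (2 * real j + 1) * sqrt (2 * real k + 1) / 2) * (legendre_P j x * legendre_P k x))"
    by (subst nu1_integral, measurable) (simp add: Legendre mult_ac)
  also have "\<dots> = (sqrt (2 * real j + 1) * sqrt (2 * real k + 1) / 2) * legendre_ip j k"
    unfolding legendre_ip_def one_ereal_def uminus_ereal.simps by (rule interval_lebesgue_integral_mult_right)
  also have "\<dots> = of_bool (j = k)"
    by (cases "j = k") (auto simp: legendre_P_orthogonal legendre_P_norm)
  finally show ?thesis .
next
  case Chebyshev
  define c where "c i = (if i = 0 then 1 else sqrt 2 :: real)" for i :: nat
  have phi: "phi1 B i x = c i * chebyshev_T i x" for i x by (simp add: Chebyshev c_def)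
  let ?I = "\<lambda>n. (LINT x|nu1 B. chebyshev_T n x)"
  interpret prob_space "nu1 B" by (rule prob_space_nu1)
  have bm: "chebyshev_T n \<in> borel_measurable borel" for n
    by (rule borel_measurable_continuous_onI[OF continuous_chebyshev_T])
  have I: "?I n = of_bool (n = 0)" for n
    unfolding nu1_integral[OF bm] using chebyshev_T_mean_zero[of n] nu1_density_integral(2)[of B]
    by (cases "n = 0") (auto simp: Chebyshev)
  have int: "integrable (nu1 B) (chebyshev_T n)" for n
    by (rule integrable_const_bound[of _ 1])
       (auto intro!: AE_I2 chebyshev_T_bound borel_measurable_nu1 bm)
  let ?d = "if j \<le> k then k - j else j - k"
  have "(LINT x|nu1 B. phi1 B j x * phi1 B k x) =
     (LINT x|nu1 B. c j * c k / 2 * (chebyshev_T (j + k) x + chebyshev_T ?d x))"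
  proof (rule Bochner_Integration.integral_cong)
    fix x assume "x \<in> space (nu1 B)"
    then have "\<bar>x\<bar> \<le> 1" by auto
    from chebyshev_T_mult[OF this, of j k]
    show "phi1 B j x * phi1 B k x = c j * c k / 2 * (chebyshev_T (j + k) x + chebyshev_T ?d x)"
      unfolding phi by (simp add: field_simps)
  qed simp
  also have "\<dots> = c j * c k / 2 * (?I (j + k) + ?I ?d)"
    by (simp add: int)
  also have "\<dots> = of_bool (j = k)"
    unfolding I by (auto simp: c_def)
  finally show ?thesis .
qed

section \<open>Tensor products\<close>

definition sup_phi :: "family \<Rightarrow> nat \<Rightarrow> (nat \<Rightarrow> nat) \<Rightarrow> real" where
  "sup_phi B d i = (\<Prod>l<d. sup_phi1 B (i l))"

lemma sup_phi1_ge_1: "1 \<le> sup_phi1 B k"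
  by (cases B) auto

lemma prob_space_nu: "prob_space (nu B d)"
  unfolding nu_def by (intro prob_space_PiM prob_space_nu1)

lemma space_nu: "space (nu B d) = (\<Pi>\<^sub>E l\<in>{..<d}. {-1<..<1})"
  by (simp add: nu_def space_PiM)

lemma phi_measurable [measurable]: "phi B d i \<in> borel_measurable (nu B d)"
proof -
  have [measurable]: "phi1 B k \<in> borel_measurable (nu1 B)" for k
    by (intro borel_measurable_nu1 phi1_measurable)
  show ?thesis unfolding phi_def[abs_def] nu_def by measurable
qed

lemma phi_bound: "t \<in> space (nu B d) \<Longrightarrow> \<bar>phi B d i t\<bar> \<le> sup_phi B d i"
  unfolding phi_def sup_phi_def abs_prod
  by (intro prod_mono conjI phi1_bound) (auto simp: space_nu PiE_iff dest!: bspec)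

lemma sup_phi_ge_1: "1 \<le> sup_phi B d i"
  unfolding sup_phi_def by (intro prod_ge_1 sup_phi1_ge_1)

lemma phi_orthonormal:
  assumes "i \<in> midx d" "j \<in> midx d"
  shows "(LINT t|nu B d. phi B d i t * phi B d j t) = of_bool (i = j)"
proof -
  interpret P: prob_space "nu1 B" by (rule prob_space_nu1)
  interpret product_sigma_finite "\<lambda>_::nat. nu1 B" by unfold_locales
  have int: "integrable (nu1 B) (\<lambda>x. phi1 B a x * phi1 B b x)" for a b
    by (rule P.integrable_const_bound[of _ "sup_phi1 B a * sup_phi1 B b"])
       (auto intro!: AE_I2 mult_mono phi1_bound borel_measurable_times borel_measurable_nu1 phi1_measurable
          order.trans[OF zero_le_one sup_phi1_ge_1] simp: abs_mult)
  have "(LINT t|nu B d. phi B d i t * phi B d j t) = (LINT t|nu B d. (\<Prod>l<d. phi1 B (i l) (t l) * phi1 B (j l) (t l)))"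
    by (simp add: phi_def prod.distrib)
  also have "\<dots> = (\<Prod>l<d. LINT x|nu1 B. phi1 B (i l) x * phi1 B (j l) x)"
    unfolding nu_def by (rule product_integral_prod) (auto intro: int)
  also have "\<dots> = (\<Prod>l<d. of_bool (i l = j l))" by (simp add: phi1_orthonormal)
  also have "\<dots> = of_bool (i = j)"
  proof (cases "i = j")
    case False
    then obtain l where "i l \<noteq> j l" by auto
    moreover have "l < d" using assms \<open>i l \<noteq> j l\<close> unfolding midx_def by (metis (mono_tags) mem_Collect_eq not_le)
    ultimately have "(\<Prod>l<d. of_bool (i l = j l) :: real) = 0" by (intro prod_zero) auto
    with False show ?thesis by simp
  qed simp
  finally show ?thesis .
qed

lemma Linf_norm_phi_le: "Linf_norm B d (\<lambda>t. complex_of_real (phi B d i t)) \<le> ennreal (sup_phi B d i)"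
  unfolding Linf_norm_def by (intro esssup_I AE_I2) (auto intro!: ennreal_leI phi_bound)

lemma ennreal_weight: "ennreal (weight B d i) = Linf_norm B d (\<lambda>t. complex_of_real (phi B d i t))"
  unfolding weight_def using Linf_norm_phi_le[of B d i] by (intro ennreal_enn2real) (auto simp: less_top[symmetric] top_unique)

lemma weight_le: "weight B d i \<le> sup_phi B d i"
proof -
  have "ennreal (weight B d i) \<le> ennreal (sup_phi B d i)" unfolding ennreal_weight by (rule Linf_norm_phi_le)
  then show ?thesis using sup_phi_ge_1[of B d i] by (subst (asm) ennreal_le_iff) auto
qed

lemma weight_nonneg: "0 \<le> weight B d i"
  by (simp add: weight_def)

lemma AE_phi_le_weight: "AE t in nu B d. \<bar>phi B d i t\<bar> \<le> weight B d i"
proof -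
  have "AE t in nu B d. ennreal (cmod (complex_of_real (phi B d i t))) \<le> ennreal (weight B d i)"
    unfolding ennreal_weight Linf_norm_def by (rule esssup_AE)
  then show ?thesis by eventually_elim (simp add: weight_nonneg)
qed

text \<open>
  A function of norm one in \<open>L\<^sup>2\<close> of a probability measure has essential supremum at least one.
\<close>
lemma weight_ge_1:
  assumes "i \<in> midx d"
  shows "1 \<le> weight B d i"
proof -
  interpret prob_space "nu B d" by (rule prob_space_nu)
  have "1 = (LINT t|nu B d. phi B d i t * phi B d i t)" using phi_orthonormal[OF assms assms] by simp
  also have "\<dots> \<le> (LINT t|nu B d. (weight B d i)\<^sup>2)"
  proof (rule integral_mono_AE)
    have b: "AE t in nu B d. phi B d i t * phi B d i t \<le> (weight B d i)\<^sup>2"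
      using AE_phi_le_weight[of B d i]
      by eventually_elim (metis abs_ge_zero abs_mult_self_eq mult_mono power2_eq_square weight_nonneg)
    show "AE t in nu B d. phi B d i t * phi B d i t \<le> (weight B d i)\<^sup>2" by (rule b)
    show "integrable (nu B d) (\<lambda>t. phi B d i t * phi B d i t)"
      by (rule integrable_const_bound[of _ "(weight B d i)\<^sup>2"]) (use b in auto)
  qed auto
  finally have "1\<^sup>2 \<le> (weight B d i)\<^sup>2" by (simp add: prob_space)
  then show ?thesis by (rule power2_le_imp_le) (rule weight_nonneg)
qed

section \<open>Lower sets and the hyperbolic cross\<close>

text \<open>
  By convexity of \<open>y powr g\<close>, the increment over an interval of length \<open>b\<close> that starts at \<open>A\<close> is at least
  the increment over \<open>[b, 2 b]\<close>.
\<close>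
lemma powr_add_ge:
  fixes A b g :: real
  assumes "1 \<le> g" "0 < b" "b \<le> A"
  shows "A powr g + (2 powr g - 1) * b powr g \<le> (A + b) powr g"
proof -
  let ?f = "\<lambda>y. (y + b) powr g - y powr g"
  have "?f b \<le> ?f A"
  proof (rule DERIV_nonneg_imp_nondecreasing[of b A ?f])
    fix y assume y: "b \<le> y"
    have "(?f has_real_derivative g * (y + b) powr (g - 1) - g * y powr (g - 1)) (at y)"
      using y assms by (auto intro!: derivative_eq_intros)
    moreover have "y powr (g - 1) \<le> (y + b) powr (g - 1)" using assms y by (intro powr_mono2) auto
    then have "0 \<le> g * (y + b) powr (g - 1) - g * y powr (g - 1)" using assms by (simp add: mult_left_mono)
    ultimately show "\<exists>D. (?f has_real_derivative D) (at y) \<and> 0 \<le> D" by blast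
  qed (use assms in auto)
  moreover have "(b + b) powr g = 2 powr g * b powr g" using assms by (simp add: powr_mult[symmetric])
  ultimately show ?thesis by (simp add: algebra_simps)
qed

lemma gam_ge_1: "1 \<le> gam B" and gam_le_2: "gam B \<le> 2"
proof -
  have "ln 3 \<le> ln ((2::real) ^ 2)" by (subst ln_le_cancel_iff) auto
  also have "\<dots> = 2 * ln 2" by (subst ln_realpow) auto
  finally have "ln 3 \<le> 2 * ln (2::real)" .
  then show "gam B \<le> 2" by (cases B) (auto simp: field_simps)
  show "1 \<le> gam B" by (cases B) (auto simp: field_simps)
qed

text \<open>
  One step of the summation over slices below: \<open>A\<close> is the total size of the first \<open>k\<close> slices, each of size
  at least \<open>b\<close>, and \<open>b\<close> the size of the next one. In the Chebyshev case the exponent satisfies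
  \<open>2 powr gam B - 1 = 2\<close>, and \<open>2\<close> is the squared weight of every positive degree.
\<close>
lemma level_gain:
  fixes A b :: real
  assumes "0 \<le> b" "0 \<le> A" "real k * b \<le> A" "k = 0 \<Longrightarrow> A = 0"
  shows "A powr gam B + (sup_phi1 B k)\<^sup>2 * b powr gam B \<le> (A + b) powr gam B"
proof (cases B)
  case Legendre
  have "2 * (real k * b) * b \<le> 2 * A * b" using assms by (intro mult_right_mono) auto
  then show ?thesis using assms Legendre by (simp add: power2_eq_square algebra_simps)
next
  case Chebyshev
  show ?thesis
  proof (cases "k = 0 \<or> b = 0")
    case True
    then show ?thesis using assms Chebyshev by auto
  next
    case False
    then have "1 * b \<le> real k * b" using assms by (intro mult_right_mono) auto
    moreover have "2 powr gam Chebyshev = 3" by (simp add: powr_def)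
    ultimately show ?thesis using powr_add_ge[of "gam B" b A] gam_ge_1[of B] False assms Chebyshev by auto
  qed
qed

lemma sum_levels_le:
  fixes a :: "nat \<Rightarrow> nat"
  assumes "\<And>k. a (Suc k) \<le> a k"
  shows "(\<Sum>k<n. (sup_phi1 B k)\<^sup>2 * real (a k) powr gam B) \<le> real (\<Sum>k<n. a k) powr gam B"
proof (induction n)
  case (Suc n)
  have "real n * real (a n) \<le> real (\<Sum>k<n. a k)"
  proof -
    have "(\<Sum>k<n. a n) \<le> (\<Sum>k<n. a k)"
      by (intro sum_mono lift_Suc_antimono_le[of a, OF assms]) auto
    then have "n * a n \<le> (\<Sum>k<n. a k)" by simp
    then show ?thesis by (metis of_nat_mult of_nat_le_iff)
  qed
  from level_gain[OF of_nat_0_le_iff of_nat_0_le_iff this, of B] Suc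
  show ?case by simp
qed (simp)

lemma lower_slice:
  assumes "lower (Suc d) S"
  shows "lower d {i \<in> midx d. i(d := k) \<in> S}"
    and "{i \<in> midx d. i(d := Suc k) \<in> S} \<subseteq> {i \<in> midx d. i(d := k) \<in> S}"
proof -
  have S: "j \<in> S" if "i \<in> S" "j \<le> i" for i j using assms that by (auto simp: lower_def)
  show "lower d {i \<in> midx d. i(d := k) \<in> S}"
    unfolding lower_def
  proof (intro conjI ballI allI impI subsetI)
    fix i j assume i: "i \<in> {i \<in> midx d. i(d := k) \<in> S}" and ji: "j \<le> i"
    have "j l = 0" if "d \<le> l" for l using i that le_funD[OF ji, of l] by (simp add: midx_def)
    moreover have "j(d := k) \<le> i(d := k)" using ji by (auto simp: le_fun_def)
    ultimately show "j \<in> {i \<in> midx d. i(d := k) \<in> S}" using i S by (auto simp: midx_def)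
  qed auto
  show "{i \<in> midx d. i(d := Suc k) \<in> S} \<subseteq> {i \<in> midx d. i(d := k) \<in> S}"
  proof safe
    fix i assume "i(d := Suc k) \<in> S"
    then show "i(d := k) \<in> S" by (rule S) (auto simp: le_fun_def)
  qed
qed

text \<open>
  Slice \<open>S\<close> by the last coordinate. The slices are lower sets of dimension \<open>d\<close>, they decrease with the value \<open>k\<close>
  of that coordinate, and the squared weight is the product of that of the slice index with \<open>(sup_phi1 B k)\<^sup>2\<close>. So
  the induction hypothesis reduces the claim to \<open>sum_levels_le\<close>.
\<close>
lemma sum_lower_le:
  assumes "lower d S" "finite S"
  shows "(\<Sum>i\<in>S. (sup_phi B d i)\<^sup>2) \<le> real (card S) powr gam B"
  using assms
proof (induction d arbitrary: S)
  case 0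
  then have "S \<subseteq> {\<lambda>_. 0}" by (auto simp: lower_def midx_def)
  then have "S = {} \<or> S = {\<lambda>_. 0}" by auto
  then show ?case by (auto simp: sup_phi_def)
next
  case (Suc d)
  define Sk where "Sk k = {i \<in> midx d. i(d := k) \<in> S}" for k
  obtain n where n: "\<And>i. i \<in> S \<Longrightarrow> i d < n"
    using finite_nat_set_iff_bounded[of "(\<lambda>i. i d) ` S"] Suc.prems by auto
  have S: "S \<subseteq> midx (Suc d)" using Suc.prems by (auto simp: lower_def)
  have inj: "inj_on (\<lambda>i. i(d := k)) (midx d)" for k
  proof (rule inj_onI)
    fix i j assume ij: "i \<in> midx d" "j \<in> midx d" "i(d := k) = j(d := k)"
    show "i = j"
    proof
      fix l show "i l = j l"
      proof (cases "l = d")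
        case True
        then show ?thesis using ij(1,2) by (simp add: midx_def)
      next
        case False
        then show ?thesis using ij(3) by (metis fun_upd_other)
      qed
    qed
  qed
  have finSk: "finite (Sk k)" for k
  proof (rule finite_imageD)
    show "finite ((\<lambda>i. i(d := k)) ` Sk k)" by (rule finite_subset[OF _ Suc.prems(2)]) (auto simp: Sk_def)
    show "inj_on (\<lambda>i. i(d := k)) (Sk k)" by (rule inj_on_subset[OF inj]) (auto simp: Sk_def)
  qed
  have sumS: "(\<Sum>i\<in>S. F i) = (\<Sum>k<n. \<Sum>i\<in>Sk k. F (i(d := k)))" for F :: "(nat \<Rightarrow> nat) \<Rightarrow> 'x::comm_monoid_add"
  proof -
    have "(\<Sum>k<n. \<Sum>i\<in>Sk k. F (i(d := k))) = (\<Sum>(k, i)\<in>(SIGMA k:{..<n}. Sk k). F (i(d := k)))"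
      by (rule sum.Sigma) (auto intro: finSk)
    also have "\<dots> = (\<Sum>i\<in>S. F i)"
    proof (rule sum.reindex_bij_witness[of _ "\<lambda>i. (i d, i(d := 0))" "\<lambda>(k, i). i(d := k)"])
      fix i assume i: "i \<in> S"
      then have z: "i l = 0" if "Suc d \<le> l" for l using S that by (auto simp: midx_def)
      have "i(d := 0) \<in> midx d"
        unfolding midx_def
      proof (intro CollectI allI impI)
        fix l assume "d \<le> l"
        then show "(i(d := 0)) l = 0" using z[of l] by (cases "l = d") auto
      qed
      then show "(i d, i(d := 0)) \<in> (SIGMA k:{..<n}. Sk k)" using i n by (auto simp: Sk_def)
    next
      fix p assume "p \<in> (SIGMA k:{..<n}. Sk k)"
      moreover have "i(d := 0) = i" if "i \<in> midx d" for i using that by (auto simp: midx_def)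
      ultimately show "((case p of (k, i) \<Rightarrow> i(d := k)) d, (case p of (k, i) \<Rightarrow> i(d := k))(d := 0)) = p"
        by (auto simp: Sk_def)
    qed (auto simp: Sk_def)
    finally show ?thesis ..
  qed
  have cardS: "card S = (\<Sum>k<n. card (Sk k))" using sumS[of "\<lambda>_. 1 :: nat"] by simp
  have phi_upd: "(sup_phi B (Suc d) (i(d := k)))\<^sup>2 = (sup_phi1 B k)\<^sup>2 * (sup_phi B d i)\<^sup>2" for i k
    by (simp add: sup_phi_def power_mult_distrib mult.commute)
  have "(\<Sum>i\<in>S. (sup_phi B (Suc d) i)\<^sup>2) = (\<Sum>k<n. (sup_phi1 B k)\<^sup>2 * (\<Sum>i\<in>Sk k. (sup_phi B d i)\<^sup>2))"
    unfolding sumS phi_upd sum_distrib_left ..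
  also have "\<dots> \<le> (\<Sum>k<n. (sup_phi1 B k)\<^sup>2 * real (card (Sk k)) powr gam B)"
    unfolding Sk_def using finSk unfolding Sk_def
    by (intro sum_mono mult_left_mono Suc.IH lower_slice(1)[OF Suc.prems(1)]) auto
  also have "\<dots> \<le> real (\<Sum>k<n. card (Sk k)) powr gam B"
    by (rule sum_levels_le) (unfold Sk_def, rule card_mono[OF finSk[unfolded Sk_def] lower_slice(2)[OF Suc.prems(1)]])
  finally show ?case by (simp add: cardS)
qed

lemma wcard_lower_le:
  assumes "lower d S" "finite S" "card S \<le> s"
  shows "wcard B d S \<le> real s powr gam B"
proof -
  have "wcard B d S \<le> (\<Sum>i\<in>S. (sup_phi B d i)\<^sup>2)"
    unfolding wcard_def by (intro sum_mono power_mono weight_le weight_nonneg)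
  also have "\<dots> \<le> real (card S) powr gam B" by (rule sum_lower_le) fact+
  also have "\<dots> \<le> real s powr gam B" using assms gam_ge_1[of B] by (intro powr_mono2) auto
  finally show ?thesis .
qed

lemma finite_HC: "finite (HC d s)"
proof -
  have "HC d s \<subseteq> {i. \<forall>l. (l \<in> {..<d} \<longrightarrow> i l \<in> {..s}) \<and> (l \<notin> {..<d} \<longrightarrow> i l = 0)}"
  proof (intro subsetI CollectI allI conjI impI)
    fix i l assume i: "i \<in> HC d s"
    show "i l = 0" if "l \<notin> {..<d}" using i that by (auto simp: HC_def midx_def)
    assume l: "l \<in> {..<d}"
    have "i l + 1 \<le> (\<Prod>l<d. (i l + 1))"
      using l by (intro dvd_imp_le dvd_prodI) auto
    then show "i l \<in> {..s}" using i by (auto simp: HC_def)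
  qed
  then show ?thesis by (rule finite_subset) (intro finite_set_of_finite_funs; simp)
qed

lemma card_le_box:
  assumes "i \<in> midx d"
  shows "finite {j. j \<le> i}" "card {j. j \<le> i} = (\<Prod>l<d. (i l + 1))"
proof -
  have "bij_betw (\<lambda>j. restrict j {..<d}) {j. j \<le> i} (\<Pi>\<^sub>E l\<in>{..<d}. {..i l})"
  proof (rule bij_betw_byWitness[where f' = "\<lambda>j l. if l < d then j l else 0"])
    have z: "j l = 0" if "j \<le> i" "d \<le> l" for j l
      using le_funD[OF that(1), of l] that(2) assms by (simp add: midx_def)
    show "\<forall>j\<in>{j. j \<le> i}. (\<lambda>l. if l < d then restrict j {..<d} l else 0) = j"
      using z by (auto simp: fun_eq_iff)
    show "\<forall>j\<in>(\<Pi>\<^sub>E l\<in>{..<d}. {..i l}). restrict (\<lambda>l. if l < d then j l else 0) {..<d} = j"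
      by (auto simp: fun_eq_iff PiE_def extensional_def)
    show "(\<lambda>j. restrict j {..<d}) ` {j. j \<le> i} \<subseteq> (\<Pi>\<^sub>E l\<in>{..<d}. {..i l})"
      by (auto simp: le_fun_def split: if_splits)
    show "(\<lambda>j l. if l < d then j l else 0) ` (\<Pi>\<^sub>E l\<in>{..<d}. {..i l}) \<subseteq> {j. j \<le> i}"
    proof (intro image_subsetI CollectI le_funI)
      fix j l assume "j \<in> (\<Pi>\<^sub>E l\<in>{..<d}. {..i l})"
      then have "l < d \<Longrightarrow> j l \<le> i l" by (auto dest: PiE_mem[of j "{..<d}" "\<lambda>l. {..i l}" l])
      then show "(if l < d then j l else 0) \<le> i l" by simp
    qed
  qed
  note b = this
  show "finite {j. j \<le> i}" using bij_betw_finite[OF b] by (simp add: finite_PiE)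
  show "card {j. j \<le> i} = (\<Prod>l<d. (i l + 1))"
    using bij_betw_same_card[OF b] by (simp add: card_PiE)
qed

text \<open>
  A lower set that contains \<open>i\<close> contains the whole box below \<open>i\<close>, whose cardinality is the product that
  defines the hyperbolic cross.
\<close>
lemma lower_subset_HC:
  assumes "lower d S" "finite S" "card S \<le> s"
  shows "S \<subseteq> HC d s"
proof
  fix i assume i: "i \<in> S"
  then have m: "i \<in> midx d" using assms by (auto simp: lower_def)
  have "{j. j \<le> i} \<subseteq> S" using i assms by (auto simp: lower_def)
  then have "card {j. j \<le> i} \<le> card S" using assms by (intro card_mono)
  then show "i \<in> HC d s" using card_le_box[OF m] m assms by (simp add: HC_def)
qed

text \<open>
  The segment of length \<open>s\<close> on the first axis is a lower set, and all weights are at least \<open>1\<close>.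
\<close>
lemma Kfun_ge:
  assumes "1 \<le> d"
  shows "real s \<le> Kfun B d s"
proof -
  define e where "e k = (\<lambda>l::nat. if l = 0 then k else 0 :: nat)" for k
  have inj: "inj e" by (rule injI) (metis e_def)
  have midx: "e k \<in> midx d" for k using assms by (auto simp: e_def midx_def)
  let ?S = "e ` {..<s}"
  have "lower d ?S"
    unfolding lower_def
  proof (intro conjI ballI allI impI)
    fix i j assume "i \<in> ?S" "j \<le> i"
    then obtain k where k: "k < s" "j \<le> e k" by auto
    have "j = e (j 0)"
    proof
      fix l show "j l = e (j 0) l" using le_funD[OF k(2), of l] by (simp add: e_def split: if_splits)
    qed
    moreover have "j 0 < s" using le_funD[OF k(2), of 0] k(1) by (simp add: e_def)
    ultimately show "j \<in> ?S" by blast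
  qed (use midx in auto)
  moreover have cS: "card ?S = s" using inj by (simp add: card_image inj_on_subset)
  ultimately have mem: "?S \<in> {S. lower d S \<and> finite S \<and> card S \<le> s}" by simp
  have "{S. lower d S \<and> finite S \<and> card S \<le> s} \<subseteq> Pow (HC d s)" using lower_subset_HC by blast
  then have fin: "finite {S. lower d S \<and> finite S \<and> card S \<le> s}"
    by (rule finite_subset) (simp add: finite_HC)
  have "real s = (\<Sum>i\<in>?S. 1)" by (simp only: sum_constant mult_1_right cS)
  also have "\<dots> \<le> wcard B d ?S"
    unfolding wcard_def
  proof (rule sum_mono)
    fix i assume "i \<in> ?S"
    then have "1 \<le> weight B d i" using midx weight_ge_1 by blast
    then show "1 \<le> (weight B d i)\<^sup>2" by (rule one_le_power)
  qed
  also have "\<dots> \<le> Kfun B d s" unfolding Kfun_def using fin mem by (intro Max_ge) auto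
  finally show ?thesis .
qed

lemma card_HC_ge_2:
  assumes "1 \<le> d" "2 \<le> s"
  shows "2 \<le> card (HC d s)"
proof -
  let ?z = "\<lambda>_::nat. 0 :: nat" and ?e = "\<lambda>l::nat. if l = 0 then 1 else 0 :: nat"
  have "(\<Prod>l<d. ?e l + 1) = (\<Prod>l\<in>{0}. ?e l + 1)"
    using assms by (intro prod.mono_neutral_right) auto
  then have "{?z, ?e} \<subseteq> HC d s" using assms by (auto simp: HC_def midx_def)
  moreover have "card {?z, ?e} = 2" using fun_cong[of ?z ?e 0] by (intro card_2_iff[THEN iffD2] exI conjI refl) auto
  ultimately show ?thesis using card_mono[OF finite_HC, of "{?z, ?e}" d s] by simp
qed

section \<open>Completeness of the tensor basis\<close>

text \<open>
  The sets \<open>A\<close> over whose preimages \<open>H\<close> integrates to zero form a Dynkin system.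
\<close>
lemma set_integral_zero_generated:
  fixes H :: "'a \<Rightarrow> real"
  assumes H: "integrable M H" and X: "X \<in> measurable M N"
    and N: "sets N = sigma_sets (space N) G" "Int_stable G" "G \<subseteq> Pow (space N)"
    and H0: "(LINT x|M. H x) = 0"
    and G0: "\<And>A. A \<in> G \<Longrightarrow> (LINT x|M. H x * indicator A (X x)) = 0"
    and A: "A \<in> sets N"
  shows "(LINT x|M. H x * indicator A (X x)) = 0"
proof -
  have [measurable]: "X \<in> measurable M N" by (rule X)
  have Hb [measurable]: "H \<in> borel_measurable M" using H by simp
  have int: "integrable M (\<lambda>x. H x * indicator B (X x))" if [measurable]: "B \<in> sets N" for B
    by (rule Bochner_Integration.integrable_bound[OF H]) (auto simp: indicator_def)
  have "A \<in> sigma_sets (space N) G" using A N by simp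
  from N(2,3) this have "A \<in> sets N \<and> (LINT x|M. H x * indicator A (X x)) = 0"
  proof (induction rule: sigma_sets_induct_disjoint)
    case (basic A)
    then show ?case using N G0 by (auto intro: sigma_sets.Basic)
  next
    case empty
    then show ?case by simp
  next
    case (compl A)
    then have [measurable]: "A \<in> sets N" by simp
    have "(LINT x|M. H x * indicator (space N - A) (X x)) = (LINT x|M. H x - H x * indicator A (X x))"
      using measurable_space[OF X] by (intro Bochner_Integration.integral_cong) (auto simp: indicator_def)
    also have "\<dots> = 0" using compl H0 by (subst Bochner_Integration.integral_diff) (auto intro: H int)
    finally show ?case by auto
  next
    case (union A)
    then have A [measurable]: "A i \<in> sets N" for i by auto
    let ?B = "\<lambda>i. X -` A i \<inter> space M"
    have B: "?B i \<in> sets M" for i by measurable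
    have eq: "(LINT x:(X -` C \<inter> space M)|M. H x) = (LINT x|M. H x * indicator C (X x))" for C
      unfolding set_lebesgue_integral_def by (intro Bochner_Integration.integral_cong) (auto simp: indicator_def)
    have "(LINT x:(\<Union>i. ?B i)|M. H x) = (\<Sum>i. (LINT x:?B i|M. H x))"
    proof (rule lebesgue_integral_countable_add)
      show "?B i \<inter> ?B j = {}" if "i \<noteq> j" for i j using union(1) that by (auto simp: disjoint_family_on_def)
      show "set_integrable M (\<Union>i. ?B i) H"
        unfolding set_integrable_def using B by (intro integrable_mult_indicator H sets.countable_UN) auto
    qed (rule B)
    also have "\<dots> = 0" unfolding eq using union by simp
    also have "(\<Union>i. ?B i) = X -` (\<Union>i. A i) \<inter> space M" by auto
    finally show ?case unfolding eq by auto
  qed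
  then show ?thesis by simp
qed

text \<open>
  For \<open>j = 0\<close> the index \<open>j - 1\<close> is again \<open>0\<close>, and the second term can be omitted.
\<close>
lemma phi1_recurrence:
  "\<exists>a b. \<forall>x. x * phi1 B j x = a * phi1 B (Suc j) x + b * phi1 B (j - 1) x"
proof (cases B)
  case Legendre
  define n where "n i = sqrt (2 * real i + 1)" for i
  have n: "n i \<noteq> 0" "phi1 B i x = n i * legendre_P i x" for i x using Legendre by (auto simp: n_def)
  have "x * legendre_P j x = (real j + 1) / (2 * real j + 1) * legendre_P (Suc j) x + real j / (2 * real j + 1) * legendre_P (j - 1) x" for x
    by (cases j) (auto simp: divide_simps, simp add: algebra_simps)
  then have "\<forall>x. x * phi1 B j x = (n j * ((real j + 1) / (2 * real j + 1)) / n (Suc j)) * phi1 B (Suc j) x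
     + (n j * (real j / (2 * real j + 1)) / n (j - 1)) * phi1 B (j - 1) x"
    unfolding n(2) using n(1) by (simp add: mult.left_commute[of _ "n j"] distrib_left)
  then show ?thesis by blast
next
  case Chebyshev
  show ?thesis
  proof (cases "j \<le> 1")
    case True
    show ?thesis
    proof (cases "j = 0")
      case True
      then show ?thesis by (intro exI[of _ "1 / sqrt 2"] exI[of _ 0]) (simp add: Chebyshev)
    next
      case False
      then have "j = 1" using True by simp
      then show ?thesis using Chebyshev
        by (intro exI[of _ "1 / 2"] exI[of _ "sqrt 2 / 2"]) (auto simp: eval_nat_numeral algebra_simps)
    qed
  next
    case False
    then obtain k where "j = Suc (Suc k)" by (cases j rule: nat.exhaust[case_names zero suc]; cases "j - 1") auto
    then show ?thesis using Chebyshev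
      by (intro exI[of _ "1 / 2"] exI[of _ "1 / 2"]) (auto simp: algebra_simps)
  qed
qed

text \<open>
  The class of functions \<open>q\<close> with zero integral of \<open>H q(X)\<close> grows step by step: multiplication by the variable preserves the span
  of the \<open>phi1 B n\<close>, which gives all polynomials; uniform limits give the continuous functions; and bounded
  pointwise limits give indicators of rays, which generate the Borel sets.
\<close>
lemma integral_indicator_zero_of_moments:
  fixes H :: "'a \<Rightarrow> real" and X :: "'a \<Rightarrow> real"
  assumes H: "integrable M H" and X [measurable]: "X \<in> borel_measurable M"
    and X1: "\<And>x. x \<in> space M \<Longrightarrow> \<bar>X x\<bar> \<le> 1"
    and orth: "\<And>n. (LINT x|M. H x * phi1 B n (X x)) = 0"
    and A: "A \<in> sets borel"
  shows "(LINT x|M. H x * indicator A (X x)) = 0"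
proof -
  have Hb [measurable]: "H \<in> borel_measurable M" using H by simp
  have int: "integrable M (\<lambda>x. H x * q (X x))"
    if [measurable]: "q \<in> borel_measurable borel" and b: "\<And>y. \<bar>y\<bar> \<le> 1 \<Longrightarrow> \<bar>q y\<bar> \<le> C" for q :: "real \<Rightarrow> real" and C
  proof (rule Bochner_Integration.integrable_bound)
    show "integrable M (\<lambda>x. C * H x)" using H by simp
    show "AE x in M. norm (H x * q (X x)) \<le> norm (C * H x)"
    proof (rule AE_I2)
      fix x assume "x \<in> space M"
      then have "\<bar>q (X x)\<bar> \<le> C" using b X1 by blast
      then have "\<bar>H x\<bar> * \<bar>q (X x)\<bar> \<le> \<bar>H x\<bar> * \<bar>C\<bar>" by (intro mult_left_mono) auto
      then show "norm (H x * q (X x)) \<le> norm (C * H x)" by (simp add: abs_mult mult.commute)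
    qed
  qed measurable
  have intc: "integrable M (\<lambda>x. H x * q (X x))" if c: "continuous_on UNIV q" for q :: "real \<Rightarrow> real"
  proof -
    have "compact (q ` {-1..1})" by (intro compact_continuous_image continuous_on_subset[OF c]) auto
    then obtain C where C: "\<And>y. y \<in> q ` {-1..1} \<Longrightarrow> norm y \<le> C" using compact_imp_bounded bounded_iff by metis
    show ?thesis
    proof (intro int[where C = C] borel_measurable_continuous_onI c)
      fix y :: real assume "\<bar>y\<bar> \<le> 1"
      then have "q y \<in> q ` {-1..1}" by (intro imageI) (auto simp: abs_le_iff)
      then show "\<bar>q y\<bar> \<le> C" using C by fastforce
    qed
  qed
  have mom: "(LINT x|M. H x * (X x ^ n * phi1 B j (X x))) = 0" for n j
  proof (induction n arbitrary: j)
    case 0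
    then show ?case by (simp add: orth)
  next
    case (Suc n)
    obtain a b where ab: "\<And>x. x * phi1 B j x = a * phi1 B (Suc j) x + b * phi1 B (j - 1) x"
      using phi1_recurrence[of B j] by auto
    have i: "integrable M (\<lambda>x. H x * (X x ^ n * phi1 B k (X x)))" for k
      by (rule intc) (intro continuous_intros continuous_phi1)
    have "H x * (X x ^ Suc n * phi1 B j (X x)) = a * (H x * (X x ^ n * phi1 B (Suc j) (X x))) + b * (H x * (X x ^ n * phi1 B (j - 1) (X x)))" for x
    proof -
      have "H x * (X x ^ Suc n * phi1 B j (X x)) = H x * (X x ^ n * (X x * phi1 B j (X x)))" by simp
      then show ?thesis unfolding ab by (simp add: algebra_simps)
    qed
    then show ?case using i Suc by (simp only:) simp
  qed
  have phi0: "phi1 B 0 y = 1" for y by (cases B) auto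
  have pow: "(LINT x|M. H x * X x ^ n) = 0" for n using mom[of n 0] by (simp add: phi0)
  have H0: "(LINT x|M. H x) = 0" using pow[of 0] by simp
  have poly: "(LINT x|M. H x * g (X x)) = 0" if g: "real_polynomial_function g" for g
  proof -
    obtain a n where g: "g = (\<lambda>x. \<Sum>i\<le>n. a i * x ^ i)" using g by (auto simp: real_polynomial_function_iff_sum)
    have "(LINT x|M. H x * g (X x)) = (LINT x|M. (\<Sum>i\<le>n. a i * (H x * X x ^ i)))"
      by (simp add: g sum_distrib_left mult.left_commute)
    also have "\<dots> = (\<Sum>i\<le>n. a i * (LINT x|M. H x * X x ^ i))"
      by (subst Bochner_Integration.integral_sum) (auto intro!: integrable_mult_right intc continuous_intros)
    finally show ?thesis by (simp add: pow)
  qed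
  have cont: "(LINT x|M. H x * f (X x)) = 0" if f: "continuous_on UNIV f" for f
  proof -
    have "\<bar>LINT x|M. H x * f (X x)\<bar> \<le> e * (LINT x|M. \<bar>H x\<bar>)" if e: "0 < e" for e
    proof -
      obtain g where g: "real_polynomial_function g" "\<And>x. x \<in> {-1..1} \<Longrightarrow> \<bar>f x - g x\<bar> < e"
        using Stone_Weierstrass_real_polynomial_function[OF _ continuous_on_subset[OF f] e, of "{-1..1}"] by auto
      have gc: "continuous_on UNIV g" using g(1) continuous_real_polymonial_function by (auto simp: continuous_on_eq_continuous_at)
      have "(LINT x|M. H x * f (X x)) = (LINT x|M. H x * f (X x)) - (LINT x|M. H x * g (X x))"
        using poly[OF g(1)] by simp
      also have "\<dots> = (LINT x|M. H x * (f (X x) - g (X x)))"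
        by (subst Bochner_Integration.integral_diff[symmetric]) (auto intro: intc f gc simp: algebra_simps)
      finally have "\<bar>LINT x|M. H x * f (X x)\<bar> \<le> (LINT x|M. \<bar>H x * (f (X x) - g (X x))\<bar>)"
        using integral_abs_bound by metis
      also have "\<dots> \<le> (LINT x|M. e * \<bar>H x\<bar>)"
      proof (rule integral_mono)
        show "integrable M (\<lambda>x. \<bar>H x * (f (X x) - g (X x))\<bar>)"
          by (intro integrable_abs intc[of "\<lambda>y. f y - g y"] continuous_intros f gc)
        fix x assume "x \<in> space M"
        then have "\<bar>f (X x) - g (X x)\<bar> \<le> e" using g(2)[of "X x"] X1[of x] by (simp add: abs_le_iff less_imp_le)
        then show "\<bar>H x * (f (X x) - g (X x))\<bar> \<le> e * \<bar>H x\<bar>" by (simp add: abs_mult mult.commute[of e] mult_left_mono)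
      qed (use H in auto)
      finally show ?thesis by simp
    qed
    note small = this
    show ?thesis
    proof (rule ccontr)
      assume "(LINT x|M. H x * f (X x)) \<noteq> 0"
      define I J where "I = \<bar>LINT x|M. H x * f (X x)\<bar>" and "J = (LINT x|M. \<bar>H x\<bar>)"
      have "0 < I" "0 \<le> J" using \<open>_ \<noteq> 0\<close> by (auto simp: I_def J_def)
      then have "I / (J + 1) * J < I" by (simp add: field_simps)
      moreover have "I \<le> I / (J + 1) * J" using small[of "I / (J + 1)"] \<open>0 < I\<close> \<open>0 \<le> J\<close> unfolding I_def J_def by auto
      ultimately show False by simp
    qed
  qed
  have ray: "(LINT x|M. H x * indicator {..a} (X x)) = 0" for a
  proof -
    define s where "s n y = max 0 (min 1 (1 - real n * (y - a)))" for n :: nat and y :: real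
    have sc: "continuous_on UNIV (s n)" for n unfolding s_def by (intro continuous_intros)
    have [measurable]: "s n \<in> borel_measurable borel" for n by (rule borel_measurable_continuous_onI[OF sc])
    have lim: "(\<lambda>n. s n y) \<longlonglongrightarrow> indicator {..a} y" for y
    proof (cases "y \<le> a")
      case True
      then have "s n y = 1" for n using mult_nonneg_nonpos[of "real n" "y - a"] by (simp add: s_def)
      then show ?thesis using True by simp
    next
      case False
      obtain N where N: "1 / (y - a) < real N" using reals_Archimedean2 by blast
      have "s n y = 0" if "N \<le> n" for n
      proof -
        have "1 < real N * (y - a)" using N False by (simp add: field_simps)
        also have "\<dots> \<le> real n * (y - a)" using that False by (intro mult_right_mono) auto
        finally show ?thesis by (simp add: s_def)
      qed
      then have "\<forall>\<^sub>F n in sequentially. s n y = 0" by (auto simp: eventually_sequentially)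
      then show ?thesis using False by (simp add: tendsto_eventually)
    qed
    have "(\<lambda>n. LINT x|M. H x * s n (X x)) \<longlonglongrightarrow> (LINT x|M. H x * indicator {..a} (X x))"
    proof (rule integral_dominated_convergence[where w = "\<lambda>x. \<bar>H x\<bar>"])
      show "AE x in M. (\<lambda>n. H x * s n (X x)) \<longlonglongrightarrow> H x * indicator {..a} (X x)"
        by (intro AE_I2 tendsto_mult lim tendsto_const)
      show "AE x in M. norm (H x * s n (X x)) \<le> \<bar>H x\<bar>" for n
        by (intro AE_I2) (auto simp: abs_mult s_def intro!: mult_left_le)
    qed (use H in auto)
    then show ?thesis unfolding cont[OF sc] by (simp add: LIMSEQ_const_iff)
  qed
  show ?thesis
  proof (rule set_integral_zero_generated[OF H X _ _ _ H0 _ A])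
    show "sets borel = sigma_sets (space borel) (range (\<lambda>a::real. {..a}))"
      by (subst borel_eq_atMost) simp
    show "Int_stable (range (\<lambda>a::real. {..a}))"
      by (auto simp: Int_stable_def intro!: image_eqI[of _ _ "min _ _"])
  qed (auto simp: ray)
qed

text \<open>
  The one-dimensional lemma is applied to one coordinate at a time, with the factors in the other
  coordinates absorbed into \<open>H\<close>. At the end \<open>h\<close> has zero integral over every measurable box, hence over every measurable set.
\<close>
lemma phi_complete_real:
  fixes h :: "(nat \<Rightarrow> real) \<Rightarrow> real"
  assumes h: "integrable (nu B d) h"
    and orth: "\<And>i. i \<in> midx d \<Longrightarrow> (LINT t|nu B d. h t * phi B d i t) = 0"
  shows "AE t in nu B d. h t = 0"
proof -
  let ?M = "nu B d"
  interpret prob_space ?M by (rule prob_space_nu)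
  have [measurable]: "h \<in> borel_measurable ?M" using h by simp
  have coord_borel [measurable]: "(\<lambda>t. t l) \<in> borel_measurable ?M" if "l < d" for l
  proof -
    have "(\<lambda>t. t l) \<in> measurable ?M (nu1 B)" unfolding nu_def using that by (intro measurable_component_singleton) auto
    moreover have "(\<lambda>x. x) \<in> borel_measurable (nu1 B)" by (rule borel_measurable_nu1) simp
    ultimately show ?thesis by (rule measurable_compose)
  qed
  have coord1: "\<bar>t l\<bar> \<le> 1" if "t \<in> space ?M" "l < d" for t l
    using that by (auto simp: space_nu PiE_iff dest!: bspec[of _ _ l])
  \<comment> \<open>polynomial factors are exchanged for indicator functions one coordinate at a time\<close>
  have "(LINT t|?M. h t * (\<Prod>l<d. if l < k then indicat_real (A l) (t l) else phi1 B (i l) (t l))) = 0"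
    if "k \<le> d" "\<And>l. A l \<in> sets borel" for k i A
    using that
  proof (induction k arbitrary: i)
    case 0
    let ?i = "\<lambda>l. if l < d then i l else 0"
    have "?i \<in> midx d" by (simp add: midx_def)
    from orth[OF this] show ?case by (simp add: phi_def)
  next
    case (Suc k)
    define f where "f j l y = (if l < k then indicat_real (A l) y else phi1 B (j l) y)" for j :: "nat \<Rightarrow> nat" and l y
    define G where "G t = (\<Prod>l\<in>{..<d} - {k}. f i l (t l))" for t
    have [measurable]: "f j l \<in> borel_measurable borel" for j l
      using Suc.prems by (cases "l < k") (auto simp: f_def[abs_def])
    have [measurable]: "G \<in> borel_measurable ?M"
      unfolding G_def by (intro borel_measurable_prod measurable_compose[OF coord_borel]) auto
    have fb: "\<bar>f i l y\<bar> \<le> sup_phi1 B (i l)" if "\<bar>y\<bar> \<le> 1" for l y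
      using sup_phi1_ge_1[of B "i l"] phi1_bound[OF that] by (auto simp: f_def indicator_def)
    have Gb: "\<bar>G t\<bar> \<le> (\<Prod>l\<in>{..<d} - {k}. sup_phi1 B (i l))" if "t \<in> space ?M" for t
      unfolding G_def abs_prod using that by (intro prod_mono conjI fb coord1) auto
    have hG: "integrable ?M (\<lambda>t. h t * G t)"
    proof (rule Bochner_Integration.integrable_bound)
      show "integrable ?M (\<lambda>t. h t * (\<Prod>l\<in>{..<d} - {k}. sup_phi1 B (i l)))" using h by simp
      show "AE t in ?M. norm (h t * G t) \<le> norm (h t * (\<Prod>l\<in>{..<d} - {k}. sup_phi1 B (i l)))"
        using Gb by (intro AE_I2) (auto simp: abs_mult intro!: mult_left_mono order.trans[OF Gb])
    qed measurable
    have split: "(\<Prod>l<d. f (i(k := n)) l (t l)) = G t * phi1 B n (t k)" for n t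
    proof -
      have "(\<Prod>l<d. f (i(k := n)) l (t l)) = f (i(k := n)) k (t k) * (\<Prod>l\<in>{..<d} - {k}. f (i(k := n)) l (t l))"
        using Suc.prems by (intro prod.remove) auto
      also have "(\<Prod>l\<in>{..<d} - {k}. f (i(k := n)) l (t l)) = G t"
        unfolding G_def by (intro prod.cong) (auto simp: f_def)
      also have "f (i(k := n)) k (t k) = phi1 B n (t k)" by (simp add: f_def)
      finally show ?thesis by (simp only: mult.commute)
    qed
    have "(LINT t|?M. (h t * G t) * indicator (A k) (t k)) = 0"
    proof (rule integral_indicator_zero_of_moments[OF hG coord_borel])
      show "(LINT t|?M. h t * G t * phi1 B n (t k)) = 0" for n
        using Suc.IH[of "i(k := n)"] Suc.prems split[of n] by (simp add: f_def[symmetric] mult.assoc)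
    qed (use Suc.prems coord1 in auto)
    moreover have "(\<Prod>l<d. if l < Suc k then indicat_real (A l) (t l) else phi1 B (i l) (t l)) = G t * indicator (A k) (t k)" for t
    proof -
      have "(\<Prod>l<d. if l < Suc k then indicat_real (A l) (t l) else phi1 B (i l) (t l))
        = indicator (A k) (t k) * (\<Prod>l\<in>{..<d} - {k}. if l < Suc k then indicat_real (A l) (t l) else phi1 B (i l) (t l))"
        using Suc.prems by (subst prod.remove[of _ k]) auto
      also have "(\<Prod>l\<in>{..<d} - {k}. if l < Suc k then indicat_real (A l) (t l) else phi1 B (i l) (t l)) = G t"
        unfolding G_def by (intro prod.cong) (auto simp: f_def)
      finally show ?thesis by simp
    qed
    ultimately show ?case by (simp add: mult.assoc)
  qed
  note swapped = this
  have box: "(LINT t|?M. h t * (\<Prod>l<d. indicat_real (A l) (t l))) = 0" if A: "\<And>l. A l \<in> sets borel" for A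
  proof -
    have "(\<Prod>l<d. if l < d then indicat_real (A l) (t l) else phi1 B 0 (t l)) = (\<Prod>l<d. indicat_real (A l) (t l))"
      for t :: "nat \<Rightarrow> real"
      by (intro prod.cong) auto
    then show ?thesis using swapped[of d A "\<lambda>_. 0"] A by simp
  qed
  have box': "(LINT t|?M. h t * indicator A t) = 0" if A: "A \<in> prod_algebra {..<d} (\<lambda>_. nu1 B)" for A
  proof -
    obtain E where E: "A = Pi\<^sub>E {..<d} E" "E \<in> (\<Pi> l\<in>{..<d}. sets (nu1 B))" by (rule prod_algebraE_all[OF A])
    define E' where "E' l = (if l < d then E l else {})" for l
    have E'b: "E' l \<in> sets borel" for l
    proof -
      have "E l \<in> sets (restrict_space borel {-1<..<1})" if "l < d" using E(2) that by (auto simp: sets_nu1)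
      then show ?thesis by (auto simp: E'_def sets_restrict_space_iff)
    qed
    have "(LINT t|?M. h t * indicator A t) = (LINT t|?M. h t * (\<Prod>l<d. indicat_real (E' l) (t l)))"
    proof (intro Bochner_Integration.integral_cong refl arg_cong2[of _ _ _ _ "(*)"])
      fix t assume "t \<in> space ?M"
      then show "indicator A t = (\<Prod>l<d. indicat_real (E' l) (t l))"
        by (auto simp: E(1) indicator_def space_nu PiE_iff E'_def split: if_splits)
    qed
    also have "\<dots> = 0" by (rule box) (rule E'b)
    finally show ?thesis .
  qed
  have zero: "(LINT t|?M. h t * indicator A t) = 0" if A: "A \<in> sets ?M" for A
  proof (rule set_integral_zero_generated[OF h measurable_ident_sets[OF refl] _ _ _ _ box' A, simplified])
    show "sets ?M = sigma_sets (space ?M) (prod_algebra {..<d} (\<lambda>_. nu1 B))"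
      unfolding nu_def by (simp add: sets_PiM space_PiM)
    show "prod_algebra {..<d} (\<lambda>_. nu1 B) \<subseteq> Pow (space ?M)"
      unfolding nu_def space_PiM by (rule prod_algebra_sets_into_space)
    show "(LINT t|?M. h t) = 0" using box[of "\<lambda>_. UNIV"] by simp
  qed (auto intro: Int_stable_prod_algebra)
  have "AE t in ?M. h t * indicator {t \<in> space ?M. 0 \<le> h t} t = 0"
    using zero[of "{t \<in> space ?M. 0 \<le> h t}"] 
    by (subst integral_nonneg_eq_0_iff_AE[symmetric]) (auto simp: indicator_def intro!: AE_I2 Bochner_Integration.integrable_bound[OF h])
  moreover have "AE t in ?M. - (h t * indicator {t \<in> space ?M. h t \<le> 0} t) = 0"
    using zero[of "{t \<in> space ?M. h t \<le> 0}"]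
    by (subst integral_nonneg_eq_0_iff_AE[symmetric]) (auto simp: indicator_def intro!: AE_I2 Bochner_Integration.integrable_bound[OF h])
  ultimately show ?thesis
    using AE_space by eventually_elim (auto simp: indicator_def split: if_splits)
qed

lemma phi_complete:
  fixes h :: "(nat \<Rightarrow> real) \<Rightarrow> complex"
  assumes h: "integrable (nu B d) h"
    and orth: "\<And>i. i \<in> midx d \<Longrightarrow> (LINT t|nu B d. h t * complex_of_real (phi B d i t)) = 0"
  shows "AE t in nu B d. h t = 0"
proof -
  have int: "integrable (nu B d) (\<lambda>t. h t * complex_of_real (phi B d i t))" for i
  proof (rule Bochner_Integration.integrable_bound)
    show "integrable (nu B d) (\<lambda>t. h t * complex_of_real (sup_phi B d i))" using h by simp
    show "AE t in nu B d. norm (h t * complex_of_real (phi B d i t)) \<le> norm (h t * complex_of_real (sup_phi B d i))"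
      by (intro AE_I2) (auto simp: norm_mult intro!: mult_left_mono order.trans[OF phi_bound])
  qed (use h in auto)
  have "AE t in nu B d. Re (h t) = 0"
  proof (rule phi_complete_real)
    show "(LINT t|nu B d. Re (h t) * phi B d i t) = 0" if "i \<in> midx d" for i
      using integral_Re[OF int[of i]] orth[OF that] by simp
  qed (use h in simp)
  moreover have "AE t in nu B d. Im (h t) = 0"
  proof (rule phi_complete_real)
    show "(LINT t|nu B d. Im (h t) * phi B d i t) = 0" if "i \<in> midx d" for i
      using integral_Im[OF int[of i]] orth[OF that] by simp
  qed (use h in simp)
  ultimately show ?thesis by eventually_elim (simp add: complex_eq_iff)
qed

section \<open>Null space property and recovery\<close>

text \<open>
  The restricted isometry property is assumed on an intersection of two norm balls instead of a set of
  sparse vectors. This is the set that the probabilistic part controls, and no sorting of coefficients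
  into blocks is needed: a vector of moderate Euclidean and weighted \<open>1\<close>-norm qualifies, whatever its support.
\<close>
locale weighted_rip =
  fixes A :: "nat \<Rightarrow> 'i \<Rightarrow> complex" and \<Lambda> :: "'i set" and m :: nat and u :: "'i \<Rightarrow> real" and r \<delta> :: real
  assumes fin: "finite \<Lambda>" and u: "\<And>i. i \<in> \<Lambda> \<Longrightarrow> 0 \<le> u i" and r: "0 < r" and \<delta>: "0 < \<delta>" "\<delta> < 1"
    and rip: "\<And>z. (\<Sum>i\<in>\<Lambda>. (cmod (z i))\<^sup>2) \<le> 1 \<Longrightarrow> (\<Sum>i\<in>\<Lambda>. u i * cmod (z i)) \<le> 2 * r \<Longrightarrow>
       \<bar>(\<Sum>k<m. (cmod (\<Sum>i\<in>\<Lambda>. A k i * z i))\<^sup>2) - (\<Sum>i\<in>\<Lambda>. (cmod (z i))\<^sup>2)\<bar> \<le> \<delta>"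
begin

definition act :: "('i \<Rightarrow> complex) \<Rightarrow> nat \<Rightarrow> complex" where
  "act z k = (\<Sum>i\<in>\<Lambda>. A k i * z i)"

definition energy :: "('i \<Rightarrow> complex) \<Rightarrow> real" where
  "energy z = (\<Sum>k<m. (cmod (act z k))\<^sup>2)"

definition ip :: "('i \<Rightarrow> complex) \<Rightarrow> ('i \<Rightarrow> complex) \<Rightarrow> real" where
  "ip v w = (\<Sum>k<m. Re (act v k * cnj (act w k)))"

definition l1 :: "'i set \<Rightarrow> ('i \<Rightarrow> complex) \<Rightarrow> real" where
  "l1 S z = (\<Sum>i\<in>S. u i * cmod (z i))"

definition l2 :: "'i set \<Rightarrow> ('i \<Rightarrow> complex) \<Rightarrow> real" where
  "l2 S z = L2_set (\<lambda>i. cmod (z i)) S"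

lemma l2_sq: "(l2 S z)\<^sup>2 = (\<Sum>i\<in>S. (cmod (z i))\<^sup>2)"
  by (simp add: l2_def L2_set_def sum_nonneg)

lemma l2_nonneg: "0 \<le> l2 S z"
  by (simp add: l2_def L2_set_nonneg)

lemma l1_nonneg: "S \<subseteq> \<Lambda> \<Longrightarrow> 0 \<le> l1 S z"
  unfolding l1_def using u by (intro sum_nonneg) auto

lemma rip_norms: "l2 \<Lambda> z \<le> 1 \<Longrightarrow> l1 \<Lambda> z \<le> 2 * r \<Longrightarrow> \<bar>energy z - (l2 \<Lambda> z)\<^sup>2\<bar> \<le> \<delta>"
  unfolding energy_def l2_sq l1_def act_def using rip[of z] l2_sq[of \<Lambda> z] power_le_one[OF l2_nonneg, of \<Lambda> z 2] by auto

lemma act_add: "act (\<lambda>i. v i + w i) k = act v k + act w k"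
  by (simp add: act_def distrib_left sum.distrib)

lemma act_scale: "act (\<lambda>i. c * v i) k = c * act v k"
  by (simp add: act_def sum_distrib_left mult.left_commute)

lemma energy_scale: "energy (\<lambda>i. complex_of_real c * v i) = c\<^sup>2 * energy v"
  by (simp add: energy_def act_scale norm_mult power_mult_distrib sum_distrib_left)

lemma ip_scale: "ip (\<lambda>i. complex_of_real c * v i) (\<lambda>i. complex_of_real d * w i) = c * d * ip v w"
  by (simp add: ip_def act_scale sum_distrib_left algebra_simps)

lemma energy_ip: "energy v = ip v v"
  by (simp add: energy_def ip_def complex_mult_cnj cmod_def power2_eq_square)

lemma ip_add_right: "ip v (\<lambda>i. w i + w' i) = ip v w + ip v w'"
  by (simp add: ip_def act_add distrib_left sum.distrib)

lemma energy_add: "energy (\<lambda>i. v i + w i) = energy v + energy w + 2 * ip v w"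
  by (simp add: energy_ip ip_def act_add sum.distrib[symmetric] sum_distrib_left algebra_simps)

lemma ip_Cauchy_Schwarz: "ip v w \<le> sqrt (energy v) * sqrt (energy w)"
proof -
  have "ip v w \<le> (\<Sum>k<m. cmod (act v k) * cmod (act w k))"
    unfolding ip_def by (intro sum_mono) (metis complex_Re_le_cmod complex_mod_cnj norm_mult)
  also have "\<dots> \<le> L2_set (\<lambda>k. cmod (act v k)) {..<m} * L2_set (\<lambda>k. cmod (act w k)) {..<m}"
    using L2_set_mult_ineq[of "\<lambda>k. cmod (act v k)" "\<lambda>k. cmod (act w k)" "{..<m}"] by simp
  finally show ?thesis by (simp add: energy_def L2_set_def)
qed

lemma l1_scale: "l1 S (\<lambda>i. complex_of_real c * z i) = \<bar>c\<bar> * l1 S z"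
  by (simp add: l1_def norm_mult sum_distrib_left algebra_simps)

lemma l2_scale: "l2 S (\<lambda>i. complex_of_real c * z i) = \<bar>c\<bar> * l2 S z"
  by (simp add: l2_def norm_mult L2_set_right_distrib)

lemma rip_homogeneous:
  assumes "l1 \<Lambda> v \<le> 2 * r * l2 \<Lambda> v"
  shows "\<bar>energy v - (l2 \<Lambda> v)\<^sup>2\<bar> \<le> \<delta> * (l2 \<Lambda> v)\<^sup>2"
proof (cases "l2 \<Lambda> v = 0")
  case True
  then have "cmod (v i) = 0" if "i \<in> \<Lambda>" for i
    using that fin by (simp add: l2_def L2_set_eq_0_iff)
  then have "energy v = 0" by (simp add: energy_def act_def)
  with True show ?thesis by simp
next
  case False
  define a where "a = l2 \<Lambda> v"
  have a: "0 < a" using False l2_nonneg[of \<Lambda> v] by (simp add: a_def)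
  let ?v = "\<lambda>i. complex_of_real (1 / a) * v i"
  have "\<bar>energy ?v - (l2 \<Lambda> ?v)\<^sup>2\<bar> \<le> \<delta>"
    using assms a by (intro rip_norms) (simp_all only: l1_scale l2_scale a_def[symmetric], auto simp: field_simps)
  then have "\<bar>(energy v - a\<^sup>2) / a\<^sup>2\<bar> \<le> \<delta>"
    unfolding energy_scale l2_scale a_def[symmetric] using a by (simp add: field_simps)
  then show ?thesis using a by (simp add: a_def[symmetric] abs_divide pos_divide_le_eq)
qed

text \<open>
  Polarization. For normalized \<open>v\<close> and \<open>w\<close> the vectors \<open>(v \<plusminus> w) / \<surd>2\<close> have the same Euclidean norm,
  because the supports are disjoint, and their weighted \<open>1\<close>-norm is at most \<open>2 r\<close>. The difference of their
  energies is twice the inner product.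
\<close>
lemma rip_inner_disjoint:
  assumes disj: "\<And>i. i \<in> \<Lambda> \<Longrightarrow> v i = 0 \<or> w i = 0"
    and ab: "0 < a" "0 < b"
    and v: "l2 \<Lambda> v \<le> a" "l1 \<Lambda> v \<le> sqrt 2 * r * a" and w: "l2 \<Lambda> w \<le> b" "l1 \<Lambda> w \<le> sqrt 2 * r * b"
  shows "\<bar>ip v w\<bar> \<le> \<delta> * a * b"
proof -
  define S where "S = ((l2 \<Lambda> v / a)\<^sup>2 + (l2 \<Lambda> w / b)\<^sup>2) / 2"
  have va: "(l2 \<Lambda> v / a)\<^sup>2 \<le> 1" "(l2 \<Lambda> w / b)\<^sup>2 \<le> 1"
    using v w ab l2_nonneg by (auto intro!: power_le_one simp: divide_simps)
  have pm: "\<bar>((1 / a)\<^sup>2 * energy v + (1 / b)\<^sup>2 * energy w + 2 * (1 / a * (\<sigma> / b) * ip v w)) / 2 - S\<bar> \<le> \<delta>"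
    if \<sigma>: "\<sigma> = 1 \<or> \<sigma> = -1" for \<sigma> :: real
  proof -
    define z where "z = (\<lambda>i. complex_of_real (1 / a) * v i + complex_of_real (\<sigma> / b) * w i)"
    let ?z = "\<lambda>i. complex_of_real (1 / sqrt 2) * z i"
    have z2: "(l2 \<Lambda> z)\<^sup>2 = 2 * S"
    proof -
      have "(cmod (z i))\<^sup>2 = (1 / a)\<^sup>2 * (cmod (v i))\<^sup>2 + (1 / b)\<^sup>2 * (cmod (w i))\<^sup>2" if "i \<in> \<Lambda>" for i
        using disj[OF that] \<sigma> ab by (auto simp: z_def norm_mult norm_divide power_mult_distrib power_divide)
      then have "(l2 \<Lambda> z)\<^sup>2 = (1 / a)\<^sup>2 * (l2 \<Lambda> v)\<^sup>2 + (1 / b)\<^sup>2 * (l2 \<Lambda> w)\<^sup>2"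
        unfolding l2_sq by (simp add: sum.distrib sum_distrib_left)
      moreover have "2 * S = (l2 \<Lambda> v / a)\<^sup>2 + (l2 \<Lambda> w / b)\<^sup>2" by (simp add: S_def)
      ultimately show ?thesis by (simp add: power_divide)
    qed
    have l2z: "(l2 \<Lambda> ?z)\<^sup>2 = S" unfolding l2_scale using z2 by (simp add: power_mult_distrib power_divide)
    have ez: "energy ?z = ((1 / a)\<^sup>2 * energy v + (1 / b)\<^sup>2 * energy w + 2 * (1 / a * (\<sigma> / b) * ip v w)) / 2"
      unfolding energy_scale z_def energy_add ip_scale using \<sigma> by (auto simp: power_divide)
    have "l1 \<Lambda> z \<le> l1 \<Lambda> v / a + l1 \<Lambda> w / b"
    proof -
      have "u i * cmod (z i) \<le> u i * cmod (v i) / a + u i * cmod (w i) / b" if "i \<in> \<Lambda>" for i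
      proof -
        have "cmod (z i) \<le> cmod (v i) / a + cmod (w i) / b"
          unfolding z_def by (rule order.trans[OF norm_triangle_ineq]) (use \<sigma> ab in \<open>auto simp: norm_mult norm_divide\<close>)
        then have "u i * cmod (z i) \<le> u i * (cmod (v i) / a + cmod (w i) / b)" by (intro mult_left_mono u that)
        then show ?thesis by (simp add: distrib_left)
      qed
      then show ?thesis unfolding l1_def sum_divide_distrib sum.distrib[symmetric] by (intro sum_mono)
    qed
    also have "\<dots> \<le> sqrt 2 * r + sqrt 2 * r" using v w ab by (intro add_mono) (auto simp: field_simps)
    finally have "l1 \<Lambda> z \<le> 2 * r * sqrt 2" by (simp add: mult_ac)
    then have l1z: "l1 \<Lambda> ?z \<le> 2 * r" unfolding l1_scale by (simp add: field_simps)
    have "(l2 \<Lambda> ?z)\<^sup>2 \<le> 1\<^sup>2" unfolding l2z S_def using va by simp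
    then have "l2 \<Lambda> ?z \<le> 1" by (rule power2_le_imp_le) simp
    from rip_norms[OF this l1z] show ?thesis unfolding l2z ez .
  qed
  define X t where "X = (1 / a)\<^sup>2 * energy v + (1 / b)\<^sup>2 * energy w" and "t = 1 / a * (1 / b) * ip v w"
  have "\<bar>(X + 2 * t) / 2 - S\<bar> \<le> \<delta>" using pm[of 1] unfolding X_def t_def by simp
  then have p1: "X / 2 + t - S \<le> \<delta>" "S - X / 2 - t \<le> \<delta>" by (auto simp: abs_le_iff add_divide_distrib)
  have "\<bar>(X - 2 * t) / 2 - S\<bar> \<le> \<delta>" using pm[of "- 1"] unfolding X_def t_def by simp
  then have p2: "X / 2 - t - S \<le> \<delta>" "S - X / 2 + t \<le> \<delta>" by (auto simp: abs_le_iff diff_divide_distrib)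
  have "t \<le> \<delta>" "- t \<le> \<delta>" using p1 p2 by linarith+
  then have "\<bar>t\<bar> \<le> \<delta>" by (simp add: abs_le_iff)
  then have "\<bar>ip v w\<bar> / (a * b) \<le> \<delta>" using ab by (simp add: t_def abs_mult)
  then show ?thesis using ab by (simp add: pos_divide_le_eq mult.assoc)
qed

text \<open>
  Here \<open>v\<close> collects \<open>S\<close> and the set \<open>L\<close> of coefficients off \<open>S\<close> that are large relative to their weight, and
  \<open>w\<close> the rest. Testing the image of \<open>z = v + w\<close> against that of \<open>v\<close> gives the bound for \<open>v\<close>; the
  near-orthogonality of the two images contributes \<open>\<delta>\<close> times the norm bound \<open>b\<close> of \<open>w\<close>.
\<close>
theorem weighted_null_space:
  fixes z :: "'i \<Rightarrow> complex"
  assumes S: "S \<subseteq> \<Lambda>" and card: "(\<Sum>i\<in>S. (u i)\<^sup>2) \<le> r\<^sup>2"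
  defines "b \<equiv> l1 (\<Lambda> - S) z / r"
  shows "l1 S z \<le> r * (\<delta> / (1 - \<delta>) * b + sqrt (1 + \<delta>) / (1 - \<delta>) * sqrt (energy z))"
    and "l2 \<Lambda> z \<le> (1 + \<delta> / (1 - \<delta>)) * b + sqrt (1 + \<delta>) / (1 - \<delta>) * sqrt (energy z)"
proof -
  have finS: "finite S" using S fin by (rule finite_subset)
  have b0: "0 \<le> b" unfolding b_def using r l1_nonneg[of "\<Lambda> - S" z] by simp
  have br: "l1 (\<Lambda> - S) z = b * r" using r by (simp add: b_def)
  define L where "L = {i \<in> \<Lambda> - S. u i * (b / r) < cmod (z i)}"
  define V where "V = S \<union> L"
  define v where "v i = (if i \<in> V then z i else 0)" for i
  define w where "w i = (if i \<in> V then 0 else z i)" for i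
  have V: "V \<subseteq> \<Lambda>" "finite V" using S fin by (auto simp: V_def L_def intro: finite_subset)
  \<comment> \<open>if \<open>b = 0\<close>, then \<open>z\<close> vanishes off \<open>S\<close> wherever the weight is nonzero; the strict inequality in \<open>L\<close> makes this case work\<close>
  have cardL: "(\<Sum>i\<in>L. (u i)\<^sup>2) \<le> r\<^sup>2"
  proof (cases "b = 0")
    case True
    have "(\<Sum>i\<in>\<Lambda> - S. u i * cmod (z i)) = 0" using br True by (simp add: l1_def)
    then have "\<forall>i\<in>\<Lambda> - S. u i * cmod (z i) = 0"
      using sum_nonneg_eq_0_iff[of "\<Lambda> - S" "\<lambda>i. u i * cmod (z i)"] fin u by auto
    moreover have "u i * cmod (z i) \<noteq> 0" if "i \<in> L" "u i \<noteq> 0" for i using that True by (auto simp: L_def)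
    ultimately have "(\<Sum>i\<in>L. (u i)\<^sup>2) = 0" by (intro sum.neutral) (auto simp: L_def)
    then show ?thesis by simp
  next
    case False
    then have b: "0 < b" using b0 by simp
    have "(\<Sum>i\<in>L. (u i)\<^sup>2) * (b / r) = (\<Sum>i\<in>L. u i * (u i * (b / r)))"
      by (simp only: sum_distrib_right power2_eq_square mult.assoc)
    also have "\<dots> \<le> (\<Sum>i\<in>L. u i * cmod (z i))" using u by (intro sum_mono mult_left_mono) (auto simp: L_def)
    also have "\<dots> \<le> l1 (\<Lambda> - S) z" unfolding l1_def using u fin by (intro sum_mono2) (auto simp: L_def)
    finally show ?thesis using b r unfolding br by (simp add: field_simps power2_eq_square)
  qed
  have cardV: "(\<Sum>i\<in>V. (u i)\<^sup>2) \<le> 2 * r\<^sup>2"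
    unfolding V_def using finS V card cardL by (subst sum.union_disjoint) (auto simp: V_def L_def)
  have l1v: "l1 \<Lambda> v = l1 V z" and l2v: "l2 \<Lambda> v = l2 V z"
    unfolding l1_def l2_def L2_set_def v_def using V fin
    by (auto intro!: sum.mono_neutral_cong_right arg_cong[where f = sqrt])
  have CS: "l1 T z \<le> sqrt (\<Sum>i\<in>T. (u i)\<^sup>2) * l2 T z" if "T \<subseteq> \<Lambda>" for T
    using L2_set_mult_ineq[of u "\<lambda>i. cmod (z i)" T] u that
    by (auto simp: l1_def l2_def L2_set_def abs_mult subset_iff cong: sum.cong)
  have "l1 \<Lambda> v \<le> sqrt (2 * r\<^sup>2) * l2 \<Lambda> v"
    unfolding l1v l2v using CS[OF V(1)] cardV l2_nonneg[of V z]
    by (meson mult_right_mono order.trans real_sqrt_le_mono)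
  then have v1: "l1 \<Lambda> v \<le> sqrt 2 * r * l2 \<Lambda> v" using r by (simp add: real_sqrt_mult)
  have "sqrt 2 \<le> 2" by (rule real_le_lsqrt) auto
  then have "sqrt 2 * r * l2 \<Lambda> v \<le> 2 * r * l2 \<Lambda> v" using r l2_nonneg by (intro mult_right_mono) auto
  then have ripv: "\<bar>energy v - (l2 \<Lambda> v)\<^sup>2\<bar> \<le> \<delta> * (l2 \<Lambda> v)\<^sup>2" using v1 by (intro rip_homogeneous) simp
  have w1: "l1 \<Lambda> w \<le> r * b"
  proof -
    have "l1 \<Lambda> w = l1 (\<Lambda> - V) z"
      unfolding l1_def w_def using fin by (intro sum.mono_neutral_cong_right) auto
    also have "\<dots> \<le> l1 (\<Lambda> - S) z" unfolding l1_def using u fin by (intro sum_mono2) (auto simp: V_def)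
    finally show ?thesis by (simp add: br mult.commute)
  qed
  have w2: "l2 \<Lambda> w \<le> b"
  proof -
    have "(l2 \<Lambda> w)\<^sup>2 \<le> (\<Sum>i\<in>\<Lambda>. (b / r) * (u i * cmod (w i)))"
      unfolding l2_sq
    proof (rule sum_mono)
      fix i assume i: "i \<in> \<Lambda>"
      have "cmod (w i) \<le> u i * (b / r)" using i b0 r u[OF i] by (auto simp: w_def V_def L_def not_less)
      then have "cmod (w i) * cmod (w i) \<le> (u i * (b / r)) * cmod (w i)" by (intro mult_right_mono) auto
      then show "(cmod (w i))\<^sup>2 \<le> (b / r) * (u i * cmod (w i))" by (simp add: power2_eq_square mult_ac)
    qed
    also have "\<dots> = (b / r) * l1 \<Lambda> w" by (simp add: l1_def sum_distrib_left)
    also have "\<dots> \<le> (b / r) * (r * b)" using w1 b0 r by (intro mult_left_mono) auto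
    also have "\<dots> = b\<^sup>2" using r by (simp add: power2_eq_square)
    finally show ?thesis using b0 by (rule power2_le_imp_le)
  qed
  have zvw: "z = (\<lambda>i. v i + w i)" by (auto simp: v_def w_def)
  define a where "a = l2 \<Lambda> v"
  have a_bound: "a \<le> \<delta> / (1 - \<delta>) * b + sqrt (1 + \<delta>) / (1 - \<delta>) * sqrt (energy z)"
  proof (cases "a = 0")
    case True
    then show ?thesis using b0 \<delta> by (simp add: energy_def sum_nonneg)
  next
    case False
    then have a: "0 < a" using l2_nonneg[of \<Lambda> v] by (simp add: a_def)
    have ip: "\<bar>ip v w\<bar> \<le> \<delta> * a * b"
    proof (cases "b = 0")
      case True
      then have "l2 \<Lambda> w = 0" using w2 l2_nonneg[of \<Lambda> w] by simp
      then have "cmod (w i) = 0" if "i \<in> \<Lambda>" for i using that fin by (simp add: l2_def L2_set_eq_0_iff)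
      then have "ip v w = 0" by (simp add: ip_def act_def)
      then show ?thesis using True by simp
    next
      case False
      have "1 \<le> sqrt (2::real)" by simp
      then have "r * b \<le> sqrt 2 * r * b" using r b0 by (intro mult_right_mono) auto
      then show ?thesis using False b0 a v1 w1 w2
        by (intro rip_inner_disjoint) (auto simp: a_def v_def w_def)
    qed
    have "(1 - \<delta>) * a\<^sup>2 \<le> energy v" using ripv by (simp add: a_def algebra_simps abs_le_iff)
    also have "energy v = ip v z - ip v w" unfolding energy_ip by (subst zvw) (simp add: ip_add_right)
    also have "\<dots> \<le> sqrt (energy v) * sqrt (energy z) + \<delta> * a * b" using ip_Cauchy_Schwarz[of v z] ip by linarith
    also have "sqrt (energy v) \<le> sqrt ((1 + \<delta>) * a\<^sup>2)" using ripv by (simp add: a_def algebra_simps abs_le_iff)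
    then have "sqrt (energy v) * sqrt (energy z) \<le> sqrt (1 + \<delta>) * a * sqrt (energy z)"
      using a by (intro mult_right_mono) (auto simp: real_sqrt_mult energy_def sum_nonneg)
    finally have "a * ((1 - \<delta>) * a) \<le> a * (sqrt (1 + \<delta>) * sqrt (energy z) + \<delta> * b)"
      by (simp add: power2_eq_square algebra_simps)
    then have "(1 - \<delta>) * a \<le> sqrt (1 + \<delta>) * sqrt (energy z) + \<delta> * b" using a by simp
    then have "a \<le> (sqrt (1 + \<delta>) * sqrt (energy z) + \<delta> * b) / (1 - \<delta>)"
      using \<delta> by (simp add: pos_le_divide_eq mult.commute)
    then show ?thesis by (simp add: add_divide_distrib)
  qed
  have "l1 S z \<le> r * l2 S z"
  proof -
    have "sqrt (\<Sum>i\<in>S. (u i)\<^sup>2) \<le> r" using card r by (intro real_le_lsqrt) auto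
    then show ?thesis using CS[OF S] l2_nonneg[of S z] by (meson mult_right_mono order.trans)
  qed
  also have "l2 S z \<le> a" unfolding a_def l2v unfolding l2_def L2_set_def
    using V by (intro real_sqrt_le_mono sum_mono2) (auto simp: V_def)
  finally have "l1 S z \<le> r * a" using r by simp
  then show "l1 S z \<le> r * (\<delta> / (1 - \<delta>) * b + sqrt (1 + \<delta>) / (1 - \<delta>) * sqrt (energy z))"
    using a_bound r by (meson mult_left_mono less_imp_le order.trans)
  have "l2 \<Lambda> z \<le> l2 \<Lambda> v + l2 \<Lambda> w"
  proof -
    have "l2 \<Lambda> z \<le> L2_set (\<lambda>i. cmod (v i) + cmod (w i)) \<Lambda>"
      unfolding l2_def by (subst zvw) (intro L2_set_mono norm_triangle_ineq norm_ge_zero)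
    also have "\<dots> \<le> l2 \<Lambda> v + l2 \<Lambda> w" unfolding l2_def by (rule L2_set_triangle_ineq)
    finally show ?thesis .
  qed
  then show "l2 \<Lambda> z \<le> (1 + \<delta> / (1 - \<delta>)) * b + sqrt (1 + \<delta>) / (1 - \<delta>) * sqrt (energy z)"
    using a_bound w2 by (simp add: a_def distrib_right)
qed

text \<open>
  The competitor in the minimization has weighted \<open>1\<close>-norm at most that of \<open>x\<close> plus \<open>Z\<close>. As usual, minimality gives the
  cone condition \<open>b \<le> 2 X + Z + a\<close> for the parts \<open>a\<close> and \<open>b\<close> of the error on and off \<open>S\<close>, and the null
  space property bounds \<open>a\<close> by \<open>\<rho> b\<close> and the data misfit.
\<close>
theorem recovery:
  fixes x xh :: "'i \<Rightarrow> complex" and \<rho> \<tau> Z e :: real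
  defines "v \<equiv> \<lambda>i. xh i - x i"
  assumes S: "S \<subseteq> \<Lambda>" and card: "(\<Sum>i\<in>S. (u i)\<^sup>2) \<le> r\<^sup>2"
    and opt: "l1 \<Lambda> xh \<le> l1 \<Lambda> x + Z" and e: "sqrt (energy v) \<le> e"
    and \<rho>: "\<delta> / (1 - \<delta>) \<le> \<rho>" "\<rho> < 1" and \<tau>: "sqrt (1 + \<delta>) / (1 - \<delta>) \<le> \<tau>"
  shows "l1 \<Lambda> v \<le> (1 + \<rho>) / (1 - \<rho>) * (2 * l1 (\<Lambda> - S) x + Z) + 2 * \<tau> / (1 - \<rho>) * (r * e)"
    and "l2 \<Lambda> v \<le> (1 + \<rho>) / (1 - \<rho>) * (2 * l1 (\<Lambda> - S) x + Z) / r + 2 * \<tau> / (1 - \<rho>) * e"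
proof -
  define a b X where "a = l1 S v" and "b = l1 (\<Lambda> - S) v" and "X = l1 (\<Lambda> - S) x"
  have e0: "0 \<le> e" using e by (rule order.trans[rotated]) (simp add: energy_def sum_nonneg)
  have \<tau>0: "0 \<le> \<tau>" using \<tau> \<delta> by (intro order.trans[OF _ \<tau>]) auto
  have \<rho>0: "0 \<le> \<rho>" using \<rho> \<delta> by (intro order.trans[OF _ \<rho>(1)]) auto
  have b0: "0 \<le> b" unfolding b_def by (rule l1_nonneg) auto
  have split: "l1 \<Lambda> y = l1 S y + l1 (\<Lambda> - S) y" for y
    unfolding l1_def using sum.subset_diff[OF S fin] by (simp add: add.commute)
  have tri: "l1 T y \<le> l1 T y' + l1 T (\<lambda>i. y i - y' i)" if "T \<subseteq> \<Lambda>" for T and y y' :: "'i \<Rightarrow> complex"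
    unfolding l1_def sum.distrib[symmetric] distrib_left[symmetric]
    by (intro sum_mono mult_left_mono) (use u that norm_triangle_ineq[of "y' i" "y i - y' i" for i] in auto)
  have sym: "l1 T (\<lambda>i. y i - y' i) = l1 T (\<lambda>i. y' i - y i)" for T and y y' :: "'i \<Rightarrow> complex"
    by (simp add: l1_def norm_minus_commute)
  have "l1 S x \<le> l1 S xh + a" using tri[OF S, of x xh] unfolding a_def v_def sym[of S x] .
  moreover have "b \<le> l1 (\<Lambda> - S) xh + X"
    using tri[of "\<Lambda> - S" v xh] unfolding b_def X_def by (simp add: v_def l1_def)
  ultimately have bX: "b \<le> 2 * X + Z + a" using opt split[of xh] split[of x] unfolding X_def by linarith
  note nsp = weighted_null_space[OF S card, of v, folded b_def a_def]
  have "\<delta> / (1 - \<delta>) * (b / r) \<le> \<rho> * (b / r)" using \<rho> b0 r by (intro mult_right_mono) auto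
  moreover have \<tau>e: "sqrt (1 + \<delta>) / (1 - \<delta>) * sqrt (energy v) \<le> \<tau> * e"
    using \<tau> e \<tau>0 by (intro mult_mono) (auto simp: energy_def sum_nonneg)
  ultimately have 1: "a \<le> r * (\<rho> * (b / r) + \<tau> * e)"
    using nsp(1) r by (smt (verit) mult_left_mono)
  then have a1: "a \<le> \<rho> * b + \<tau> * (r * e)" using r by (simp add: distrib_left mult.left_commute)
  have "(1 - \<rho>) * b \<le> 2 * X + Z + \<tau> * (r * e)" using bX a1 by (simp add: algebra_simps)
  then have b1: "b \<le> (2 * X + Z + \<tau> * (r * e)) / (1 - \<rho>)" using \<rho> by (simp add: pos_le_divide_eq mult.commute)
  have key: "(1 + \<rho>) * b + \<tau> * (r * e) \<le> (1 + \<rho>) / (1 - \<rho>) * (2 * X + Z) + 2 * \<tau> / (1 - \<rho>) * (r * e)"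
  proof -
    have "(1 + \<rho>) * b + \<tau> * (r * e) \<le> (1 + \<rho>) * ((2 * X + Z + \<tau> * (r * e)) / (1 - \<rho>)) + \<tau> * (r * e)"
      using b1 \<rho>0 by (intro add_right_mono mult_left_mono) auto
    also have "\<dots> = (1 + \<rho>) / (1 - \<rho>) * (2 * X + Z) + 2 * \<tau> / (1 - \<rho>) * (r * e)"
      using \<rho> by (simp add: divide_simps) (simp add: algebra_simps)
    finally show ?thesis .
  qed
  have "l1 \<Lambda> v = a + b" unfolding a_def b_def by (rule split)
  also have "\<dots> \<le> (1 + \<rho>) * b + \<tau> * (r * e)" using a1 by (simp add: algebra_simps)
  finally show "l1 \<Lambda> v \<le> (1 + \<rho>) / (1 - \<rho>) * (2 * l1 (\<Lambda> - S) x + Z) + 2 * \<tau> / (1 - \<rho>) * (r * e)"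
    using key by (simp add: X_def)
  have "l2 \<Lambda> v \<le> b / r + \<rho> * (b / r) + \<tau> * e"
    using nsp(2)[unfolded distrib_right mult_1_left] \<open>\<delta> / (1 - \<delta>) * (b / r) \<le> _\<close> \<tau>e by linarith
  also have "\<dots> = (1 + \<rho>) * (b / r) + \<tau> * e" by (simp only: distrib_right mult_1_left)
  also have "\<dots> = ((1 + \<rho>) * b + \<tau> * (r * e)) / r" using r by (simp add: add_divide_distrib)
  also have "\<dots> \<le> ((1 + \<rho>) / (1 - \<rho>) * (2 * X + Z) + 2 * \<tau> / (1 - \<rho>) * (r * e)) / r"
    using key r by (intro divide_right_mono) auto
  also have "\<dots> = (1 + \<rho>) / (1 - \<rho>) * (2 * X + Z) / r + 2 * \<tau> / (1 - \<rho>) * e"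
    using r by (simp add: add_divide_distrib)
  finally show "l2 \<Lambda> v \<le> (1 + \<rho>) / (1 - \<rho>) * (2 * l1 (\<Lambda> - S) x + Z) / r + 2 * \<tau> / (1 - \<rho>) * e"
    by (simp add: X_def)
qed

end

section \<open>The design matrix is a weighted near-isometry\<close>

text \<open>
  A real vector \<open>z\<close> in the ball of radius \<open>R\<close> for the weighted \<open>1\<close>-norm is encoded by convex weights on the \<open>2 n\<close>
  functions \<open>\<plusminus> \<phi>\<^sub>i / u\<^sub>i\<close>. As essential suprema, the weights bound the \<open>\<phi>\<^sub>i\<close> almost everywhere, so these
  functions are first truncated to \<open>\<psi>\<^sub>i\<close>, and sample points at which a bound fails are excluded from
  the event \<open>E\<close>.
\<close>
lemma sample_convex_hull_bounds:
  fixes \<delta> :: real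
  assumes d: "1 \<le> d" and s: "2 \<le> s" and \<delta>: "0 < \<delta>" "\<delta> \<le> 1" and \<epsilon>: "0 < \<epsilon>" "\<epsilon> \<le> 1"
    and J: "1 \<le> J" "1 \<le> \<delta> / (4 * real s powr gam B) * (1 + \<delta>) ^ (2 * J)"
    and m: "8 * real J * real s powr gam B / \<delta> *
       (34 * ln (8 * real J * real s powr gam B) * ln (2 * real (card (HC d s))) / \<delta>\<^sup>2 + ln (2 * real J / \<epsilon>)) \<le> real m"
  shows "\<exists>E\<in>sets (sample B d m). 1 - \<epsilon> \<le> measure (sample B d m) E \<and>
    (\<forall>t\<in>E. \<forall>z :: (nat \<Rightarrow> nat) \<Rightarrow> real.
       (\<Sum>i\<in>HC d s. (z i)\<^sup>2) \<le> 1 \<longrightarrow>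
       (\<Sum>i\<in>HC d s. weight B d i * \<bar>z i\<bar>) \<le> 2 * real s powr (gam B / 2) \<longrightarrow>
       \<bar>(\<Sum>k<m. (\<Sum>i\<in>HC d s. z i * phi B d i (t k))\<^sup>2) / real m - (\<Sum>i\<in>HC d s. (z i)\<^sup>2)\<bar> \<le> 44 * \<delta>)"
proof -
  define \<Lambda> where "\<Lambda> = HC d s"
  define n where "n = card \<Lambda>"
  define u where "u = weight B d"
  define R where "R = 2 * real s powr (gam B / 2)"
  define \<theta> where "\<theta> = 1 / R\<^sup>2"
  have fin: "finite \<Lambda>" by (simp add: \<Lambda>_def finite_HC)
  have n2: "2 \<le> n" unfolding n_def \<Lambda>_def by (rule card_HC_ge_2) (rule d s)+
  have \<Lambda>m: "\<Lambda> \<subseteq> midx d" by (auto simp: \<Lambda>_def HC_def)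
  have u1: "1 \<le> u i" if "i \<in> \<Lambda>" for i using weight_ge_1[of i d B] \<Lambda>m that by (auto simp: u_def)
  have R2: "R\<^sup>2 = 4 * real s powr gam B" unfolding R_def power_mult_distrib
    using s by (simp add: powr_power)
  have "1 \<le> real s powr (gam B / 2)" using s gam_ge_1[of B] by (intro ge_one_powr_ge_zero) auto
  then have R: "2 \<le> R" by (simp add: R_def)
  then have "1 \<le> R\<^sup>2" by (intro one_le_power) auto
  then have \<theta>: "0 < \<theta>" "\<theta> \<le> 1" using R by (auto simp: \<theta>_def divide_le_eq_1)
  define \<psi> where "\<psi> i t = (if \<bar>phi B d i t\<bar> \<le> u i then phi B d i t / u i else 0)" for i t
  define A where "A = \<Lambda> \<times> {1, - 1 :: real}"
  define g where "g = (\<lambda>(i, \<sigma>) t. \<sigma> * \<psi> i t)"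
  have finA: "finite A" and cardA: "card A = 2 * n" using fin by (auto simp: A_def n_def card_cartesian_product)
  have [measurable]: "\<psi> i \<in> borel_measurable (nu B d)" for i unfolding \<psi>_def by measurable
  have "\<exists>E\<in>sets (Pi\<^sub>M {..<m} (\<lambda>_. nu B d)). 1 - \<epsilon> \<le> measure (Pi\<^sub>M {..<m} (\<lambda>_. nu B d)) E \<and>
    (\<forall>t\<in>E. \<forall>p. (\<forall>a\<in>A. 0 \<le> p a) \<longrightarrow> sum p A = 1 \<longrightarrow>
       (\<Sum>k<m. (\<Sum>a\<in>A. p a * g a (t k))\<^sup>2) / real m
          \<le> (1 + \<delta>) ^ 5 * (LINT x|nu B d. (\<Sum>a\<in>A. p a * g a x)\<^sup>2) + 13 * \<delta> * \<theta> \<and>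
       (LINT x|nu B d. (\<Sum>a\<in>A. p a * g a x)\<^sup>2)
          \<le> (1 + \<delta>) ^ 5 * ((\<Sum>k<m. (\<Sum>a\<in>A. p a * g a (t k))\<^sup>2) / real m) + 13 * \<delta> * \<theta>)"
  proof (rule conv_hull_quadratic_process[OF prob_space_nu finA cardA])
    show "g a \<in> borel_measurable (nu B d)" for a by (cases a) (simp add: g_def)
    show "\<bar>g a x\<bar> \<le> 1" if "a \<in> A" for a x
      using that u1 by (auto simp: A_def g_def \<psi>_def abs_divide divide_le_eq_1)
    show "1 \<le> \<delta> * \<theta> * (1 + \<delta>) ^ (2 * J)" using J by (simp add: \<theta>_def R2)
    show "2 * real J / (\<delta> * \<theta>) * (34 * ln (2 * real J / \<theta>) * ln (real (2 * n)) / \<delta>\<^sup>2 + ln (2 * real J / \<epsilon>)) \<le> real m"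
      using m by (simp add: \<theta>_def R2 n_def \<Lambda>_def mult_ac)
  qed (use n2 \<delta> \<epsilon> \<theta> J in auto)
  then obtain E1 where E1: "E1 \<in> sets (sample B d m)" "1 - \<epsilon> \<le> measure (sample B d m) E1"
    and hull: "\<And>t p. t \<in> E1 \<Longrightarrow> \<forall>a\<in>A. 0 \<le> p a \<Longrightarrow> sum p A = 1 \<Longrightarrow>
       (\<Sum>k<m. (\<Sum>a\<in>A. p a * g a (t k))\<^sup>2) / real m
          \<le> (1 + \<delta>) ^ 5 * (LINT x|nu B d. (\<Sum>a\<in>A. p a * g a x)\<^sup>2) + 13 * \<delta> * \<theta> \<and>
       (LINT x|nu B d. (\<Sum>a\<in>A. p a * g a x)\<^sup>2)
          \<le> (1 + \<delta>) ^ 5 * ((\<Sum>k<m. (\<Sum>a\<in>A. p a * g a (t k))\<^sup>2) / real m) + 13 * \<delta> * \<theta>"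
    unfolding sample_def by blast
  interpret P: prob_space "sample B d m" unfolding sample_def by (intro prob_space_PiM prob_space_nu)
  interpret M: prob_space "nu B d" by (rule prob_space_nu)
  define Good where "Good = {x \<in> space (nu B d). \<forall>i\<in>\<Lambda>. \<bar>phi B d i x\<bar> \<le> u i}"
  have [measurable]: "Good \<in> sets (nu B d)" unfolding Good_def using fin by measurable
  define E0 where "E0 = {t \<in> space (sample B d m). \<forall>k\<in>{..<m}. t k \<in> Good}"
  have E0s: "E0 \<in> sets (sample B d m)" unfolding E0_def sample_def by measurable
  have AE_Good: "AE x in nu B d. x \<in> Good"
  proof -
    have "AE x in nu B d. \<forall>i\<in>\<Lambda>. \<bar>phi B d i x\<bar> \<le> u i"
      unfolding u_def by (intro AE_finite_allI fin AE_phi_le_weight)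
    then show ?thesis using AE_space by eventually_elim (simp add: Good_def)
  qed
  have "AE t in sample B d m. \<forall>k\<in>{..<m}. t k \<in> Good"
    unfolding sample_def by (intro AE_finite_allI AE_PiM_component prob_space_nu AE_Good) auto
  then have "AE t in sample B d m. t \<in> E1 \<inter> E0 \<longleftrightarrow> t \<in> E1"
    using AE_space by eventually_elim (auto simp: E0_def)
  then have "measure (sample B d m) (E1 \<inter> E0) = measure (sample B d m) E1"
    using E1 E0s by (intro P.finite_measure_eq_AE) auto
  with E1(2) have "1 - \<epsilon> \<le> measure (sample B d m) (E1 \<inter> E0)" by simp
  moreover have "\<bar>(\<Sum>k<m. (\<Sum>i\<in>\<Lambda>. z i * phi B d i (t k))\<^sup>2) / real m - (\<Sum>i\<in>\<Lambda>. (z i)\<^sup>2)\<bar> \<le> 44 * \<delta>"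
    if t: "t \<in> E1 \<inter> E0" and z2: "(\<Sum>i\<in>\<Lambda>. (z i)\<^sup>2) \<le> 1" and z1: "(\<Sum>i\<in>\<Lambda>. u i * \<bar>z i\<bar>) \<le> R" for t and z :: "(nat \<Rightarrow> nat) \<Rightarrow> real"
  proof -
    define w where "w i = u i * z i / R" for i
    define W where "W = (\<Sum>i\<in>\<Lambda>. \<bar>w i\<bar>)"
    \<comment> \<open>the missing mass \<open>1 - W\<close> is spread evenly over both signs and cancels in the combination\<close>
    define p where "p = (\<lambda>(i, \<sigma>). (\<bar>w i\<bar> + \<sigma> * w i) / 2 + (1 - W) / (2 * real n))"
    have "W = (\<Sum>i\<in>\<Lambda>. u i * \<bar>z i\<bar>) / R"
      unfolding W_def w_def sum_divide_distrib using R u1 by (intro sum.cong) (force simp: abs_mult)+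
    then have W1: "W \<le> 1" using z1 R by simp
    have p0: "\<forall>a\<in>A. 0 \<le> p a"
      using W1 n2 by (auto simp: A_def p_def intro!: add_nonneg_nonneg)
    have sumA: "(\<Sum>a\<in>A. k a) = (\<Sum>i\<in>\<Lambda>. k (i, 1) + k (i, - 1))" for k :: "_ \<Rightarrow> real"
      unfolding A_def by (subst sum.cartesian_product[symmetric, where g = "\<lambda>i \<sigma>. k (i, \<sigma>)", simplified]) simp
    have "sum p A = (\<Sum>i\<in>\<Lambda>. \<bar>w i\<bar> + (1 - W) / real n)"
      unfolding sumA by (intro sum.cong) (auto simp: p_def add_divide_distrib diff_divide_distrib)
    also have "\<dots> = 1" using n2 by (simp add: sum.distrib W_def[symmetric] n_def[symmetric])
    finally have p1: "sum p A = 1" .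
    have F: "(\<Sum>a\<in>A. p a * g a x) = (\<Sum>i\<in>\<Lambda>. z i * phi B d i x) / R" if "x \<in> Good" for x
    proof -
      have "(\<Sum>a\<in>A. p a * g a x) = (\<Sum>i\<in>\<Lambda>. w i * \<psi> i x)"
        unfolding sumA by (intro sum.cong) (auto simp: p_def g_def algebra_simps add_divide_distrib diff_divide_distrib)
      also have "\<dots> = (\<Sum>i\<in>\<Lambda>. z i * phi B d i x / R)"
        using that u1 by (intro sum.cong) (force simp: \<psi>_def w_def Good_def)+
      finally show ?thesis by (simp add: sum_divide_distrib)
    qed
    have emp: "(\<Sum>k<m. (\<Sum>a\<in>A. p a * g a (t k))\<^sup>2) / real m = ((\<Sum>k<m. (\<Sum>i\<in>\<Lambda>. z i * phi B d i (t k))\<^sup>2) / real m) * \<theta>"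
    proof -
      have "(\<Sum>k<m. (\<Sum>a\<in>A. p a * g a (t k))\<^sup>2) = (\<Sum>k<m. (\<Sum>i\<in>\<Lambda>. z i * phi B d i (t k))\<^sup>2 * \<theta>)"
        using t by (intro sum.cong) (auto simp: E0_def F \<theta>_def power_divide)
      then show ?thesis by (simp add: sum_distrib_right[symmetric])
    qed
    have pop: "(LINT x|nu B d. (\<Sum>a\<in>A. p a * g a x)\<^sup>2) = (\<Sum>i\<in>\<Lambda>. (z i)\<^sup>2) * \<theta>"
    proof -
      have int: "integrable (nu B d) (\<lambda>x. phi B d i x * phi B d j x)" for i j
        by (rule M.integrable_const_bound[of _ "sup_phi B d i * sup_phi B d j"])
           (auto intro!: AE_I2 mult_mono phi_bound order.trans[OF zero_le_one sup_phi_ge_1] simp: abs_mult)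
      have "(LINT x|nu B d. (\<Sum>a\<in>A. p a * g a x)\<^sup>2) = (LINT x|nu B d. (\<Sum>i\<in>\<Lambda>. \<Sum>j\<in>\<Lambda>. \<theta> * (z i * z j) * (phi B d i x * phi B d j x)))"
      proof (rule integral_cong_AE)
        show "AE x in nu B d. (\<Sum>a\<in>A. p a * g a x)\<^sup>2 = (\<Sum>i\<in>\<Lambda>. \<Sum>j\<in>\<Lambda>. \<theta> * (z i * z j) * (phi B d i x * phi B d j x))"
          using AE_Good
        proof eventually_elim
          case (elim x)
          have "(\<Sum>a\<in>A. p a * g a x)\<^sup>2 = \<theta> * ((\<Sum>i\<in>\<Lambda>. z i * phi B d i x) * (\<Sum>j\<in>\<Lambda>. z j * phi B d j x))"
            unfolding F[OF elim] by (simp add: \<theta>_def power2_eq_square)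
          then show ?case unfolding sum_product by (simp add: sum_distrib_left mult_ac)
        qed
        show "(\<lambda>x. (\<Sum>a\<in>A. p a * g a x)\<^sup>2) \<in> borel_measurable (nu B d)"
          unfolding g_def case_prod_unfold by measurable
      qed measurable
      also have "\<dots> = (\<Sum>i\<in>\<Lambda>. \<Sum>j\<in>\<Lambda>. \<theta> * (z i * z j) * (LINT x|nu B d. phi B d i x * phi B d j x))"
        by (simp only: Bochner_Integration.integral_sum Bochner_Integration.integrable_sum
            integrable_mult_right int integral_mult_right_zero)
      also have "\<dots> = (\<Sum>i\<in>\<Lambda>. \<Sum>j\<in>\<Lambda>. if j = i then \<theta> * (z i)\<^sup>2 else 0)"
        using \<Lambda>m by (intro sum.cong refl) (auto simp: phi_orthonormal power2_eq_square subset_iff)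
      also have "\<dots> = (\<Sum>i\<in>\<Lambda>. (z i)\<^sup>2) * \<theta>" using fin by (simp add: sum_distrib_left mult.commute)
      finally show ?thesis .
    qed
    define q where "q = (\<Sum>k<m. (\<Sum>i\<in>\<Lambda>. z i * phi B d i (t k))\<^sup>2) / real m"
    define Z where "Z = (\<Sum>i\<in>\<Lambda>. (z i)\<^sup>2)"
    have q0: "0 \<le> q" by (simp add: q_def sum_nonneg)
    have Z: "0 \<le> Z" "Z \<le> 1" using z2 by (auto simp: Z_def sum_nonneg)
    have "q * \<theta> \<le> ((1 + \<delta>) ^ 5 * Z + 13 * \<delta>) * \<theta>" "Z * \<theta> \<le> ((1 + \<delta>) ^ 5 * q + 13 * \<delta>) * \<theta>"
      using hull[of t p] t p0 p1 unfolding emp pop q_def[symmetric] Z_def[symmetric] by (auto simp: algebra_simps)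
    then have 1: "q \<le> (1 + \<delta>) ^ 5 * Z + 13 * \<delta>" and 2: "Z \<le> (1 + \<delta>) ^ 5 * q + 13 * \<delta>"
      using \<theta> by auto
    \<comment> \<open>together with the additive \<open>13 \<delta>\<close> this yields \<open>44 \<delta>\<close>\<close>
    have five: "(1 + \<delta>) ^ 5 \<le> 1 + 31 * \<delta>"
    proof -
      have "\<delta> ^ 2 \<le> \<delta>" "\<delta> ^ 3 \<le> \<delta>" "\<delta> ^ 4 \<le> \<delta>" "\<delta> ^ 5 \<le> \<delta>"
        using power_decreasing[of 1 _ \<delta>] \<delta> by auto
      moreover have "(1 + \<delta>) ^ 5 = 1 + 5 * \<delta> + 10 * \<delta> ^ 2 + 10 * \<delta> ^ 3 + 5 * \<delta> ^ 4 + \<delta> ^ 5"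
        by (simp add: eval_nat_numeral algebra_simps)
      ultimately show ?thesis by linarith
    qed
    have "q \<le> Z + 44 * \<delta>"
    proof -
      have "(1 + \<delta>) ^ 5 * Z \<le> (1 + 31 * \<delta>) * Z" using five Z by (intro mult_right_mono)
      moreover have "31 * \<delta> * Z \<le> 31 * \<delta>" using \<delta> Z by (intro mult_left_le) auto
      ultimately show ?thesis using 1 by (simp add: algebra_simps)
    qed
    moreover have "Z \<le> q + 44 * \<delta>"
    proof (cases "Z \<le> q")
      case False
      have "(1 + \<delta>) ^ 5 * q \<le> (1 + 31 * \<delta>) * q" using five q0 by (intro mult_right_mono)
      moreover have "31 * \<delta> * q \<le> 31 * \<delta>" using \<delta> Z False by (intro mult_left_le) auto
      ultimately show ?thesis using 2 by (simp add: algebra_simps)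
    qed (use \<delta> in auto)
    ultimately show ?thesis unfolding q_def[symmetric] Z_def[symmetric] by (simp add: abs_le_iff)
  qed
  moreover have "E1 \<inter> E0 \<in> sets (sample B d m)" using E1 E0s by auto
  ultimately show ?thesis unfolding \<Lambda>_def u_def R_def by blast
qed

lemma design_energy:
  "(\<Sum>k<m. (cmod (\<Sum>i\<in>\<Lambda>. design B d m t k i * z i))\<^sup>2)
   = (\<Sum>k<m. (\<Sum>i\<in>\<Lambda>. Re (z i) * phi B d i (t k))\<^sup>2) / real m + (\<Sum>k<m. (\<Sum>i\<in>\<Lambda>. Im (z i) * phi B d i (t k))\<^sup>2) / real m"
proof -
  have "(cmod (\<Sum>i\<in>\<Lambda>. design B d m t k i * z i))\<^sup>2
    = (\<Sum>i\<in>\<Lambda>. Re (z i) * phi B d i (t k))\<^sup>2 / real m + (\<Sum>i\<in>\<Lambda>. Im (z i) * phi B d i (t k))\<^sup>2 / real m" for k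
  proof -
    have "Re (\<Sum>i\<in>\<Lambda>. design B d m t k i * z i) = (\<Sum>i\<in>\<Lambda>. Re (z i) * phi B d i (t k)) / sqrt (real m)"
      by (simp add: design_def sum_divide_distrib mult_ac)
    moreover have "Im (\<Sum>i\<in>\<Lambda>. design B d m t k i * z i) = (\<Sum>i\<in>\<Lambda>. Im (z i) * phi B d i (t k)) / sqrt (real m)"
      by (simp add: design_def sum_divide_distrib mult_ac)
    ultimately show ?thesis by (simp add: cmod_power2 power_divide)
  qed
  then show ?thesis by (simp add: sum.distrib sum_divide_distrib)
qed

text \<open>
  Numerical part. The level argument is run with accuracy \<open>\<delta> / 88\<close>, since it yields the error \<open>44\<close> times
  its accuracy for the real and for the imaginary part, and with \<open>\<theta> = 1 / (4 \<kappa>)\<close> for \<open>\<kappa> = s\<^sup>\<gamma>\<close>.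
  The number \<open>J\<close> is about \<open>ln (1 / (\<delta> \<theta>)) / \<delta>\<close> up to constants, and \<open>352 = 88 * 4\<close>. Every logarithm that occurs is bounded by a constant
  multiple of \<open>ln (K / \<delta>\<^sup>2)\<close>, of \<open>ln (K / \<delta>\<^sup>2 * ln (K / \<delta>\<^sup>2))\<close> or of
  \<open>ln (1 / (\<delta> \<epsilon>) * ln (K / \<delta>\<^sup>2))\<close>. As \<open>\<delta> < 1 / 5\<close>, these are at least \<open>1\<close> and absorb the
  additive constants.
\<close>
lemma sample_complexity_bound:
  fixes K \<kappa> \<delta> \<epsilon> :: real and n :: nat
  assumes K: "2 \<le> K" "1 \<le> \<kappa>" "\<kappa> \<le> K\<^sup>2" and \<delta>: "0 < \<delta>" "\<delta> < 1 / 5" and \<epsilon>: "0 < \<epsilon>" "\<epsilon> < 1" and n: "2 \<le> n"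
  defines "J \<equiv> nat \<lceil>88 * ln (352 * \<kappa> / \<delta>) / \<delta>\<rceil>"
  shows "1 \<le> J" "1 \<le> (\<delta> / 88) / (4 * \<kappa>) * (1 + \<delta> / 88) ^ (2 * J)"
    "8 * real J * \<kappa> / (\<delta> / 88) * (34 * ln (8 * real J * \<kappa>) * ln (2 * real n) / (\<delta> / 88)\<^sup>2 + ln (2 * real J / \<epsilon>))
      \<le> (682880 * 7898892) * \<kappa> * (1 / \<delta>\<^sup>2 * ln (K / \<delta>\<^sup>2) *
          max (1 / \<delta> ^ 4 * ln (K / \<delta>\<^sup>2 * ln (K / \<delta>\<^sup>2)) * ln (real n)) (1 / \<delta> * ln (1 / (\<delta> * \<epsilon>) * ln (K / \<delta>\<^sup>2))))"
proof -
  define l where "l = ln (K / \<delta>\<^sup>2)"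
  define l' where "l' = ln (K / \<delta>\<^sup>2 * l)"
  define le where "le = ln (1 / (\<delta> * \<epsilon>) * l)"
  have K0: "0 < K" using K by simp
  have l_eq: "l = ln K + 2 * ln (1 / \<delta>)"
    unfolding l_def using K0 \<delta> by (simp add: ln_div ln_realpow)
  have ln\<delta>: "0 \<le> ln (1 / \<delta>)" using \<delta> by simp
  have "exp 1 \<le> (3::real)" using exp_le by simp
  also have "3 \<le> K / \<delta>\<^sup>2"
  proof -
    have "\<delta>\<^sup>2 \<le> (1 / 5)\<^sup>2" using \<delta> by (intro power_mono) auto
    then have "3 * \<delta>\<^sup>2 \<le> K" using K by (simp add: power2_eq_square)
    then show ?thesis using \<delta> by (simp add: pos_le_divide_eq)
  qed
  finally have "ln (exp 1) \<le> l" unfolding l_def using K0 \<delta> by (subst ln_le_cancel_iff) auto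
  then have l1: "1 \<le> l" by simp
  have l'_eq: "l' = l + ln l" unfolding l'_def using K0 \<delta> l1 by (subst ln_mult) (auto simp: l_def)
  have l'1: "l \<le> l'" unfolding l'_eq using l1 by simp
  have ln2: "ln 2 \<le> (1::real)" using ln_2_less_1 by simp
  have ln\<kappa>: "ln \<kappa> \<le> 2 * ln K"
    using K by (metis K0 ln_le_cancel_iff ln_realpow of_nat_numeral zero_less_power dual_order.strict_trans1 zero_less_one)
  have two: "ln (2 ^ j) \<le> real j * x" if "1 \<le> x" for x :: real and j
    using ln2 that by (simp add: ln_realpow) (meson ln2 mult_left_mono of_nat_0_le_iff order.trans)
  have e1: "ln (352 * \<kappa> / \<delta>) \<le> 11 * l"
  proof -
    have "ln (352 * \<kappa> / \<delta>) = ln 352 + ln \<kappa> + ln (1 / \<delta>)" using K \<delta> by (simp add: ln_mult ln_div)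
    also have "ln 352 \<le> ln ((2::real) ^ 9)" by (subst ln_le_cancel_iff) auto
    also have "\<dots> \<le> real 9 * l" by (rule two) (rule l1)
    \<comment> \<open>\<open>\<kappa> \<le> K\<^sup>2\<close> gives \<open>ln \<kappa> \<le> 2 ln K\<close>\<close>
    finally show ?thesis using ln\<kappa> ln\<delta> l_eq by simp
  qed
  have pos: "0 < ln (352 * \<kappa> / \<delta>)"
  proof -
    have "\<delta> < 352 * \<kappa>" using \<delta> K by linarith
    then show ?thesis using \<delta> by simp
  qed
  then have Jpos: "0 < 88 * ln (352 * \<kappa> / \<delta>) / \<delta>" using \<delta> by simp
  then show J1: "1 \<le> J" unfolding J_def by linarith
  have J_ge: "88 * ln (352 * \<kappa> / \<delta>) / \<delta> \<le> real J" unfolding J_def by (simp add: real_nat_ceiling_ge)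
  have "real J \<le> 88 * ln (352 * \<kappa> / \<delta>) / \<delta> + 1" unfolding J_def using Jpos by (simp add: of_nat_ceiling)
  also have "\<dots> \<le> 88 * (11 * l) / \<delta> + 2 * l / \<delta>"
    using e1 \<delta> l1 by (intro add_mono divide_right_mono) (auto simp: field_simps)
  also have "\<dots> = 970 * l / \<delta>" using \<delta> by (simp add: field_simps)
  finally have J_le: "real J \<le> 970 * l / \<delta>" .
  show "1 \<le> (\<delta> / 88) / (4 * \<kappa>) * (1 + \<delta> / 88) ^ (2 * J)"
  proof -
    define x where "x = \<delta> / 88"
    have x: "0 < x" "x \<le> 1" using \<delta> by (auto simp: x_def)
    have "exp x \<le> (1 + x)\<^sup>2" using exp_le_quadratic[of x] x by (simp add: power2_eq_square algebra_simps)
    then have "exp x ^ J \<le> ((1 + x)\<^sup>2) ^ J" by (intro power_mono) auto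
    then have "exp (real J * x) \<le> (1 + x) ^ (2 * J)" by (simp add: exp_of_nat_mult power_mult)
    moreover have "ln (352 * \<kappa> / \<delta>) \<le> real J * x" using J_ge \<delta> by (simp add: x_def field_simps)
    then have "exp (ln (352 * \<kappa> / \<delta>)) \<le> exp (real J * x)" by simp
    then have "352 * \<kappa> / \<delta> \<le> exp (real J * x)" using K \<delta> by simp
    ultimately have "352 * \<kappa> / \<delta> \<le> (1 + \<delta> / 88) ^ (2 * J)" unfolding x_def by simp
    then show ?thesis using \<delta> K by (simp add: field_simps)
  qed
  have lnJk: "ln (8 * real J * \<kappa>) \<le> 15 * l'"
  proof -
    have "8 * real J * \<kappa> \<le> 7760 * l / \<delta> * \<kappa>"
      using J_le K by (intro mult_right_mono) auto
    then have "ln (8 * real J * \<kappa>) \<le> ln (7760 * l / \<delta> * \<kappa>)" using J1 K l1 \<delta> by (subst ln_le_cancel_iff) auto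
    also have "\<dots> = ln 7760 + ln l + ln (1 / \<delta>) + ln \<kappa>" using K l1 \<delta> by (simp add: ln_mult ln_div)
    also have "ln 7760 \<le> ln ((2::real) ^ 13)" by (subst ln_le_cancel_iff) auto
    also have "\<dots> \<le> real 13 * l'" using l1 l'1 by (intro two) simp
    finally have "ln (8 * real J * \<kappa>) \<le> 13 * l' + ln l + ln (1 / \<delta>) + ln \<kappa>" by simp
    then show ?thesis using ln\<kappa> ln\<delta> l_eq l'_eq ln_ge_zero[OF l1] by linarith
  qed
  have lnJe: "ln (2 * real J / \<epsilon>) \<le> 12 * le"
  proof -
    have "2 * real J / \<epsilon> \<le> 2 * (970 * l / \<delta>) / \<epsilon>" using J_le \<epsilon> by (intro divide_right_mono) auto
    then have "ln (2 * real J / \<epsilon>) \<le> ln (1940 * (1 / (\<delta> * \<epsilon>) * l))"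
      using J1 \<epsilon> \<delta> l1 by (subst ln_le_cancel_iff) auto
    also have "\<dots> = ln 1940 + le" unfolding le_def using \<epsilon> \<delta> l1 by (subst ln_mult) auto
    also have "ln 1940 \<le> ln ((2::real) ^ 11)" by (subst ln_le_cancel_iff) auto
    also have "\<dots> \<le> real 11 * le"
    proof (rule two)
      have "\<delta> * \<epsilon> \<le> 1 / 5 * 1" using \<delta> \<epsilon> by (intro mult_mono) auto
      then have "3 \<le> 1 / (\<delta> * \<epsilon>)" using \<delta> \<epsilon> by (subst pos_le_divide_eq) auto
      then have "3 * 1 \<le> 1 / (\<delta> * \<epsilon>) * l" using l1 \<delta> \<epsilon> by (intro mult_mono) auto
      with \<open>exp 1 \<le> 3\<close> have "exp 1 \<le> 1 / (\<delta> * \<epsilon>) * l" by simp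
      then have "ln (exp 1) \<le> le" unfolding le_def by (subst ln_le_cancel_iff) (auto intro: less_le_trans[OF exp_gt_zero])
      then show "1 \<le> le" by simp
    qed
    finally show ?thesis by simp
  qed
  have lnn: "0 < ln (real n)" "ln (2 * real n) \<le> 2 * ln (real n)"
    using n by (auto simp: ln_mult)
  have l0: "0 < l'" "0 \<le> le"
  proof -
    show "0 < l'" using l1 l'1 by simp
    have "1 \<le> 2 * real J" using J1 by simp
    then have "0 \<le> ln (2 * real J / \<epsilon>)" using \<epsilon> by (simp add: pos_le_divide_eq)
    then show "0 \<le> le" using lnJe by simp
  qed
  define X where "X = max (1 / \<delta> ^ 4 * l' * ln (real n)) (1 / \<delta> * le)"
  have "34 * ln (8 * real J * \<kappa>) * ln (2 * real n) / (\<delta> / 88)\<^sup>2 + ln (2 * real J / \<epsilon>)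
     \<le> 34 * (15 * l') * (2 * ln (real n)) / (\<delta> / 88)\<^sup>2 + 12 * le"
    using lnJk lnn l0 lnJe n by (intro add_mono divide_right_mono mult_mono mult_left_mono) auto
  also have "\<dots> = 7898880 * (1 / \<delta>\<^sup>2 * l' * ln (real n)) + 12 * (1 * le)"
    using \<delta> by (simp add: power_divide field_simps)
  also have "\<dots> \<le> 7898880 * X + 12 * X"
  proof (intro add_mono mult_left_mono)
    have "1 / \<delta>\<^sup>2 \<le> 1 / \<delta> ^ 4" using \<delta> by (intro divide_left_mono power_decreasing) auto
    then have "1 / \<delta>\<^sup>2 * l' * ln (real n) \<le> 1 / \<delta> ^ 4 * l' * ln (real n)" using l0 lnn by (intro mult_right_mono) auto
    then show "1 / \<delta>\<^sup>2 * l' * ln (real n) \<le> X" by (simp add: X_def)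
    have "1 * le \<le> 1 / \<delta> * le" using \<delta> l0 by (intro mult_right_mono) auto
    then show "1 * le \<le> X" by (simp add: X_def)
  qed auto
  finally have 1: "34 * ln (8 * real J * \<kappa>) * ln (2 * real n) / (\<delta> / 88)\<^sup>2 + ln (2 * real J / \<epsilon>) \<le> 7898892 * X" by simp
  have X0: "0 \<le> X" using \<delta> l0 by (simp add: X_def le_max_iff_disj)
  have "8 * real J * \<kappa> / (\<delta> / 88) * (34 * ln (8 * real J * \<kappa>) * ln (2 * real n) / (\<delta> / 88)\<^sup>2 + ln (2 * real J / \<epsilon>))
     \<le> 8 * (970 * l / \<delta>) * \<kappa> / (\<delta> / 88) * (7898892 * X)"
    using 1 J_le K \<delta> X0 l1 J1
    by (intro order.trans[OF mult_left_mono[OF 1] mult_right_mono] divide_right_mono mult_mono) auto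
  also have "\<dots> = (682880 * 7898892) * \<kappa> * (1 / \<delta>\<^sup>2 * l * X)"
    using \<delta> by (simp add: field_simps power2_eq_square)
  finally show "8 * real J * \<kappa> / (\<delta> / 88) * (34 * ln (8 * real J * \<kappa>) * ln (2 * real n) / (\<delta> / 88)\<^sup>2 + ln (2 * real J / \<epsilon>))
      \<le> (682880 * 7898892) * \<kappa> * (1 / \<delta>\<^sup>2 * ln (K / \<delta>\<^sup>2) *
          max (1 / \<delta> ^ 4 * ln (K / \<delta>\<^sup>2 * ln (K / \<delta>\<^sup>2)) * ln (real n)) (1 / \<delta> * ln (1 / (\<delta> * \<epsilon>) * ln (K / \<delta>\<^sup>2))))"
    unfolding X_def l'_def le_def l_def .
qed

text \<open>
  The design matrix is real, so its energy is the sum of those of the real and the imaginary part of the vector.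
\<close>
lemma design_rip:
  assumes d: "1 \<le> d" and s: "2 \<le> s" and \<delta>: "0 < \<delta>" "\<delta> < 1 / 5" and \<epsilon>: "0 < \<epsilon>" "\<epsilon> < 1"
    and m: "(682880 * 7898892) * real s powr gam B * Lfactor B d s (card (HC d s)) \<delta> \<epsilon> \<le> real m"
  shows "\<exists>E\<in>sets (sample B d m). 1 - \<epsilon> \<le> measure (sample B d m) E \<and>
    (\<forall>t\<in>E. weighted_rip (design B d m t) (HC d s) m (weight B d) (real s powr (gam B / 2)) \<delta>)"
proof -
  let ?\<kappa> = "real s powr gam B" and ?K = "Kfun B d s" and ?\<Lambda> = "HC d s"
  define J where "J = nat \<lceil>88 * ln (352 * ?\<kappa> / \<delta>) / \<delta>\<rceil>"
  have K: "real s \<le> ?K" by (rule Kfun_ge) (rule d)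
  have K2: "2 \<le> ?K" using K s by simp
  have \<kappa>1: "1 \<le> ?\<kappa>" using s gam_ge_1[of B] by (intro ge_one_powr_ge_zero) auto
  have "?\<kappa> \<le> real s powr 2" using s gam_le_2[of B] by (intro powr_mono) auto
  also have "\<dots> = (real s)\<^sup>2" using s by simp
  also have "\<dots> \<le> ?K\<^sup>2" using K by (intro power_mono) auto
  finally have \<kappa>K: "?\<kappa> \<le> ?K\<^sup>2" .
  note bound = sample_complexity_bound[OF K2 \<kappa>1 \<kappa>K \<delta> \<epsilon> card_HC_ge_2[OF d s], folded J_def]
  obtain E where E: "E \<in> sets (sample B d m)" "1 - \<epsilon> \<le> measure (sample B d m) E"
    and hull: "\<And>t z. t \<in> E \<Longrightarrow> (\<Sum>i\<in>?\<Lambda>. (z i)\<^sup>2) \<le> 1 \<Longrightarrow>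
       (\<Sum>i\<in>?\<Lambda>. weight B d i * \<bar>z i\<bar>) \<le> 2 * real s powr (gam B / 2) \<Longrightarrow>
       \<bar>(\<Sum>k<m. (\<Sum>i\<in>?\<Lambda>. z i * phi B d i (t k))\<^sup>2) / real m - (\<Sum>i\<in>?\<Lambda>. (z i)\<^sup>2)\<bar> \<le> 44 * (\<delta> / 88)"
  proof -
    have "8 * real J * ?\<kappa> / (\<delta> / 88) *
      (34 * ln (8 * real J * ?\<kappa>) * ln (2 * real (card ?\<Lambda>)) / (\<delta> / 88)\<^sup>2 + ln (2 * real J / \<epsilon>)) \<le> real m"
      using order.trans[OF bound(3)[unfolded Lfactor_def[unfolded Let_def, symmetric]]] m by (simp add: Lfactor_def Let_def)
    from sample_convex_hull_bounds[OF d s _ _ _ _ bound(1,2) this] \<delta> \<epsilon> that show ?thesis by auto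
  qed
  have "weighted_rip (design B d m t) ?\<Lambda> m (weight B d) (real s powr (gam B / 2)) \<delta>" if t: "t \<in> E" for t
  proof
    fix z :: "(nat \<Rightarrow> nat) \<Rightarrow> complex"
    assume z2: "(\<Sum>i\<in>?\<Lambda>. (cmod (z i))\<^sup>2) \<le> 1" and z1: "(\<Sum>i\<in>?\<Lambda>. weight B d i * cmod (z i)) \<le> 2 * real s powr (gam B / 2)"
    have split: "(\<Sum>i\<in>?\<Lambda>. (cmod (z i))\<^sup>2) = (\<Sum>i\<in>?\<Lambda>. (Re (z i))\<^sup>2) + (\<Sum>i\<in>?\<Lambda>. (Im (z i))\<^sup>2)"
      by (simp add: cmod_power2 sum.distrib)
    have "0 \<le> (\<Sum>i\<in>?\<Lambda>. (Re (z i))\<^sup>2)" "0 \<le> (\<Sum>i\<in>?\<Lambda>. (Im (z i))\<^sup>2)" by (auto intro: sum_nonneg)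
    then have 2: "(\<Sum>i\<in>?\<Lambda>. (Re (z i))\<^sup>2) \<le> 1" "(\<Sum>i\<in>?\<Lambda>. (Im (z i))\<^sup>2) \<le> 1" using z2 split by linarith+
    have 1: "(\<Sum>i\<in>?\<Lambda>. weight B d i * \<bar>Re (z i)\<bar>) \<le> 2 * real s powr (gam B / 2)"
      "(\<Sum>i\<in>?\<Lambda>. weight B d i * \<bar>Im (z i)\<bar>) \<le> 2 * real s powr (gam B / 2)"
      by (rule order.trans[OF sum_mono z1], intro mult_left_mono abs_Re_le_cmod abs_Im_le_cmod weight_nonneg)+
    show "\<bar>(\<Sum>k<m. (cmod (\<Sum>i\<in>?\<Lambda>. design B d m t k i * z i))\<^sup>2) - (\<Sum>i\<in>?\<Lambda>. (cmod (z i))\<^sup>2)\<bar> \<le> \<delta>"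
      unfolding design_energy split
      using hull[OF t 2(1) 1(1)] hull[OF t 2(2) 1(2)] by linarith
  qed (use \<delta> s in \<open>auto simp: finite_HC weight_nonneg\<close>)
  then show ?thesis using E by blast
qed

section \<open>Expansions and their residuals\<close>

lemma L2_Linf_integrable:
  assumes "f \<in> L2_Linf B d"
  shows "integrable (nu B d) f"
proof -
  interpret prob_space "nu B d" by (rule prob_space_nu)
  have "AE t in nu B d. ennreal (cmod (f t)) \<le> Linf_norm B d f" unfolding Linf_norm_def by (rule esssup_AE)
  moreover have "Linf_norm B d f < \<infinity>" using assms by (simp add: L2_Linf_def)
  ultimately have "AE t in nu B d. norm (f t) \<le> enn2real (Linf_norm B d f)"
    by (auto elim!: eventually_mono simp: enn2real_leI dest!: enn2real_mono)
  then show ?thesis using assms by (intro integrable_const_bound[of f "enn2real (Linf_norm B d f)"]) (auto simp: L2_Linf_def)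
qed

lemma integrable_mult_phi:
  assumes "integrable (nu B d) h"
  shows "integrable (nu B d) (\<lambda>t. h t * complex_of_real (phi B d i t))"
proof (rule Bochner_Integration.integrable_bound)
  show "integrable (nu B d) (\<lambda>t. h t * complex_of_real (sup_phi B d i))" using assms by simp
  show "AE t in nu B d. norm (h t * complex_of_real (phi B d i t)) \<le> norm (h t * complex_of_real (sup_phi B d i))"
    by (intro AE_I2) (auto simp: norm_mult intro!: mult_left_mono order.trans[OF phi_bound])
qed (use assms in auto)

lemma integrable_phi: "integrable (nu B d) (\<lambda>t. complex_of_real (phi B d i t))"
proof -
  interpret prob_space "nu B d" by (rule prob_space_nu)
  show ?thesis using integrable_mult_phi[of B d "\<lambda>_. 1" i] by simp
qed

lemma integrable_expansion: "integrable (nu B d) (expansion B d \<Lambda> z)"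
  unfolding expansion_def[abs_def] by (intro Bochner_Integration.integrable_sum integrable_mult_right integrable_phi)

lemma fcoeff_phi:
  assumes "i \<in> midx d" "j \<in> midx d"
  shows "fcoeff B d (\<lambda>t. c * complex_of_real (phi B d i t)) j = c * of_bool (i = j)"
proof -
  have "fcoeff B d (\<lambda>t. c * complex_of_real (phi B d i t)) j = (LINT t|nu B d. c * complex_of_real (phi B d i t * phi B d j t))"
    by (simp add: fcoeff_def mult.assoc)
  also have "\<dots> = c * complex_of_real (LINT t|nu B d. phi B d i t * phi B d j t)"
    by (simp only: integral_mult_right_zero integral_complex_of_real)
  finally show ?thesis by (simp add: phi_orthonormal assms)
qed

lemma fcoeff_expansion:
  assumes "finite \<Lambda>" "\<Lambda> \<subseteq> midx d" "j \<in> midx d"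
  shows "fcoeff B d (expansion B d \<Lambda> z) j = (if j \<in> \<Lambda> then z j else 0)"
proof -
  have "fcoeff B d (expansion B d \<Lambda> z) j = (LINT t|nu B d. (\<Sum>i\<in>\<Lambda>. (z i * complex_of_real (phi B d i t)) * complex_of_real (phi B d j t)))"
    by (simp add: fcoeff_def expansion_def sum_distrib_right)
  also have "\<dots> = (\<Sum>i\<in>\<Lambda>. fcoeff B d (\<lambda>t. z i * complex_of_real (phi B d i t)) j)"
    unfolding fcoeff_def
    by (subst Bochner_Integration.integral_sum) (auto intro!: integrable_mult_phi integrable_mult_right integrable_phi)
  also have "\<dots> = (\<Sum>i\<in>\<Lambda>. if i = j then z i else 0)"
    using assms by (intro sum.cong refl) (auto simp: fcoeff_phi subset_iff)
  finally show ?thesis using assms by simp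
qed

lemma fcoeff_diff:
  assumes "integrable (nu B d) f" "integrable (nu B d) g"
  shows "fcoeff B d (\<lambda>t. f t - g t) j = fcoeff B d f j - fcoeff B d g j"
  unfolding fcoeff_def left_diff_distrib
  by (intro Bochner_Integration.integral_diff integrable_mult_phi assms)

text \<open>
  Pythagoras: \<open>f\<close> minus its truncation is orthogonal to the span of the \<open>\<phi>\<^sub>i\<close> with \<open>i \<in> \<Lambda>\<close>.
\<close>
lemma L2_norm_residual:
  assumes f: "f \<in> L2_Linf B d" and \<Lambda>: "finite \<Lambda>" "\<Lambda> \<subseteq> midx d"
  defines "x \<equiv> fcoeff B d f"
  shows "(L2_norm B d (\<lambda>p. f p - expansion B d \<Lambda> z p))\<^sup>2
    = (L2_norm B d (\<lambda>p. f p - expansion B d \<Lambda> x p))\<^sup>2 + (\<Sum>i\<in>\<Lambda>. (cmod (z i - x i))\<^sup>2)"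
proof -
  interpret prob_space "nu B d" by (rule prob_space_nu)
  let ?h = "\<lambda>p. f p - expansion B d \<Lambda> x p"
  define w where "w i = x i - z i" for i
  have fi: "integrable (nu B d) f" by (rule L2_Linf_integrable) fact
  have hi: "integrable (nu B d) ?h" by (intro Bochner_Integration.integrable_diff fi integrable_expansion)
  have Em [measurable]: "expansion B d \<Lambda> y \<in> borel_measurable (nu B d)" for y
    using integrable_expansion by (rule borel_measurable_integrable)
  have fm [measurable]: "f \<in> borel_measurable (nu B d)" using fi by simp
  have Ebound: "cmod (expansion B d \<Lambda> y t) \<le> (\<Sum>i\<in>\<Lambda>. cmod (y i) * sup_phi B d i)" if "t \<in> space (nu B d)" for y t
    unfolding expansion_def
    by (rule sum_norm_le) (auto simp: norm_mult intro!: mult_left_mono phi_bound that)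
  have coeff: "(LINT t|nu B d. ?h t * complex_of_real (phi B d i t)) = 0" if "i \<in> \<Lambda>" for i
    using fcoeff_diff[OF fi integrable_expansion, of \<Lambda> x i] fcoeff_expansion[OF \<Lambda>, of i B x] that \<Lambda>
    by (auto simp: fcoeff_def x_def)
  have E2: "integrable (nu B d) (\<lambda>t. (cmod (expansion B d \<Lambda> y t))\<^sup>2)" for y
    by (rule integrable_const_bound[of _ "(\<Sum>i\<in>\<Lambda>. cmod (y i) * sup_phi B d i)\<^sup>2"])
       (auto intro!: AE_I2 power_mono Ebound)
  have f2: "integrable (nu B d) (\<lambda>t. (cmod (f t))\<^sup>2)" using f by (simp add: L2_Linf_def)
  have h2: "integrable (nu B d) (\<lambda>t. (cmod (?h t))\<^sup>2)"
  proof (rule Bochner_Integration.integrable_bound)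
    show "integrable (nu B d) (\<lambda>t. 2 * (cmod (f t))\<^sup>2 + 2 * (cmod (expansion B d \<Lambda> x t))\<^sup>2)"
      by (intro Bochner_Integration.integrable_add integrable_mult_right f2 E2)
    show "AE t in nu B d. norm ((cmod (?h t))\<^sup>2) \<le> norm (2 * (cmod (f t))\<^sup>2 + 2 * (cmod (expansion B d \<Lambda> x t))\<^sup>2)"
    proof (rule AE_I2)
      fix t
      have "(cmod (a - b))\<^sup>2 \<le> 2 * (cmod a)\<^sup>2 + 2 * (cmod b)\<^sup>2" for a b
      proof -
        have "(cmod (a - b))\<^sup>2 \<le> (cmod a + cmod b)\<^sup>2" by (intro power_mono norm_triangle_ineq4) auto
        also have "\<dots> \<le> 2 * (cmod a)\<^sup>2 + 2 * (cmod b)\<^sup>2"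
          using sum_squares_bound[of "cmod a" "cmod b"] by (simp add: power2_eq_square algebra_simps)
        finally show ?thesis .
      qed
      then show "norm ((cmod (?h t))\<^sup>2) \<le> norm (2 * (cmod (f t))\<^sup>2 + 2 * (cmod (expansion B d \<Lambda> x t))\<^sup>2)" by simp
    qed
  qed measurable
  have c_int: "integrable (nu B d) (\<lambda>t. g t * cnj (expansion B d \<Lambda> w t))"
    and c_sum: "(LINT t|nu B d. g t * cnj (expansion B d \<Lambda> w t)) = (\<Sum>i\<in>\<Lambda>. cnj (w i) * fcoeff B d g i)"
    if g: "integrable (nu B d) g" for g
  proof -
    have e: "g t * cnj (expansion B d \<Lambda> w t) = (\<Sum>i\<in>\<Lambda>. cnj (w i) * (g t * complex_of_real (phi B d i t)))" for t
      by (simp add: expansion_def sum_distrib_left mult_ac)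
    show "integrable (nu B d) (\<lambda>t. g t * cnj (expansion B d \<Lambda> w t))"
      unfolding e by (intro Bochner_Integration.integrable_sum integrable_mult_right integrable_mult_phi g)
    show "(LINT t|nu B d. g t * cnj (expansion B d \<Lambda> w t)) = (\<Sum>i\<in>\<Lambda>. cnj (w i) * fcoeff B d g i)"
      unfolding e fcoeff_def
      by (subst Bochner_Integration.integral_sum) (auto intro!: integrable_mult_right integrable_mult_phi g)
  qed
  have cross: "(LINT t|nu B d. Re (?h t * cnj (expansion B d \<Lambda> w t))) = 0"
    by (subst integral_Re[OF c_int[OF hi]]) (auto simp: c_sum[OF hi] fcoeff_def coeff intro!: sum.neutral)
  have EE: "(LINT t|nu B d. (cmod (expansion B d \<Lambda> w t))\<^sup>2) = (\<Sum>i\<in>\<Lambda>. (cmod (w i))\<^sup>2)"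
  proof -
    have "complex_of_real (LINT t|nu B d. (cmod (expansion B d \<Lambda> w t))\<^sup>2) = (LINT t|nu B d. expansion B d \<Lambda> w t * cnj (expansion B d \<Lambda> w t))"
      by (simp only: integral_complex_of_real[symmetric] complex_norm_square)
    also have "\<dots> = (\<Sum>i\<in>\<Lambda>. cnj (w i) * w i)"
      unfolding c_sum[OF integrable_expansion] using \<Lambda>(2)
      by (intro sum.cong refl) (auto simp: fcoeff_expansion[OF \<Lambda>] subset_iff)
    also have "\<dots> = complex_of_real (\<Sum>i\<in>\<Lambda>. (cmod (w i))\<^sup>2)"
      by (simp only: of_real_sum complex_norm_square mult.commute)
    finally show ?thesis by (simp only: of_real_eq_iff)
  qed
  have sq: "(L2_norm B d g)\<^sup>2 = (LINT t|nu B d. (cmod (g t))\<^sup>2)" for g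
    unfolding L2_norm_def by (simp add: Bochner_Integration.integral_nonneg)
  have pt: "(cmod (f t - expansion B d \<Lambda> z t))\<^sup>2
      = (cmod (?h t))\<^sup>2 + (cmod (expansion B d \<Lambda> w t))\<^sup>2 + 2 * Re (?h t * cnj (expansion B d \<Lambda> w t))" for t
  proof -
    have "f t - expansion B d \<Lambda> z t = ?h t + expansion B d \<Lambda> w t"
      by (simp add: expansion_def w_def left_diff_distrib sum_subtractf)
    then show ?thesis by (simp only: cmod_power2) (simp add: power2_eq_square algebra_simps)
  qed
  have Rei: "integrable (nu B d) (\<lambda>t. Re (?h t * cnj (expansion B d \<Lambda> w t)))"
    by (rule integrable_Re) (rule c_int[OF hi])
  have "(LINT t|nu B d. (cmod (f t - expansion B d \<Lambda> z t))\<^sup>2)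
    = (LINT t|nu B d. (cmod (?h t))\<^sup>2) + (LINT t|nu B d. (cmod (expansion B d \<Lambda> w t))\<^sup>2)"
    unfolding pt using h2 E2 Rei
    by (simp only: Bochner_Integration.integral_add Bochner_Integration.integrable_add integrable_mult_right integral_mult_right_zero cross)
  then show ?thesis unfolding sq EE by (simp add: w_def norm_minus_commute)
qed

lemma countable_midx: "countable (midx d)"
proof -
  have "midx d \<subseteq> (\<lambda>j l. if l < d then j l else 0) ` (\<Pi>\<^sub>E l\<in>{..<d}. UNIV)"
  proof
    fix i assume "i \<in> midx d"
    then have "i = (\<lambda>l. if l < d then restrict i {..<d} l else 0)" by (auto simp: midx_def fun_eq_iff)
    then show "i \<in> (\<lambda>j l. if l < d then j l else 0) ` (\<Pi>\<^sub>E l\<in>{..<d}. UNIV)" by (rule image_eqI[where x = "restrict i {..<d}"]) auto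
  qed
  then show ?thesis by (rule countable_subset) (intro countable_image countable_PiE; simp)
qed

lemma infinite_midx:
  assumes "1 \<le> d"
  shows "infinite (midx d)"
proof -
  let ?e = "\<lambda>k l. if l = 0 then k else 0 :: nat"
  have "inj ?e" by (rule injI) (drule fun_cong[of _ _ 0], simp)
  then have "infinite (range ?e)" by (rule range_inj_infinite)
  moreover have "range ?e \<subseteq> midx d" using assms by (auto simp: midx_def)
  ultimately show ?thesis by (rule infinite_super[rotated])
qed

text \<open>
  If the right-hand side is finite, then the terms with \<open>i \<notin> \<Lambda>\<close> sum to a function \<open>G\<close>, with absolute
  convergence almost everywhere, bounded by the right-hand side. Its coefficients are those of
  \<open>f\<close> minus its truncation, and completeness identifies the two.
\<close>
lemma Linf_norm_truncation_le:
  assumes f: "f \<in> L2_Linf B d" and d: "1 \<le> d" and \<Lambda>: "finite \<Lambda>" "\<Lambda> \<subseteq> midx d"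
  shows "Linf_norm B d (\<lambda>p. f p - expansion B d \<Lambda> (fcoeff B d f) p)
     \<le> (\<Sum>\<^sub>\<infinity>i\<in>midx d - \<Lambda>. ennreal (weight B d i * cmod (fcoeff B d f i)))" (is "_ \<le> ?T")
proof (cases "?T = \<infinity>")
  case False
  interpret prob_space "nu B d" by (rule prob_space_nu)
  let ?x = "fcoeff B d f" and ?M = "nu B d"
  define e where "e = from_nat_into (midx d)"
  have bij: "bij_betw e UNIV (midx d)" unfolding e_def
    by (rule bij_betw_from_nat_into) (use countable_midx infinite_midx[OF d] in auto)
  have em: "e n \<in> midx d" for n using bij by (auto simp: bij_betw_def)
  have inj: "inj e" using bij by (auto simp: bij_betw_def)
  define y where "y n = (if e n \<in> \<Lambda> then 0 else ?x (e n))" for n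
  define b where "b n = weight B d (e n) * cmod (y n)" for n
  have b0: "0 \<le> b n" for n by (simp add: b_def weight_nonneg)
  have part: "(\<Sum>n<N. b n) \<le> enn2real ?T" for N
  proof -
    have "ennreal (\<Sum>n<N. b n) = (\<Sum>n<N. ennreal (b n))" by (simp add: b0)
    also have "\<dots> = (\<Sum>i\<in>e ` {..<N}. ennreal (weight B d i * cmod (if i \<in> \<Lambda> then 0 else ?x i)))"
      using inj by (subst sum.reindex) (auto simp: b_def y_def inj_on_def)
    also have "\<dots> = (\<Sum>i\<in>e ` {..<N} - \<Lambda>. ennreal (weight B d i * cmod (?x i)))"
      by (rule sum.mono_neutral_cong_right) auto
    also have "\<dots> \<le> ?T"
      by (subst nonneg_infsum_complete) (auto intro!: SUP_upper simp: em subset_iff)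
    finally show ?thesis using False by (intro ennreal_le_iff[THEN iffD1, OF enn2real_nonneg]) (simp add: less_top)
  qed
  have bs: "summable b" by (rule summableI_nonneg_bounded[OF b0 part])
  have bT: "suminf b \<le> enn2real ?T" by (rule suminf_le_const[OF bs part])
  define q where "q n t = y n * complex_of_real (phi B d (e n) t)" for n t
  define G where "G t = (\<Sum>n. q n t)" for t
  have AEb: "AE t in ?M. \<forall>n. norm (q n t) \<le> b n"
  proof (subst AE_all_countable, intro allI)
    fix n
    show "AE t in ?M. norm (q n t) \<le> b n"
      using AE_phi_le_weight[of B d "e n"] 
      by eventually_elim (simp add: q_def b_def norm_mult mult.commute[of "weight _ _ _"] mult_left_mono)
  qed
  have qi: "integrable ?M (q n)" for n unfolding q_def[abs_def] by (intro integrable_mult_right integrable_phi)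
  have Gi: "integrable ?M G" and Gc: "fcoeff B d G j = (\<Sum>n. fcoeff B d (q n) j)" for j
  proof -
    have norm_int: "(LINT t|?M. norm (q n t)) \<le> b n" for n
    proof -
      have "(LINT t|?M. norm (q n t)) \<le> (LINT t|?M. b n)"
        using AEb by (intro integral_mono_AE) (auto intro: qi elim: eventually_mono)
      then show ?thesis by (simp add: prob_space)
    qed
    show "integrable ?M G" unfolding G_def[abs_def]
    proof (rule integrable_suminf[OF qi])
      show "AE t in ?M. summable (\<lambda>n. norm (q n t))"
        using AEb by eventually_elim (auto intro: summable_comparison_test'[OF bs])
      show "summable (\<lambda>n. LINT t|?M. norm (q n t))"
        by (rule summable_comparison_test'[OF bs, of 0]) (use norm_int in \<open>auto simp: Bochner_Integration.integral_nonneg\<close>)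
    qed
    let ?p = "\<lambda>t. complex_of_real (phi B d j t)"
    have AEj: "AE t in ?M. \<forall>n. norm (q n t * ?p t) \<le> b n * sup_phi B d j"
      using AEb AE_space by eventually_elim (auto simp: norm_mult intro!: mult_mono b0 phi_bound)
    have bs': "summable (\<lambda>n. b n * sup_phi B d j)" by (rule summable_mult2) (rule bs)
    have "fcoeff B d G j = (LINT t|?M. (\<Sum>n. q n t * ?p t))"
      unfolding fcoeff_def G_def
    proof (rule integral_cong_AE)
      show "AE t in ?M. (\<Sum>n. q n t) * ?p t = (\<Sum>n. q n t * ?p t)"
        using AEb by eventually_elim (auto intro!: suminf_mult2 summable_norm_cancel summable_comparison_test'[OF bs])
    qed (use \<open>integrable ?M G\<close> qi in \<open>auto simp: G_def[abs_def] intro!: borel_measurable_suminf\<close>)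
    also have "\<dots> = (\<Sum>n. (LINT t|?M. q n t * ?p t))"
    proof (rule integral_suminf)
      show "integrable ?M (\<lambda>t. q n t * ?p t)" for n by (rule integrable_mult_phi[OF qi])
      show "AE t in ?M. summable (\<lambda>n. norm (q n t * ?p t))"
        using AEj by eventually_elim (auto intro: summable_comparison_test'[OF bs'])
      have "(LINT t|?M. norm (q n t * ?p t)) \<le> b n * sup_phi B d j" for n
      proof -
        have "(LINT t|?M. norm (q n t * ?p t)) \<le> (LINT t|?M. b n * sup_phi B d j)"
          using AEj by (intro integral_mono_AE) (auto intro: integrable_norm integrable_mult_phi[OF qi] elim: eventually_mono)
        then show ?thesis by (simp add: prob_space)
      qed
      then show "summable (\<lambda>n. LINT t|?M. norm (q n t * ?p t))"
        by (intro summable_comparison_test'[OF bs', of 0]) (auto simp: Bochner_Integration.integral_nonneg)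
    qed
    finally show "fcoeff B d G j = (\<Sum>n. fcoeff B d (q n) j)" by (simp add: fcoeff_def)
  qed
  have Gcoeff: "fcoeff B d G j = (if j \<in> \<Lambda> then 0 else ?x j)" if j: "j \<in> midx d" for j
  proof -
    have "j \<in> range e" using bij j by (simp add: bij_betw_def)
    then obtain k where k: "e k = j" by blast
    have "fcoeff B d (q n) j = (if n = k then y n else 0)" for n
      using inj k unfolding q_def[abs_def] by (auto simp: fcoeff_phi em j inj_def)
    then have "fcoeff B d G j = y k"
      unfolding Gc by (subst suminf_finite[of "{k}"]) auto
    then show ?thesis by (simp add: y_def k)
  qed
  let ?E = "expansion B d \<Lambda> ?x"
  have fi: "integrable ?M f" by (rule L2_Linf_integrable) fact
  have hi: "integrable ?M (\<lambda>t. f t - ?E t)" by (intro Bochner_Integration.integrable_diff fi integrable_expansion)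
  have "AE t in ?M. (f t - ?E t) - G t = 0"
  proof (rule phi_complete)
    show "integrable ?M (\<lambda>t. (f t - ?E t) - G t)" by (intro Bochner_Integration.integrable_diff hi Gi)
    fix j assume j: "j \<in> midx d"
    have "fcoeff B d (\<lambda>t. (f t - ?E t) - G t) j = 0"
      using fcoeff_expansion[OF \<Lambda> j, of B ?x]
      by (simp add: fcoeff_diff[OF hi Gi] fcoeff_diff[OF fi integrable_expansion] Gcoeff j)
    then show "(LINT t|?M. (f t - ?E t - G t) * complex_of_real (phi B d j t)) = 0" by (simp add: fcoeff_def)
  qed
  then have "AE t in ?M. ennreal (cmod (f t - ?E t)) \<le> ?T"
    using AEb
  proof eventually_elim
    case (elim t)
    have sn: "summable (\<lambda>n. norm (q n t))" using elim by (auto intro: summable_comparison_test'[OF bs])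
    have "cmod (f t - ?E t) = cmod (G t)" using elim by simp
    also have "\<dots> \<le> (\<Sum>n. norm (q n t))" unfolding G_def by (rule summable_norm[OF sn])
    also have "\<dots> \<le> suminf b" using elim by (intro suminf_le sn bs) auto
    also have "\<dots> \<le> enn2real ?T" by (rule bT)
    finally have "ennreal (cmod (f t - ?E t)) \<le> ennreal (enn2real ?T)" by (rule ennreal_leI)
    also have "\<dots> = ?T" using False by (simp add: less_top)
    finally show ?case .
  qed
  then show ?thesis unfolding Linf_norm_def
    using hi by (intro esssup_I) auto
qed simp

section \<open>Error bounds for basis pursuit\<close>

text \<open>
  An affine function of an infimum in \<open>[0, \<infinity>]\<close>. Solving for \<open>F a\<close> covers the empty index set as well,
  where the infimum is \<open>\<infinity>\<close>.
\<close>
lemma ennreal_le_INF_affine: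
  fixes L k :: ennreal and F :: "'a \<Rightarrow> ennreal"
  assumes "0 < c" and le: "\<And>a. a \<in> A \<Longrightarrow> L \<le> ennreal c * F a + k"
  shows "L \<le> ennreal c * (INF a\<in>A. F a) + k"
proof (cases "k = \<infinity>")
  case False
  have c: "ennreal c \<noteq> 0" "ennreal c \<noteq> top" using assms by auto
  have "(L - k) / ennreal c \<le> (INF a\<in>A. F a)"
  proof (rule INF_greatest)
    fix a assume "a \<in> A"
    then have "L - k \<le> ennreal c * F a"
      using le[of a] False by (subst ennreal_minus_le_iff) (auto simp: add.commute)
    then show "(L - k) / ennreal c \<le> F a"
      using assms by (intro divide_le_posI_ennreal) (auto simp: mult.commute)
  qed
  then have "ennreal c * ((L - k) / ennreal c) \<le> ennreal c * (INF a\<in>A. F a)" by (rule mult_left_mono) simp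
  also have "ennreal c * ((L - k) / ennreal c) = (L - k) * ennreal c / ennreal c"
    by (simp only: ennreal_times_divide mult.commute)
  also have "\<dots> = L - k" by (rule mult_divide_eq_ennreal) (fact c)+
  finally show ?thesis using False by (subst (asm) ennreal_minus_le_iff) (auto simp: add.commute)
qed simp

lemma ennreal_le_INF_affine2:
  fixes L k :: ennreal and F :: "'a \<Rightarrow> ennreal" and G :: "'b \<Rightarrow> ennreal"
  assumes "0 < \<alpha>" "0 < \<beta>"
    and le: "\<And>a b. a \<in> A \<Longrightarrow> b \<in> B \<Longrightarrow> L \<le> ennreal \<alpha> * F a + k + ennreal \<beta> * G b"
  shows "L \<le> ennreal \<alpha> * (INF a\<in>A. F a) + k + ennreal \<beta> * (INF b\<in>B. G b)"
proof -
  have "L \<le> ennreal \<alpha> * (INF a\<in>A. F a) + (k + ennreal \<beta> * G b)" if "b \<in> B" for b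
    using le[OF _ that] by (intro ennreal_le_INF_affine assms) (simp add: add.assoc)
  then have "L \<le> ennreal \<beta> * (INF b\<in>B. G b) + (ennreal \<alpha> * (INF a\<in>A. F a) + k)"
    by (intro ennreal_le_INF_affine assms) (simp add: add_ac)
  then show ?thesis by (simp add: add_ac)
qed

lemma l1u_vecs:
  assumes "z \<in> vecs \<Lambda>" "finite \<Lambda>" "\<Lambda> \<subseteq> midx d"
  shows "l1u B d z = ennreal (\<Sum>i\<in>\<Lambda>. weight B d i * cmod (z i))"
proof -
  have "l1u B d z = (\<Sum>\<^sub>\<infinity>i\<in>\<Lambda>. ennreal (weight B d i * cmod (z i)))"
    unfolding l1u_def using assms by (intro infsum_cong_neutral) (auto simp: vecs_def)
  then show ?thesis using assms(2) by (simp add: sum_ennreal weight_nonneg)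
qed

text \<open>
  A vector supported in \<open>S\<close> leaves an error of at least the part of \<open>x\<close> off \<open>S\<close>, which is split here at \<open>\<Lambda>\<close>: the
  part within \<open>\<Lambda>\<close> enters through recovery, the part outside through truncation.
\<close>
lemma l1u_approximation_ge:
  assumes \<Lambda>: "finite \<Lambda>" "\<Lambda> \<subseteq> midx d" and S: "supp z' \<subseteq> \<Lambda>"
  shows "ennreal (\<Sum>i\<in>\<Lambda> - supp z'. weight B d i * cmod (x i))
      + (\<Sum>\<^sub>\<infinity>i\<in>midx d - \<Lambda>. ennreal (weight B d i * cmod (x i))) \<le> l1u B d (\<lambda>i. x i - z' i)"
proof -
  let ?h = "\<lambda>i. ennreal (weight B d i * cmod (x i - z' i))"
  have summ: "k summable_on T" for k :: "(nat \<Rightarrow> nat) \<Rightarrow> ennreal" and T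
    by (rule nonneg_summable_on_complete) simp
  have "l1u B d (\<lambda>i. x i - z' i) = infsum ?h (\<Lambda> \<union> (midx d - \<Lambda>))"
    unfolding l1u_def using \<Lambda> by (intro arg_cong[where f = "infsum _"]) auto
  also have "\<dots> = infsum ?h \<Lambda> + infsum ?h (midx d - \<Lambda>)" by (intro infsum_Un_disjoint summ) auto
  also have "infsum ?h (midx d - \<Lambda>) = (\<Sum>\<^sub>\<infinity>i\<in>midx d - \<Lambda>. ennreal (weight B d i * cmod (x i)))"
  proof (intro infsum_cong)
    fix i assume "i \<in> midx d - \<Lambda>"
    then have "z' i = 0" using S by (auto simp: supp_def)
    then show "?h i = ennreal (weight B d i * cmod (x i))" by simp
  qed
  also have "infsum ?h \<Lambda> = ennreal (\<Sum>i\<in>\<Lambda>. weight B d i * cmod (x i - z' i))"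
    using \<Lambda> by (simp add: sum_ennreal weight_nonneg)
  finally have eq: "l1u B d (\<lambda>i. x i - z' i) = ennreal (\<Sum>i\<in>\<Lambda>. weight B d i * cmod (x i - z' i))
     + (\<Sum>\<^sub>\<infinity>i\<in>midx d - \<Lambda>. ennreal (weight B d i * cmod (x i)))" .
  have "(\<Sum>i\<in>\<Lambda> - supp z'. weight B d i * cmod (x i)) = (\<Sum>i\<in>\<Lambda> - supp z'. weight B d i * cmod (x i - z' i))"
    by (intro sum.cong) (auto simp: supp_def)
  also have "\<dots> \<le> (\<Sum>i\<in>\<Lambda>. weight B d i * cmod (x i - z' i))"
    using \<Lambda> by (intro sum_mono2) (auto simp: weight_nonneg)
  finally show ?thesis unfolding eq by (intro add_right_mono ennreal_leI)
qed

lemma norm2_add_le: "norm2 m (\<lambda>k. v k + w k) \<le> norm2 m v + norm2 m w"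
proof -
  have "norm2 m (\<lambda>k. v k + w k) \<le> L2_set (\<lambda>k. cmod (v k) + cmod (w k)) {..<m}"
    unfolding norm2_def by (intro L2_set_mono norm_triangle_ineq) auto
  also have "\<dots> \<le> norm2 m v + norm2 m w" unfolding norm2_def by (rule L2_set_triangle_ineq)
  finally show ?thesis .
qed

lemma mat_vec_add: "mat_vec A \<Lambda> (\<lambda>i. v i + w i) k = mat_vec A \<Lambda> v k + mat_vec A \<Lambda> w k"
  by (simp add: mat_vec_def distrib_left sum.distrib)

lemma mat_vec_diff: "mat_vec A \<Lambda> (\<lambda>i. v i - w i) k = mat_vec A \<Lambda> v k - mat_vec A \<Lambda> w k"
  by (simp add: mat_vec_def right_diff_distrib sum_subtractf)

text \<open>
  Adding the truncated coefficients of \<open>f\<close> to a vector that is feasible for the data \<open>e\<close> gives one that is feasible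
  for \<open>y\<close>. It serves as the competitor of the minimizer, and the infimum over such vectors is the term \<open>\<T>\<close>.
\<close>
lemma recovery_coefficients:
  assumes rip: "weighted_rip (design B d m t) \<Lambda> m (weight B d) r \<delta>" and \<rho>: "rho \<delta> < 1"
    and \<Lambda>: "\<Lambda> \<subseteq> midx d" and \<eta>: "0 \<le> \<eta>"
    and y: "\<And>k. k < m \<Longrightarrow> y k = mat_vec (design B d m t) \<Lambda> (restrict_vec \<Lambda> x) k + e k"
    and min: "is_arg_min (l1u B d) (\<lambda>z. z \<in> feasible (design B d m t) \<Lambda> m y \<eta>) xhat"
    and S: "S \<subseteq> \<Lambda>" "wcard B d S \<le> r\<^sup>2" and z: "z \<in> feasible (design B d m t) \<Lambda> m e \<eta>"
  defines "X \<equiv> \<Sum>i\<in>\<Lambda> - S. weight B d i * cmod (x i)" and "Z \<equiv> \<Sum>i\<in>\<Lambda>. weight B d i * cmod (z i)"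
  shows "(\<Sum>i\<in>\<Lambda>. weight B d i * cmod (xhat i - x i)) \<le> C3 \<delta> * (2 * X + Z) + C2 \<delta> * (r * (\<eta> + norm2 m e))"
    and "sqrt (\<Sum>i\<in>\<Lambda>. (cmod (xhat i - x i))\<^sup>2) \<le> C3 \<delta> * (2 * X + Z) / r + C2 \<delta> * (\<eta> + norm2 m e)"
proof -
  let ?A = "design B d m t"
  interpret weighted_rip ?A \<Lambda> m "weight B d" r \<delta> by (rule rip)
  let ?x = "restrict_vec \<Lambda> x" and ?v = "\<lambda>i. xhat i - restrict_vec \<Lambda> x i"
  have xr: "?x i = x i" if "i \<in> \<Lambda>" for i using that by (simp add: restrict_vec_def)
  have xh: "xhat \<in> feasible ?A \<Lambda> m y \<eta>" using min by (simp add: is_arg_min_def)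
  have act: "act w k = mat_vec ?A \<Lambda> w k" for w k by (simp add: act_def mat_vec_def)
  have xz: "(\<lambda>i. ?x i + z i) \<in> feasible ?A \<Lambda> m y \<eta>"
  proof -
    have "norm2 m (\<lambda>k. mat_vec ?A \<Lambda> (\<lambda>i. ?x i + z i) k - y k) = norm2 m (\<lambda>k. mat_vec ?A \<Lambda> z k - e k)"
      unfolding norm2_def by (intro L2_set_cong) (auto simp: mat_vec_add y)
    then show ?thesis using z by (auto simp: feasible_def vecs_def restrict_vec_def)
  qed
  then have "l1u B d xhat \<le> l1u B d (\<lambda>i. ?x i + z i)" using min by (auto simp: is_arg_min_def not_less)
  then have "l1 \<Lambda> xhat \<le> l1 \<Lambda> (\<lambda>i. ?x i + z i)"
    using xh xz by (simp add: feasible_def l1u_vecs[OF _ fin \<Lambda>] l1_def sum_nonneg weight_nonneg)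
  also have "\<dots> \<le> l1 \<Lambda> ?x + Z"
    unfolding l1_def Z_def sum.distrib[symmetric] distrib_left[symmetric]
    by (intro sum_mono mult_left_mono norm_triangle_ineq weight_nonneg)
  finally have opt: "l1 \<Lambda> xhat \<le> l1 \<Lambda> ?x + Z" .
  have "sqrt (energy ?v) = norm2 m (\<lambda>k. (mat_vec ?A \<Lambda> xhat k - y k) + e k)"
    unfolding energy_def norm2_def L2_set_def by (intro arg_cong[where f = sqrt] sum.cong) (auto simp: act mat_vec_diff y)
  also have "\<dots> \<le> norm2 m (\<lambda>k. mat_vec ?A \<Lambda> xhat k - y k) + norm2 m e" by (rule norm2_add_le)
  also have "\<dots> \<le> \<eta> + norm2 m e" using xh by (simp add: feasible_def)
  finally have e: "sqrt (energy ?v) \<le> \<eta> + norm2 m e" .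
  have \<rho>': "\<delta> / (1 - \<delta>) \<le> rho \<delta>" using \<delta> by (simp add: rho_def divide_right_mono)
  have card: "(\<Sum>i\<in>S. (weight B d i)\<^sup>2) \<le> r\<^sup>2" using S(2) by (simp add: wcard_def)
  note rec = recovery[OF S(1) card opt e \<rho>' \<rho>, of "tau \<delta>"]
  have l1x: "l1 (\<Lambda> - S) ?x = X" unfolding l1_def X_def by (intro sum.cong) (auto simp: xr)
  have l1v: "l1 \<Lambda> ?v = (\<Sum>i\<in>\<Lambda>. weight B d i * cmod (xhat i - x i))"
    unfolding l1_def by (intro sum.cong) (auto simp: xr)
  have l2v: "l2 \<Lambda> ?v = sqrt (\<Sum>i\<in>\<Lambda>. (cmod (xhat i - x i))\<^sup>2)"
    unfolding l2_def L2_set_def by (intro arg_cong[where f = sqrt] sum.cong) (auto simp: xr)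
  show "(\<Sum>i\<in>\<Lambda>. weight B d i * cmod (xhat i - x i)) \<le> C3 \<delta> * (2 * X + Z) + C2 \<delta> * (r * (\<eta> + norm2 m e))"
    using rec(1) by (simp add: l1x l1v C3_def C2_def tau_def)
  show "sqrt (\<Sum>i\<in>\<Lambda>. (cmod (xhat i - x i))\<^sup>2) \<le> C3 \<delta> * (2 * X + Z) / r + C2 \<delta> * (\<eta> + norm2 m e)"
    using rec(2) by (simp add: l1x l2v C3_def C2_def tau_def)
qed

text \<open>
  Recovery gives the coefficients \<open>2 C3\<close>, \<open>C2\<close> and \<open>C3\<close> for approximation error, noise and \<open>\<T>\<close> in both
  norms, up to the scaling by \<open>r\<close>; the uniform norm needs the additional coefficient \<open>1\<close> for the truncation error.
\<close>
lemma constants_compare: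
  assumes "0 < \<delta>" "\<delta> < 1" "rho \<delta> < 1"
  shows "0 < C1 \<delta>" "1 \<le> C1 \<delta>" "2 * C3 \<delta> \<le> C1 \<delta>" "0 \<le> C2 \<delta>" "0 < C3 \<delta>"
    "2 * C3 \<delta> \<le> C4 \<delta>" "0 < C4 \<delta>" "C2 \<delta> \<le> C5 \<delta>" "C3 \<delta> \<le> C6 \<delta>" "0 < C6 \<delta>"
proof -
  have \<rho>: "0 < rho \<delta>" "0 < 1 - rho \<delta>" using assms by (auto simp: rho_def)
  have \<tau>: "0 < tau \<delta>" using assms by (simp add: tau_def)
  show "0 < C1 \<delta>" "0 \<le> C2 \<delta>" "0 < C3 \<delta>" "0 < C4 \<delta>" "0 < C6 \<delta>"
    using \<rho> \<tau> by (auto simp: C1_def C2_def C3_def C4_def C6_def)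
  show "1 \<le> C1 \<delta>" using \<rho> by (simp add: C1_def pos_le_divide_eq)
  show "2 * C3 \<delta> \<le> C1 \<delta>" unfolding C1_def C3_def times_divide_eq_right using \<rho> by (intro divide_right_mono) auto
  have *: "(1 + rho \<delta>) * 1 \<le> (1 + rho \<delta>) * (2 + rho \<delta>)" using \<rho> by (intro mult_left_mono) auto
  show 1: "2 * C3 \<delta> \<le> C4 \<delta>" unfolding C3_def C4_def times_divide_eq_right
    using \<rho> * by (intro divide_right_mono) auto
  show "C3 \<delta> \<le> C6 \<delta>" using 1 \<open>0 < C3 \<delta>\<close> by (simp add: C6_def)
  have "tau \<delta> * 2 \<le> tau \<delta> * (9 + 3 * rho \<delta>)" using \<rho> \<tau> by (intro mult_left_mono) auto
  then show "C2 \<delta> \<le> C5 \<delta>" unfolding C2_def C5_def using \<rho> by (intro divide_right_mono) auto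
qed

lemma Linf_norm_error_le:
  assumes f: "f \<in> L2_Linf B d" and d: "1 \<le> d" and \<Lambda>: "finite \<Lambda>" "\<Lambda> \<subseteq> midx d"
  shows "Linf_norm B d (\<lambda>p. f p - expansion B d \<Lambda> z p)
     \<le> (\<Sum>\<^sub>\<infinity>i\<in>midx d - \<Lambda>. ennreal (weight B d i * cmod (fcoeff B d f i)))
       + ennreal (\<Sum>i\<in>\<Lambda>. weight B d i * cmod (z i - fcoeff B d f i))" (is "_ \<le> ?T + ennreal ?N")
proof -
  let ?x = "fcoeff B d f"
  let ?h = "\<lambda>p. f p - expansion B d \<Lambda> ?x p"
  have m: "(\<lambda>p. f p - expansion B d \<Lambda> z p) \<in> borel_measurable (nu B d)"
    using L2_Linf_integrable[OF f] integrable_expansion[of B d \<Lambda> z] by auto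
  have AEh: "AE t in nu B d. ennreal (cmod (?h t)) \<le> ?T"
  proof -
    have "AE t in nu B d. ennreal (cmod (?h t)) \<le> Linf_norm B d ?h" unfolding Linf_norm_def by (rule esssup_AE)
    then show ?thesis by eventually_elim (rule order.trans[OF _ Linf_norm_truncation_le[OF f d \<Lambda>]])
  qed
  have AEw: "AE t in nu B d. \<forall>i\<in>\<Lambda>. \<bar>phi B d i t\<bar> \<le> weight B d i"
    by (intro AE_finite_allI \<Lambda> AE_phi_le_weight)
  show ?thesis unfolding Linf_norm_def
  proof (rule esssup_I)
    show "AE t in nu B d. ennreal (cmod (f t - expansion B d \<Lambda> z t)) \<le> ?T + ennreal ?N"
      using AEh AEw
    proof eventually_elim
      case (elim t)
      have "cmod (expansion B d \<Lambda> ?x t - expansion B d \<Lambda> z t) \<le> ?N"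
      proof -
        have "expansion B d \<Lambda> ?x t - expansion B d \<Lambda> z t = (\<Sum>i\<in>\<Lambda>. (?x i - z i) * complex_of_real (phi B d i t))"
          by (simp add: expansion_def left_diff_distrib sum_subtractf)
        also have "cmod \<dots> \<le> ?N"
          by (rule sum_norm_le) (use elim in \<open>auto simp: norm_mult norm_minus_commute mult.commute[of "weight _ _ _"] intro!: mult_left_mono\<close>)
        finally show ?thesis .
      qed
      moreover have "cmod (f t - expansion B d \<Lambda> z t) \<le> cmod (?h t) + cmod (expansion B d \<Lambda> ?x t - expansion B d \<Lambda> z t)"
        using norm_triangle_ineq[of "?h t" "expansion B d \<Lambda> ?x t - expansion B d \<Lambda> z t"] by simp
      ultimately have "cmod (f t - expansion B d \<Lambda> z t) \<le> cmod (?h t) + ?N" by linarith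
      then have "ennreal (cmod (f t - expansion B d \<Lambda> z t)) \<le> ennreal (cmod (?h t) + ?N)" by (rule ennreal_leI)
      also have "\<dots> = ennreal (cmod (?h t)) + ennreal ?N" by (intro ennreal_plus sum_nonneg) (auto simp: weight_nonneg)
      finally show ?case using elim(1) by (meson add_right_mono order.trans)
    qed
  qed (use m in measurable)
qed

lemma L2_norm_error_le:
  assumes f: "f \<in> L2_Linf B d" and \<Lambda>: "finite \<Lambda>" "\<Lambda> \<subseteq> midx d"
  shows "L2_norm B d (\<lambda>p. f p - expansion B d \<Lambda> z p)
    \<le> L2_norm B d (\<lambda>p. f p - expansion B d \<Lambda> (fcoeff B d f) p) + sqrt (\<Sum>i\<in>\<Lambda>. (cmod (z i - fcoeff B d f i))\<^sup>2)"
proof (rule power2_le_imp_le)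
  let ?D = "L2_norm B d (\<lambda>p. f p - expansion B d \<Lambda> (fcoeff B d f) p)" and ?N = "\<Sum>i\<in>\<Lambda>. (cmod (z i - fcoeff B d f i))\<^sup>2"
  have D: "0 \<le> ?D" by (simp add: L2_norm_def)
  have N: "0 \<le> ?N" by (simp add: sum_nonneg)
  have "0 \<le> 2 * ?D * sqrt ?N" using D N by simp
  then show "(L2_norm B d (\<lambda>p. f p - expansion B d \<Lambda> z p))\<^sup>2 \<le> (?D + sqrt ?N)\<^sup>2"
    by (subst L2_norm_residual[OF f \<Lambda>]) (use N in \<open>simp add: power2_sum\<close>)
  show "0 \<le> ?D + sqrt ?N" using D N by simp
qed

text \<open>
  The bounds hold for every competitor of each of the two infima \<open>\<sigma>\<close> and \<open>\<T>\<close> separately, and both enter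
  with positive factors.
\<close>
lemma error_bounds:
  assumes rip: "weighted_rip (design B d m t) (HC d s) m (weight B d) (real s powr (gam B / 2)) \<delta>" and \<rho>: "rho \<delta> < 1"
    and d: "1 \<le> d" and \<eta>: "0 \<le> \<eta>" and f: "f \<in> L2_Linf B d"
  defines "\<Lambda> \<equiv> HC d s" and "A \<equiv> design B d m t" and "x \<equiv> fcoeff B d f" and "r \<equiv> real s powr (gam B / 2)"
  assumes y: "\<And>k. k < m \<Longrightarrow> y k = mat_vec A \<Lambda> (restrict_vec \<Lambda> x) k + e k"
    and min: "is_arg_min (l1u B d) (\<lambda>z. z \<in> feasible A \<Lambda> m y \<eta>) xhat"
  shows "Linf_norm B d (\<lambda>p. f p - expansion B d \<Lambda> xhat p)
      \<le> ennreal (C1 \<delta>) * sigma_lower B d s x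
        + ennreal r * (ennreal (C2 \<delta> * (\<eta> + norm2 m e)) + ennreal (C3 \<delta>) * Tmin B d s A \<Lambda> m e \<eta>)"
    and "ennreal (L2_norm B d (\<lambda>p. f p - expansion B d \<Lambda> xhat p))
      \<le> ennreal (C4 \<delta>) * (sigma_lower B d s x / ennreal r)
        + ennreal (C5 \<delta> * (\<eta> + norm2 m e)) + ennreal (C6 \<delta>) * Tmin B d s A \<Lambda> m e \<eta>
        + ennreal (L2_norm B d (\<lambda>p. f p - expansion B d \<Lambda> x p))"
proof -
  have fin: "finite \<Lambda>" unfolding \<Lambda>_def by (rule finite_HC)
  have \<Lambda>m: "\<Lambda> \<subseteq> midx d" by (auto simp: \<Lambda>_def HC_def)
  have r: "0 < r" and \<delta>: "0 < \<delta>" "\<delta> < 1" using rip unfolding weighted_rip_def r_def by auto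
  have r2: "r\<^sup>2 = real s powr gam B" using r unfolding r_def by (simp add: powr_power)
  note C = constants_compare[OF \<delta> \<rho>]
  define Ee where "Ee = \<eta> + norm2 m e"
  have Ee: "0 \<le> Ee" using \<eta> by (simp add: Ee_def norm2_def L2_set_nonneg)
  let ?A = "{z'. finite (supp z') \<and> card (supp z') \<le> s \<and> lower d (supp z')}" and ?B = "feasible A \<Lambda> m e \<eta>"
  let ?F = "\<lambda>z'. l1u B d (\<lambda>i. x i - z' i)" and ?G = "\<lambda>z. l1u B d z / ennreal r"
  let ?T = "\<Sum>\<^sub>\<infinity>i\<in>midx d - \<Lambda>. ennreal (weight B d i * cmod (x i))"
  define X where "X z' = (\<Sum>i\<in>\<Lambda> - supp z'. weight B d i * cmod (x i))" for z' :: "(nat \<Rightarrow> nat) \<Rightarrow> complex"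
  define Z where "Z z = (\<Sum>i\<in>\<Lambda>. weight B d i * cmod (z i))" for z
  have X0: "0 \<le> X z'" for z' by (simp add: X_def sum_nonneg weight_nonneg)
  have Z0: "0 \<le> Z z" for z by (simp add: Z_def sum_nonneg weight_nonneg)
  have F: "ennreal (X z') + ?T \<le> ?F z'" and coeffs:
      "(\<Sum>i\<in>\<Lambda>. weight B d i * cmod (xhat i - x i)) \<le> C3 \<delta> * (2 * X z' + Z z) + C2 \<delta> * (r * Ee)"
      "sqrt (\<Sum>i\<in>\<Lambda>. (cmod (xhat i - x i))\<^sup>2) \<le> C3 \<delta> * (2 * X z' + Z z) / r + C2 \<delta> * Ee"
    if z': "z' \<in> ?A" and z: "z \<in> ?B" for z' z
  proof -
    have S: "supp z' \<subseteq> \<Lambda>" unfolding \<Lambda>_def using z' by (intro lower_subset_HC) auto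
    show "ennreal (X z') + ?T \<le> ?F z'" unfolding X_def by (rule l1u_approximation_ge[OF fin \<Lambda>m S])
    have W: "wcard B d (supp z') \<le> r\<^sup>2" unfolding r2 using z' by (intro wcard_lower_le) auto
    note rec = recovery_coefficients[OF rip[folded r_def \<Lambda>_def] \<rho> \<Lambda>m \<eta> y[unfolded A_def] min[unfolded A_def] S W z[unfolded A_def]]
    show "(\<Sum>i\<in>\<Lambda>. weight B d i * cmod (xhat i - x i)) \<le> C3 \<delta> * (2 * X z' + Z z) + C2 \<delta> * (r * Ee)"
      unfolding X_def Z_def Ee_def by (rule rec(1))
    show "sqrt (\<Sum>i\<in>\<Lambda>. (cmod (xhat i - x i))\<^sup>2) \<le> C3 \<delta> * (2 * X z' + Z z) / r + C2 \<delta> * Ee"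
      unfolding X_def Z_def Ee_def by (rule rec(2))
  qed
  have G: "?G z = ennreal (Z z / r)" if "z \<in> ?B" for z
    using that r unfolding Z_def
    by (simp add: feasible_def l1u_vecs[OF _ fin \<Lambda>m] divide_ennreal sum_nonneg weight_nonneg)
  have "Linf_norm B d (\<lambda>p. f p - expansion B d \<Lambda> xhat p)
     \<le> ennreal (C1 \<delta>) * (INF z'\<in>?A. ?F z') + ennreal (r * (C2 \<delta> * Ee)) + ennreal (r * C3 \<delta>) * (INF z\<in>?B. ?G z)"
  proof (rule ennreal_le_INF_affine2)
    fix z' z assume z': "z' \<in> ?A" and z: "z \<in> ?B"
    have "Linf_norm B d (\<lambda>p. f p - expansion B d \<Lambda> xhat p)
       \<le> ?T + ennreal (C1 \<delta> * X z' + r * (C2 \<delta> * Ee) + C3 \<delta> * Z z)"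
    proof (rule order.trans[OF Linf_norm_error_le[OF f d fin \<Lambda>m, folded x_def]], intro add_left_mono ennreal_leI)
      have "2 * C3 \<delta> * X z' \<le> C1 \<delta> * X z'" using C X0 by (intro mult_right_mono)
      then show "(\<Sum>i\<in>\<Lambda>. weight B d i * cmod (xhat i - x i)) \<le> C1 \<delta> * X z' + r * (C2 \<delta> * Ee) + C3 \<delta> * Z z"
        using coeffs(1)[OF z' z] by (simp add: algebra_simps)
    qed
    also have "ennreal (C1 \<delta> * X z' + r * (C2 \<delta> * Ee) + C3 \<delta> * Z z)
       = ennreal (C1 \<delta>) * ennreal (X z') + ennreal (r * (C2 \<delta> * Ee)) + ennreal (r * C3 \<delta>) * ?G z"
      unfolding G[OF z] using C X0 Z0 r Ee by (simp add: ennreal_mult[symmetric] ennreal_plus[symmetric] del: ennreal_plus)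
    also have "?T + \<dots> \<le> ennreal (C1 \<delta>) * (ennreal (X z') + ?T) + ennreal (r * (C2 \<delta> * Ee)) + ennreal (r * C3 \<delta>) * ?G z"
    proof -
      have "1 * ?T \<le> ennreal (C1 \<delta>) * ?T" using C by (intro mult_right_mono) auto
      then have "ennreal (C1 \<delta>) * ennreal (X z') + ?T \<le> ennreal (C1 \<delta>) * (ennreal (X z') + ?T)"
        by (simp add: distrib_left)
      from add_right_mono[OF add_right_mono[OF this, of "ennreal (r * (C2 \<delta> * Ee))"], of "ennreal (r * C3 \<delta>) * ?G z"]
      show ?thesis by (simp only: add_ac)
    qed
    also have "\<dots> \<le> ennreal (C1 \<delta>) * ?F z' + ennreal (r * (C2 \<delta> * Ee)) + ennreal (r * C3 \<delta>) * ?G z"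
      by (intro add_right_mono mult_left_mono F[OF z' z]) simp
    finally show "Linf_norm B d (\<lambda>p. f p - expansion B d \<Lambda> xhat p)
      \<le> ennreal (C1 \<delta>) * ?F z' + ennreal (r * (C2 \<delta> * Ee)) + ennreal (r * C3 \<delta>) * ?G z" .
  qed (use C r in auto)
  then show "Linf_norm B d (\<lambda>p. f p - expansion B d \<Lambda> xhat p)
      \<le> ennreal (C1 \<delta>) * sigma_lower B d s x
        + ennreal r * (ennreal (C2 \<delta> * (\<eta> + norm2 m e)) + ennreal (C3 \<delta>) * Tmin B d s A \<Lambda> m e \<eta>)"
    using r C Ee by (simp add: sigma_lower_def Tmin_def r_def[symmetric] Ee_def[symmetric] distrib_left ennreal_mult add.assoc mult.assoc)
  let ?D = "L2_norm B d (\<lambda>p. f p - expansion B d \<Lambda> x p)"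
  have D0: "0 \<le> ?D" by (simp add: L2_norm_def)
  have "ennreal (L2_norm B d (\<lambda>p. f p - expansion B d \<Lambda> xhat p))
     \<le> ennreal (C4 \<delta> / r) * (INF z'\<in>?A. ?F z') + (ennreal (C5 \<delta> * Ee) + ennreal ?D) + ennreal (C6 \<delta>) * (INF z\<in>?B. ?G z)"
  proof (rule ennreal_le_INF_affine2)
    fix z' z assume z': "z' \<in> ?A" and z: "z \<in> ?B"
    have "L2_norm B d (\<lambda>p. f p - expansion B d \<Lambda> xhat p) \<le> C4 \<delta> / r * X z' + (C5 \<delta> * Ee + ?D) + C6 \<delta> * (Z z / r)"
    proof -
      have "2 * C3 \<delta> * (X z' / r) \<le> C4 \<delta> * (X z' / r)" using C X0 r by (intro mult_right_mono) auto
      moreover have "C3 \<delta> * (Z z / r) \<le> C6 \<delta> * (Z z / r)" using C Z0 r by (intro mult_right_mono) auto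
      moreover have "C2 \<delta> * Ee \<le> C5 \<delta> * Ee" using C Ee by (intro mult_right_mono)
      moreover have "C3 \<delta> * (2 * X z' + Z z) / r = 2 * C3 \<delta> * (X z' / r) + C3 \<delta> * (Z z / r)"
        by (simp add: distrib_left add_divide_distrib)
      ultimately show ?thesis
        using L2_norm_error_le[OF f fin \<Lambda>m, of xhat, folded x_def] coeffs(2)[OF z' z] by simp
    qed
    then have "ennreal (L2_norm B d (\<lambda>p. f p - expansion B d \<Lambda> xhat p))
       \<le> ennreal (C4 \<delta> / r * X z' + (C5 \<delta> * Ee + ?D) + C6 \<delta> * (Z z / r))" by (rule ennreal_leI)
    also have "\<dots> = ennreal (C4 \<delta> / r) * ennreal (X z') + (ennreal (C5 \<delta> * Ee) + ennreal ?D) + ennreal (C6 \<delta>) * ?G z"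
    proof -
      have "0 \<le> C5 \<delta>" using C by linarith
      then show ?thesis
        unfolding G[OF z] using C X0 Z0 r Ee D0
        by (simp add: ennreal_mult[symmetric] ennreal_plus[symmetric] del: ennreal_plus)
    qed
    also have "\<dots> \<le> ennreal (C4 \<delta> / r) * ?F z' + (ennreal (C5 \<delta> * Ee) + ennreal ?D) + ennreal (C6 \<delta>) * ?G z"
      using F[OF z' z] by (intro add_right_mono mult_left_mono order.trans[OF _ F[OF z' z]]) auto
    finally show "ennreal (L2_norm B d (\<lambda>p. f p - expansion B d \<Lambda> xhat p))
      \<le> ennreal (C4 \<delta> / r) * ?F z' + (ennreal (C5 \<delta> * Ee) + ennreal ?D) + ennreal (C6 \<delta>) * ?G z" .
  qed (use C r in auto)
  moreover have "ennreal (C4 \<delta>) * (sg / ennreal r) = ennreal (C4 \<delta> / r) * sg" for sg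
  proof -
    have "ennreal (C4 \<delta> / r) = ennreal (C4 \<delta>) / ennreal r" using C r by (simp add: divide_ennreal)
    then show ?thesis by (simp add: divide_ennreal_def mult_ac)
  qed
  ultimately show "ennreal (L2_norm B d (\<lambda>p. f p - expansion B d \<Lambda> xhat p))
      \<le> ennreal (C4 \<delta>) * (sigma_lower B d s x / ennreal r)
        + ennreal (C5 \<delta> * (\<eta> + norm2 m e)) + ennreal (C6 \<delta>) * Tmin B d s A \<Lambda> m e \<eta>
        + ennreal ?D"
    by (simp add: sigma_lower_def Tmin_def r_def[symmetric] Ee_def[symmetric] add_ac)
qed

theorem theorem5p10:
  shows "\<exists>c::real. c > 0 \<and>
    (\<forall>(B::family) (d::nat) (s::nat) (m::nat) (\<delta>::real) (\<epsilon>::real) \<Lambda>.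
       1 \<le> d \<longrightarrow> 0 < \<epsilon> \<longrightarrow> \<epsilon> < 1 \<longrightarrow> 0 < \<delta> \<longrightarrow> \<delta> < 1 \<longrightarrow> rho \<delta> < 1 \<longrightarrow>
       2 \<le> s \<longrightarrow> s \<le> 2 ^ (d + 1) \<longrightarrow> \<Lambda> = HC d s \<longrightarrow>
       real m \<ge> c * real s powr gam B * Lfactor B d s (card \<Lambda>) \<delta> \<epsilon> \<longrightarrow>
       (\<exists>E\<in>sets (sample B d m). measure (sample B d m) E \<ge> 1 - \<epsilon> \<and>
          (\<forall>t\<in>E. \<forall>\<eta>\<ge>0. \<forall>f\<in>L2_Linf B d. \<forall>e y xhat.
             let A = design B d m t;
                 x = fcoeff B d f;
                 g = (\<lambda>p. f p - expansion B d \<Lambda> xhat p);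
                 r = real s powr (gam B / 2);
                 T = Tmin B d s A \<Lambda> m e \<eta>
             in (\<forall>k<m. y k = mat_vec A \<Lambda> (restrict_vec \<Lambda> x) k + e k) \<longrightarrow>
                is_arg_min (l1u B d) (\<lambda>z. z \<in> feasible A \<Lambda> m y \<eta>) xhat \<longrightarrow>
                Linf_norm B d g
                  \<le> ennreal (C1 \<delta>) * sigma_lower B d s x
                    + ennreal r * (ennreal (C2 \<delta> * (\<eta> + norm2 m e)) + ennreal (C3 \<delta>) * T) \<and>
                ennreal (L2_norm B d g)
                  \<le> ennreal (C4 \<delta>) * (sigma_lower B d s x / ennreal r)
                    + ennreal (C5 \<delta> * (\<eta> + norm2 m e)) + ennreal (C6 \<delta>) * T
                    + ennreal (L2_norm B d (\<lambda>p. f p - expansion B d \<Lambda> x p)))))"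
proof (intro exI[of _ "682880 * 7898892 :: real"] conjI allI impI)
  fix B :: family and d s m :: nat and \<delta> \<epsilon> :: real and \<Lambda>
  assume d: "1 \<le> d" and \<epsilon>: "0 < \<epsilon>" "\<epsilon> < 1" and \<delta>: "0 < \<delta>" "\<delta> < 1" and \<rho>: "rho \<delta> < 1"
    and s: "2 \<le> s" and \<Lambda>: "\<Lambda> = HC d s"
    and m: "682880 * 7898892 * real s powr gam B * Lfactor B d s (card \<Lambda>) \<delta> \<epsilon> \<le> real m"
  have \<delta>5: "\<delta> < 1 / 5" using \<rho> \<delta> by (simp add: rho_def)
  from design_rip[OF d s \<delta>(1) \<delta>5 \<epsilon> m[unfolded \<Lambda>]]
  obtain E where E: "E \<in> sets (sample B d m)" "1 - \<epsilon> \<le> measure (sample B d m) E"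
    and rip: "\<And>t. t \<in> E \<Longrightarrow> weighted_rip (design B d m t) (HC d s) m (weight B d) (real s powr (gam B / 2)) \<delta>"
    by auto
  show "\<exists>E\<in>sets (sample B d m). measure (sample B d m) E \<ge> 1 - \<epsilon> \<and>
          (\<forall>t\<in>E. \<forall>\<eta>\<ge>0. \<forall>f\<in>L2_Linf B d. \<forall>e y xhat.
             let A = design B d m t;
                 x = fcoeff B d f;
                 g = (\<lambda>p. f p - expansion B d \<Lambda> xhat p);
                 r = real s powr (gam B / 2);
                 T = Tmin B d s A \<Lambda> m e \<eta>
             in (\<forall>k<m. y k = mat_vec A \<Lambda> (restrict_vec \<Lambda> x) k + e k) \<longrightarrow>
                is_arg_min (l1u B d) (\<lambda>z. z \<in> feasible A \<Lambda> m y \<eta>) xhat \<longrightarrow>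
                Linf_norm B d g
                  \<le> ennreal (C1 \<delta>) * sigma_lower B d s x
                    + ennreal r * (ennreal (C2 \<delta> * (\<eta> + norm2 m e)) + ennreal (C3 \<delta>) * T) \<and>
                ennreal (L2_norm B d g)
                  \<le> ennreal (C4 \<delta>) * (sigma_lower B d s x / ennreal r)
                    + ennreal (C5 \<delta> * (\<eta> + norm2 m e)) + ennreal (C6 \<delta>) * T
                    + ennreal (L2_norm B d (\<lambda>p. f p - expansion B d \<Lambda> x p)))"
    unfolding Let_def \<Lambda>
  proof (intro bexI[OF _ E(1)] conjI[OF E(2)] ballI allI impI)
    fix t \<eta> f e y xhat
    assume t: "t \<in> E" and \<eta>: "0 \<le> \<eta>" and f: "f \<in> L2_Linf B d"
      and y: "\<forall>k<m. y k = mat_vec (design B d m t) (HC d s) (restrict_vec (HC d s) (fcoeff B d f)) k + e k"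
      and min: "is_arg_min (l1u B d) (\<lambda>z. z \<in> feasible (design B d m t) (HC d s) m y \<eta>) xhat"
    note bounds = error_bounds[OF rip[OF t] \<rho> d \<eta> f y[rule_format] min]
    show "Linf_norm B d (\<lambda>p. f p - expansion B d (HC d s) xhat p)
        \<le> ennreal (C1 \<delta>) * sigma_lower B d s (fcoeff B d f)
          + ennreal (real s powr (gam B / 2)) * (ennreal (C2 \<delta> * (\<eta> + norm2 m e))
          + ennreal (C3 \<delta>) * Tmin B d s (design B d m t) (HC d s) m e \<eta>) \<and>
      ennreal (L2_norm B d (\<lambda>p. f p - expansion B d (HC d s) xhat p))
        \<le> ennreal (C4 \<delta>) * (sigma_lower B d s (fcoeff B d f) / ennreal (real s powr (gam B / 2)))
          + ennreal (C5 \<delta> * (\<eta> + norm2 m e)) + ennreal (C6 \<delta>) * Tmin B d s (design B d m t) (HC d s) m e \<eta>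
          + ennreal (L2_norm B d (\<lambda>p. f p - expansion B d (HC d s) (fcoeff B d f) p))"
      using bounds by blast
  qed
qed simp

end
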